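(* For integers $m\ge 1$ and $k\ge 0$ put $$\mathcal{I}_k^m=\int_{0}^{1}x^k \left\{\frac{1}{x}\right\}^m\left(1-\left\{\frac{1}{x}\right\}\right)^m dx .$$ Then, for every $m\ge 1$: (i) for $k\ge 2m$, $$\mathcal{I}_k^m=(-1)^m\Bigg(\frac{1}{(k+1-m)\binom{k-m}{m}}-\frac{2}{k+1}\sum_{j=[m/2]}^{m-1}\frac{\binom{m}{2j+1-m}}{\binom{k}{2j+1}}\zeta(k-2j)\Bigg);$$ (ii) for $k=2m-1$, $$\mathcal{I}_{2m-1}^m=(-1)^m\Bigg(H_{2m}-H_m-\gamma-\frac{1}{m}\sum_{j=[m/2]}^{m-2}\frac{\binom{m}{2j+1-m}}{\binom{2m-1}{2j+1}}\zeta(2m-1-2j)\Bigg);$$ (iii) for $m\le k\le 2m-2$, $$\mathcal{I}_k^m=\frac{(-1)^m}{k+1}\Bigg(p_{m,k}-2\sum_{j=[m/2]}^{[k/2]-1}\frac{\binom{m}{2j+1-m}}{\binom{k}{2j+1}}\zeta(k-2j)-2\gamma\binom{m}{2m-k}\delta\big((k+1)/2,[(k+1)/2]\big)\Bigg)$$ $$\qquad+(-1)^m(k+2)\sum_{j=[m/2]+1}^{m}\binom{m}{2j-m-1}\binom{2j}{k+2}\frac{b_{2j-k-2}}{j};$$ (iv) for $0\le k\le m-1$, $$\mathcal{I}_k^m=(-1)^m(k+2)\sum_{j=[m/2]+1}^{m}\binom{m}{2j-m-1}\binom{2j}{k+2}\frac{b_{2j-k-2}}{j}.$$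
   Context: $\{t\}=t-\lfloor t\rfloor$ denotes the fractional part and $[t]=\lfloor t\rfloor$ the integer part of the real number $t$. $\gamma$ is the Euler--Mascheroni constant, $H_n=\sum_{i=1}^n\frac1i$ the $n$-th harmonic number, $\zeta$ the Riemann zeta function, $\zeta'$ its derivative, and $B_n$ the Bernoulli numbers, $\frac{t}{e^t-1}=\sum_{n\ge0}B_n\frac{t^n}{n!}$ (so $B_1=-1/2$). Further, $\delta(x,y)=1$ if $x=y$ and $\delta(x,y)=0$ if $x\ne y$, and $$p_{m,k}=\sum_{j=m}^{k}\frac{\binom{m}{j-m}}{\binom{k}{j}}.$$ The sequence $a_n$ ($n\ge 0$) is defined by $$a_{n}=\begin{cases}-\zeta'(-n),& n=0,2,4,\dots,\\ \frac{B_{n+1}}{n+1}\left(\frac{\zeta'(n+1)}{\zeta(n+1)}-\log(2\pi)-\gamma\right), & n=1,3,5,\dots,\end{cases}$$ and the sequence $b_n$ ($n\ge 0$) by $$b_n=a_n-\frac{1}{n+1}\sum_{k=1}^{n+1}\binom{n+1}{k}\frac{B_{n+1-k}}{k}.$$ Binomial coefficients $\binom{a}{b}$ with integers $b>a\ge0$ are zero; in particular a summand containing $\binom{2j}{k+2}b_{2j-k-2}$ with $2j<k+2$ is taken to be zero. An empty sum is zero. *)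

theory Defs
  imports "HOL-Analysis.Analysis"
begin

(* The Riemann zeta function as the analytic continuation of its Dirichlet series to the
   punctured plane; it is unique by the identity theorem once a value is fixed at the pole 1,
   and that value (here 0) is never used. *)
definition riemann_zeta :: "complex \<Rightarrow> complex" where
  "riemann_zeta = (THE f. f holomorphic_on (- {1}) \<and>
     (\<forall>s. Re s > 1 \<longrightarrow> (\<lambda>n. 1 / of_nat (Suc n) powr s) sums f s) \<and> f 1 = 0)"

(* zeta and its derivative are real at the integers below, so Re only changes the type. *)
definition zeta_nat :: "nat \<Rightarrow> real" where
  "zeta_nat n = Re (riemann_zeta (of_nat n))"

definition zeta'_int :: "int \<Rightarrow> real" where
  "zeta'_int n = Re (deriv riemann_zeta (of_int n))"

(* Exponential generating function t / (exp t - 1), hence bernoulli 1 = -1/2. *)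
definition bernoulli :: "nat \<Rightarrow> real" where
  "bernoulli n = fact n * fps_nth (fps_X / (fps_exp 1 - 1)) n"

definition delta :: "real \<Rightarrow> real \<Rightarrow> real" where
  "delta x y = (if x = y then 1 else 0)"

definition p_sum :: "nat \<Rightarrow> nat \<Rightarrow> real" where
  "p_sum m k = (\<Sum>j=m..k. real (m choose (j - m)) / real (k choose j))"

definition a_seq :: "nat \<Rightarrow> real" where
  "a_seq n =
     (if even n then - zeta'_int (- int n)
      else bernoulli (n + 1) / real (n + 1) *
        (zeta'_int (int n + 1) / zeta_nat (n + 1) - ln (2 * pi) - euler_mascheroni))"

definition b_seq :: "nat \<Rightarrow> real" where
  "b_seq n = a_seq n - 1 / real (n + 1) *
     (\<Sum>k=1..n+1. real ((n + 1) choose k) * bernoulli (n + 1 - k) / real k)"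

definition frac_integral :: "nat \<Rightarrow> nat \<Rightarrow> real" where
  "frac_integral m k = integral {0..1} (\<lambda>x::real. x ^ k * frac (1 / x) ^ m * (1 - frac (1 / x)) ^ m)"

(* The common sum in the cases k < 2m - 1. Natural-number subtraction only truncates in
   2j - k - 2 when 2j < k + 2, where the factor (2j choose k + 2) vanishes. *)
definition b_sum :: "nat \<Rightarrow> nat \<Rightarrow> real" where
  "b_sum m k = (\<Sum>j=m div 2 + 1..m. real (m choose (2 * j - m - 1)) *
     real ((2 * j) choose (k + 2)) * (b_seq (2 * j - k - 2) / real j))"

end

theory Submission
  imports Defs "HOL-Complex_Analysis.Complex_Analysis" "HOL-Real_Asymp.Real_Asymp"
begin

text \<open>Substituting \<open>x = 1/t\<close> turns the integral into \<open>F (k + 2)\<close>, where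
  \<open>F s = \<integral>\<^sub>1\<^sup>\<infinity> {t}\<^sup>m (1 - {t})\<^sup>m t\<^sup>-\<^sup>s dt\<close> is holomorphic for \<open>Re s > 1\<close>. For large \<open>s\<close>, integrating by
  parts on each unit interval until the polynomial \<open>P u = u\<^sup>m (1 - u)\<^sup>m\<close> is used up writes \<open>F s\<close> as a finite
  combination of the \<open>\<zeta> (s - i - 1)\<close>, \<open>i\<close> odd, over falling factorials of \<open>s - 1\<close>; the identity theorem extends this to
  \<open>Re s > 1\<close>. As \<open>s \<rightarrow> k + 2\<close> the terms with \<open>i \<ge> k\<close> have simple poles which cancel, because \<open>F\<close> is finite, and
  whose constant terms contribute \<open>\<gamma>\<close>, \<open>\<zeta>'(-n)\<close> and harmonic numbers. The functional equation
  rewrites \<open>\<zeta>'(-n) + H\<^sub>n \<zeta>(-n)\<close> as \<open>(-1)\<^sup>n\<^sup>+\<^sup>1 a\<^sub>n\<close>, and the symmetry \<open>P (1 - u) = P u\<close> turns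
  the remaining harmonic numbers into the Bernoulli sums in \<open>b\<^sub>n\<close>.

  The zeta function is continued through \<open>\<Gamma>(s) \<zeta>(s) = \<integral>\<^sub>0\<^sup>\<infinity> t\<^sup>s\<^sup>-\<^sup>1 / (e\<^sup>t - 1) dt\<close>, expanding the
  integrand into Bernoulli numbers on \<open>[0, 1]\<close>. On the strip \<open>-1 < s < 0\<close> the same representation, together with the
  partial fractions of \<open>1 / (e\<^sup>t - 1)\<close>, gives the functional equation.\<close>

section \<open>Series of integrals of Dirichlet type\<close>

text \<open>The termwise formula cannot be used at s = k + 2 for small k: the series for zeta(s - i
  - 1) diverges once i \<ge> k, and the products of the factors s - l vanish once i > k. Hence F is
  treated as a function of a complex variable, and the integer is approached from the right instead
  of being inserted. As \<open>riemann_zeta\<close> is a definite description, existence and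
  uniqueness of the continuation must be settled before anything can be said about it. The
  functional equation enters because \<open>a_seq\<close> at odd n is written with zeta'(n + 1),
  whereas the limit produces zeta'(-n); it is first proved for real s in (1, 2), where all terms of
  the integrated series are nonnegative, and then extended. The symmetry of P enters because the
  limit leaves a harmonic number for every i > k, even or odd, while the claimed sum runs over odd i
  only.\<close>

lemma continuous_on_integrand_powr:
  fixes \<phi> :: "real \<Rightarrow> real"
  assumes "continuous_on {0..1} \<phi>" and "a > 0"
  shows "continuous_on {0..1} (\<lambda>u. of_real (\<phi> u) * of_real (a + u) powr (- s :: complex))"
  using assms by (intro continuous_intros) (auto simp del: of_real_add)

lemma holomorphic_integral_powr:
  fixes \<phi> :: "real \<Rightarrow> real"
  assumes cont: "continuous_on {0..1} \<phi>" and "a > 0"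
  shows "(\<lambda>s. integral {0..1} (\<lambda>u. of_real (\<phi> u) * of_real (a + u) powr (- s))) holomorphic_on (UNIV :: complex set)"
proof -
  have "(\<lambda>s. integral (cbox 0 1) (\<lambda>u. of_real (\<phi> u) * of_real (a + u) powr (- s))) holomorphic_on (UNIV :: complex set)"
  proof (rule leibniz_rule_holomorphic)
    fix s :: complex and u :: real
    assume u: "u \<in> cbox 0 1"
    with \<open>a > 0\<close> have "a + u > 0" by auto
    then have eq: "of_real (a + u) powr (- s) = exp (- s * of_real (ln (a + u)))" for s :: complex
      by (simp add: powr_def Ln_of_real del: of_real_add)
    show "((\<lambda>s. of_real (\<phi> u) * of_real (a + u) powr (- s)) has_field_derivative
        (of_real (\<phi> u) * (of_real (a + u) powr (- s) * of_real (- ln (a + u))))) (at s within UNIV)"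
      unfolding eq by (auto intro!: derivative_eq_intros simp del: of_real_add)
  next
    fix s :: complex
    show "(\<lambda>u. of_real (\<phi> u) * of_real (a + u) powr (- s)) integrable_on cbox 0 1"
      using continuous_on_integrand_powr[OF cont \<open>a > 0\<close>] by (intro integrable_continuous) simp
  next
    show "continuous_on (UNIV \<times> cbox 0 1) (\<lambda>(s::complex, u). of_real (\<phi> u) * (of_real (a + u) powr (- s) * of_real (- ln (a + u))))"
      using \<open>a > 0\<close> unfolding case_prod_beta
      by (intro continuous_intros continuous_on_compose2[OF cont])
         (auto simp del: of_real_add)
  qed auto
  then show ?thesis by simp
qed

text \<open>The Weierstrass test on closed discs. It serves twice: for the exponentially decaying
  weight \<open>1 / (exp t - 1)\<close>, and for the weight \<open>u ^ m * (1 - u) ^ m\<close>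
  repeated on every unit interval.\<close>

lemma holomorphic_dirichlet_integral_series:
  fixes \<phi> :: "nat \<Rightarrow> real \<Rightarrow> real" and \<sigma>0 :: real
  assumes cont: "\<And>n. continuous_on {0..1} (\<phi> n)"
    and bound: "\<And>n u. u \<in> {0..1} \<Longrightarrow> \<bar>\<phi> n u\<bar> \<le> c n"
    and summ: "\<And>\<sigma>. \<sigma> > \<sigma>0 \<Longrightarrow> summable (\<lambda>n. c n * real (Suc n) powr (- \<sigma>))"
  defines "h \<equiv> \<lambda>n s. integral {0..1} (\<lambda>u. of_real (\<phi> n u) * of_real (real (Suc n) + u) powr (- s) :: complex)"
  shows "(\<lambda>s. \<Sum>n. h n s) holomorphic_on {s. Re s > \<sigma>0}"
    and "\<And>s. Re s > \<sigma>0 \<Longrightarrow> summable (\<lambda>n. h n s)"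
proof -
  have loc: "\<exists>d>0. cball z d \<subseteq> {s. Re s > \<sigma>0} \<and>
      uniform_limit (cball z d) (\<lambda>N s. \<Sum>n<N. h n s) (\<lambda>s. \<Sum>n. h n s) sequentially"
    if z: "z \<in> {s. Re s > \<sigma>0}" for z
  proof -
    define d where "d = (Re z - \<sigma>0) / 2"
    define R where "R = norm z + d"
    define \<sigma> where "\<sigma> = Re z - d"
    have d: "d > 0" using z by (simp add: d_def)
    have sub: "\<sigma> \<le> Re s" "norm s \<le> R" if "s \<in> cball z d" for s
    proof -
      have "norm (z - s) \<le> d" using that by (simp add: dist_norm)
      then show "norm s \<le> R" unfolding R_def using norm_triangle_ineq2[of s z] by (simp add: norm_minus_commute)
      show "\<sigma> \<le> Re s" using abs_Re_le_cmod[of "z - s"] \<open>norm (z - s) \<le> d\<close> by (simp add: \<sigma>_def)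
    qed
    have \<sigma>: "\<sigma> > \<sigma>0" using z by (simp add: \<sigma>_def d_def field_simps)
    have "uniform_limit (cball z d) (\<lambda>N s. \<Sum>n<N. h n s) (\<lambda>s. \<Sum>n. h n s) sequentially"
    proof (rule Weierstrass_m_test)
      fix n s assume s: "s \<in> cball z d"
      have "norm (h n s) \<le> c n * (2 powr R * real (Suc n) powr (- \<sigma>)) * measure lborel (cbox 0 (1::real))"
      proof -
        have "((\<lambda>u. of_real (\<phi> n u) * of_real (real (Suc n) + u) powr (- s)) has_integral h n s) (cbox 0 1)"
          unfolding h_def box_real
          by (intro integrable_integral integrable_continuous_real continuous_on_integrand_powr cont) simp
        then show ?thesis
        proof (rule has_integral_bound[rotated])
          fix u :: real assume u: "u \<in> cbox 0 1"
          define N where "N = real (Suc n)"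
          have N: "N \<ge> 1" by (simp add: N_def)
          have u': "u \<ge> 0" "u \<le> 1" using u by auto
          have "norm (of_real (N + u) powr (- s)) = (N + u) powr (- Re s)"
            using N u' by (subst norm_powr_real_powr) auto
          \<comment> \<open>The exponent \<open>- Re s\<close> may be positive, so
            \<open>N + u\<close> cannot simply be replaced by \<open>N\<close>. As
            \<open>1 + u / N\<close> lies in [1, 2], splitting it off costs at most the factor
            \<open>2 powr R\<close>.\<close>
          also have "\<dots> = (1 + u / N) powr (- Re s) * N powr (- Re s)"
          proof -
            have "N + u = (1 + u / N) * N" using N by (simp add: field_simps)
            then show ?thesis using N u' by (simp add: powr_mult)
          qed
          also have "\<dots> \<le> 2 powr R * N powr (- \<sigma>)"
          proof (rule mult_mono)
            have *: "0 \<le> u / N" "u / N \<le> 1" using N u' by (auto simp: field_simps)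
            have "(1 + u / N) powr (- Re s) \<le> (1 + u / N) powr R"
              using * sub[OF s] abs_Re_le_cmod[of s] by (intro powr_mono) auto
            also have "\<dots> \<le> 2 powr R"
              using * sub[OF s] norm_ge_zero[of s] by (intro powr_mono2) (linarith+)
            finally show "(1 + u / N) powr (- Re s) \<le> 2 powr R" .
            show "N powr (- Re s) \<le> N powr (- \<sigma>)"
              using N sub[OF s] by (intro powr_mono) auto
          qed auto
          finally have "norm (of_real (N + u) powr (- s)) \<le> 2 powr R * N powr (- \<sigma>)" .
          then show "norm (of_real (\<phi> n u) * of_real (real (Suc n) + u) powr (- s)) \<le> c n * (2 powr R * real (Suc n) powr (- \<sigma>))"
            unfolding norm_mult N_def[symmetric] using bound[of u n] u'
            by (intro mult_mono) (auto intro: order_trans[OF abs_ge_zero])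
        next
          have "0 \<le> c n" using bound[of 0 n] abs_ge_zero[of "\<phi> n 0"] by (auto intro: order_trans)
          then show "0 \<le> c n * (2 powr R * real (Suc n) powr (- \<sigma>))" by simp
        qed
      qed
      then show "norm (h n s) \<le> 2 powr R * (c n * real (Suc n) powr (- \<sigma>))" by (simp add: mult_ac)
    next
      show "summable (\<lambda>n. 2 powr R * (c n * real (Suc n) powr (- \<sigma>)))"
        by (intro summable_mult summ \<sigma>)
    qed
    moreover have "cball z d \<subseteq> {s. Re s > \<sigma>0}" using sub(1) \<sigma> by fastforce
    ultimately show ?thesis using d by blast
  qed
  have "open {s. Re s > \<sigma>0}" by (simp add: open_halfspace_Re_gt)
  then show "(\<lambda>s. \<Sum>n. h n s) holomorphic_on {s. Re s > \<sigma>0}"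
  proof (rule holomorphic_uniform_sequence[OF _ _ loc])
    show "(\<lambda>s. \<Sum>n<N. h n s) holomorphic_on {s. Re s > \<sigma>0}" for N
      unfolding h_def
      by (intro holomorphic_on_sum holomorphic_on_subset[OF holomorphic_integral_powr] cont) auto
  qed
  fix s assume "Re s > \<sigma>0"
  then obtain d where d: "d > 0" and ul: "uniform_limit (cball s d) (\<lambda>N s. \<Sum>n<N. h n s) (\<lambda>s. \<Sum>n. h n s) sequentially"
    using loc by blast
  then have "(\<lambda>N. \<Sum>n<N. h n s) \<longlonglongrightarrow> (\<Sum>n. h n s)"
    using tendsto_uniform_limitI[OF ul, of s] d by simp
  then show "summable (\<lambda>n. h n s)" by (auto simp: summable_iff_convergent convergent_def)
qed

section \<open>Bernoulli numbers\<close>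

text \<open>The divisor \<open>fps_exp 1 - 1\<close> has zero constant term and thus no inverse; the
  quotient is exact because its subdegree equals that of \<open>fps_X\<close>.\<close>

lemma bernoulli_series_mult:
  "Abs_fps (\<lambda>n. bernoulli n / fact n) * (fps_exp 1 - 1) = (fps_X :: real fps)"
proof -
  have "fps_exp (1::real) - 1 \<noteq> 0"
  proof
    assume "fps_exp (1::real) - 1 = 0"
    then have "fps_nth (fps_exp (1::real) - 1) 1 = 0" by simp
    then show False by simp
  qed
  moreover have "subdegree (fps_exp (1::real) - 1) = 1" by (intro subdegreeI) auto
  ultimately have "fps_X / (fps_exp 1 - 1) * (fps_exp 1 - 1) = (fps_X :: real fps)"
    by (simp flip: fps_divide_times2 add: fps_divide_times_eq)
  moreover have "Abs_fps (\<lambda>n. bernoulli n / fact n) = fps_X / (fps_exp 1 - 1)"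
    by (simp add: fps_eq_iff bernoulli_def)
  ultimately show ?thesis by simp
qed

text \<open>Coefficient \<open>Suc n\<close> of the product above. The summand with index
  \<open>Suc n\<close> is missing because \<open>fps_exp 1 - 1\<close> has no constant term.\<close>

lemma bernoulli_conv: "(\<Sum>i\<le>n. bernoulli i / fact i / fact (Suc n - i)) = (if n = 0 then 1 else 0)"
proof -
  have "fps_nth (Abs_fps (\<lambda>n. bernoulli n / fact n) * (fps_exp 1 - 1)) (Suc n) = (\<Sum>i=0..Suc n. bernoulli i / fact i * fps_nth (fps_exp 1 - 1) (Suc n - i))"
    by (simp add: fps_mult_nth)
  also have "\<dots> = (\<Sum>i\<le>n. bernoulli i / fact i * fps_nth (fps_exp 1 - 1) (Suc n - i))"
    by (simp add: atMost_atLeast0 mult.commute)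
  also have "\<dots> = (\<Sum>i\<le>n. bernoulli i / fact i / fact (Suc n - i))"
    by (intro sum.cong refl) (simp add: mult.commute)
  finally show ?thesis by (simp add: bernoulli_series_mult)
qed

lemma bernoulli_0: "bernoulli 0 = 1" and bernoulli_1: "bernoulli (Suc 0) = -1/2"
proof -
  show 0: "bernoulli 0 = 1" using bernoulli_conv[of 0] by simp
  show "bernoulli (Suc 0) = -1/2" using bernoulli_conv[of 1] 0 by (simp add: fact_numeral field_simps)
qed

text \<open>Induction over the recurrence works for any ratio \<open>1 / y\<close> with \<open>exp y \<le> 1 + 2 * y\<close>;
  \<open>y = 6/5\<close> makes the ratio smaller than 1.\<close>

lemma bernoulli_bound: "\<bar>bernoulli n / fact n\<bar> \<le> (5/6) ^ n"
proof (induction n rule: less_induct)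
  case (less n)
  define \<beta> where "\<beta> = (\<lambda>n. bernoulli n / fact n :: real)"
  show ?case
  proof (cases "n = 0")
    case True
    then show ?thesis by (simp add: bernoulli_0)
  next
    case False
    have "0 = (\<Sum>i\<le>n. \<beta> i / fact (Suc n - i))" using bernoulli_conv[of n] False by (simp add: \<beta>_def)
    also have "\<dots> = (\<Sum>i<n. \<beta> i / fact (Suc n - i)) + \<beta> n"
      by (simp add: lessThan_Suc_atMost[symmetric])
    finally have "\<bar>\<beta> n\<bar> = \<bar>\<Sum>i<n. \<beta> i / fact (Suc n - i)\<bar>" by simp
    also have "\<dots> \<le> (\<Sum>i<n. (5/6) ^ i / fact (Suc n - i))"
    proof (intro sum_abs[THEN order_trans] sum_mono)
      fix i assume "i \<in> {..<n}"
      then have "\<bar>\<beta> i\<bar> \<le> (5/6) ^ i" using less by (simp add: \<beta>_def)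
      then have "\<bar>\<beta> i\<bar> / fact (Suc n - i) \<le> (5/6) ^ i / fact (Suc n - i)" by (rule divide_right_mono) simp
      then show "\<bar>\<beta> i / fact (Suc n - i)\<bar> \<le> (5/6) ^ i / fact (Suc n - i)" by simp
    qed
    \<comment> \<open>Reversing the sum turns it into a multiple of a partial sum of the exponential
      series at 6/5 without its first two terms.\<close>
    also have "\<dots> = (\<Sum>j<n. (5/6) ^ (n - Suc j) / fact (Suc n - (n - Suc j)))"
      by (rule sum.nat_diff_reindex[symmetric])
    also have "\<dots> = (\<Sum>j<n. (5/6) ^ (n + 1) * ((6/5) ^ (j + 2) / fact (j + 2)))"
    proof (intro sum.cong refl)
      fix j assume j: "j \<in> {..<n}"
      have "n + 1 = (n - Suc j) + (j + 2)" using j by auto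
      then have "(5/6::real) ^ (n + 1) * (6/5) ^ (j + 2) = (5/6) ^ (n - Suc j) * ((5/6) ^ (j + 2) * (6/5) ^ (j + 2))"
        by (metis power_add mult.assoc)
      also have "(5/6::real) ^ (j + 2) * (6/5) ^ (j + 2) = 1" by (simp flip: power_mult_distrib)
      moreover have "Suc n - (n - Suc j) = j + 2" using j by auto
      ultimately show "(5/6::real) ^ (n - Suc j) / fact (Suc n - (n - Suc j)) = (5/6) ^ (n + 1) * ((6/5) ^ (j + 2) / fact (j + 2))"
        by (metis times_divide_eq_right mult.right_neutral)
    qed
    also have "\<dots> = (5/6) ^ (n + 1) * (\<Sum>j<n. (6/5) ^ (j + 2) / fact (j + 2))"
      by (simp add: sum_distrib_left)
    also have "\<dots> \<le> (5/6) ^ (n + 1) * (6/5)"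
    proof (rule mult_left_mono)
      have s: "(\<lambda>n. (6/5::real) ^ n / fact n) sums exp (6/5)"
        using exp_converges[of "6/5::real"] by (simp add: field_simps)
      have "(\<Sum>j<n. (6/5::real) ^ (j + 2) / fact (j + 2)) \<le> (\<Sum>j. (6/5::real) ^ (j + 2) / fact (j + 2))"
        by (rule sum_le_suminf[OF summable_ignore_initial_segment[OF sums_summable[OF s], of 2]]) auto
      also have "\<dots> = exp (6/5) - (1 + 6/5)"
        using sums_split_initial_segment[OF s, of 2] by (simp add: sums_iff numeral_2_eq_2)
      also have "exp (6/5 :: real) \<le> 17/5"
      proof -
        \<comment> \<open>The quadratic bound for exp holds on [0, 1] only, and it is sharp enough
          at the small argument 1/40, where 48/40 = 6/5 and 1641/1600 = 1 + 1/40 + (1/40)^2.\<close>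
        have "exp (6/5 :: real) = exp (1/40) ^ 48" by (simp flip: exp_of_nat_mult)
        also have "exp (1/40 :: real) \<le> 1 + 1/40 + (1/40)\<^sup>2" by (intro exp_bound) auto
        then have "exp (1/40 :: real) ^ 48 \<le> (1641/1600) ^ 48" by (intro power_mono) (auto simp: power2_eq_square)
        also have "(1641/1600 :: real) ^ 48 \<le> 17/5"
          by (simp add: power_divide divide_le_eq)
        finally show ?thesis .
      qed
      finally show "(\<Sum>j<n. (6/5::real) ^ (j + 2) / fact (j + 2)) \<le> 6/5" by simp
    qed simp
    finally show ?thesis by (simp add: \<beta>_def)
  qed
qed

definition bernoulli_quot :: "nat \<Rightarrow> real" where
  "bernoulli_quot n = bernoulli n / fact n"

lemma bernoulli_quot_0: "bernoulli_quot 0 = 1" and bernoulli_quot_1: "bernoulli_quot (Suc 0) = -1/2"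
  by (simp_all add: bernoulli_quot_def bernoulli_0 bernoulli_1)

lemma summable_abs_bernoulli_quot: "summable (\<lambda>n. \<bar>bernoulli_quot n\<bar>)"
  by (rule summable_comparison_test[OF _ summable_geometric[of "5/6::real"]])
     (auto simp: bernoulli_quot_def intro!: exI[of _ 0] order_trans[OF eq_refl bernoulli_bound])

text \<open>The endpoint t = 1 is included because the coefficients are absolutely summable, which
  is what integration over all of [0, 1] requires. The Cauchy product with the series of
  \<open>exp t - 1\<close> collapses to t by \<open>bernoulli_conv\<close>.\<close>

lemma bernoulli_quot_sums:
  assumes "0 < t" "t \<le> 1"
  shows "(\<lambda>n. bernoulli_quot n * t ^ n) sums (t / (exp t - 1))"
proof -
  define a where "a = (\<lambda>n. bernoulli_quot n * t ^ n)"
  define b where "b = (\<lambda>n. t ^ Suc n / fact (Suc n))"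
  have sa: "summable (\<lambda>n. norm (a n))"
    by (rule summable_comparison_test[OF _ summable_abs_bernoulli_quot])
       (use assms in \<open>auto simp: a_def abs_mult power_abs intro!: exI[of _ 0] mult_left_le power_le_one\<close>)
  have e: "(\<lambda>n. t ^ n / fact n) sums exp t" using exp_converges[of t] by (simp add: field_simps)
  have b: "b sums (exp t - 1)" using sums_split_initial_segment[OF e, of 1] by (simp add: b_def)
  have sb: "summable (\<lambda>n. norm (b n))"
    using b assms by (simp add: b_def sums_iff)
  have "(\<lambda>k. \<Sum>i\<le>k. a i * b (k - i)) sums ((\<Sum>k. a k) * (\<Sum>k. b k))"
    by (rule Cauchy_product_sums[OF sa sb])
  also have "(\<lambda>k. \<Sum>i\<le>k. a i * b (k - i)) = (\<lambda>k. if k = 0 then t else 0)"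
  proof
    fix k
    have "(\<Sum>i\<le>k. a i * b (k - i)) = (\<Sum>i\<le>k. t ^ Suc k * (bernoulli i / fact i / fact (Suc k - i)))"
    proof (intro sum.cong refl)
      fix i assume "i \<in> {..k}"
      then have "i \<le> k" by simp
      then have "t ^ i * t ^ Suc (k - i) = t ^ Suc k" "Suc (k - i) = Suc k - i"
        by (simp_all flip: power_add)
      then show "a i * b (k - i) = t ^ Suc k * (bernoulli i / fact i / fact (Suc k - i))"
        unfolding a_def b_def bernoulli_quot_def by (metis (no_types, lifting) mult.assoc mult.commute times_divide_eq_right times_divide_eq_left)
    qed
    also have "\<dots> = t ^ Suc k * (if k = 0 then 1 else 0)" by (simp only: sum_distrib_left[symmetric] bernoulli_conv)
    finally show "(\<Sum>i\<le>k. a i * b (k - i)) = (if k = 0 then t else 0)" by simp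
  qed
  finally have "(\<Sum>k. a k) * (exp t - 1) = t"
    using b sums_unique2[OF _ sums_single[of 0 "\<lambda>_. t"]] by (simp add: sums_iff)
  then have "(\<Sum>k. a k) = t / (exp t - 1)" using assms by (simp add: field_simps)
  then show ?thesis using summable_norm_cancel[OF sa] by (simp add: a_def sums_iff)
qed

section \<open>Removing the poles of the Bernoulli expansion\<close>

lemma pochhammer_rGamma_quotient:
  assumes "s + of_nat n \<noteq> 0"
  shows "pochhammer s n * rGamma (s + of_nat (Suc n)) = rGamma s / (s + of_nat n :: complex)"
proof -
  have "rGamma s = pochhammer s n * ((s + of_nat n) * rGamma (s + of_nat n + 1))"
    by (simp only: rGamma_plus1 pochhammer_rGamma[symmetric])
  then show ?thesis using assms by (simp add: field_simps)
qed

text \<open>This is \<open>rGamma s * (\<Sum>n. B\<^sub>n\<^sub>+\<^sub>1 / (n + 1)! / (s + n))\<close>, with the poles at the nonpositive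
  integers cancelled against the zeros of \<open>rGamma\<close>.\<close>

definition bernoulli_mellin :: "complex \<Rightarrow> complex" where
  "bernoulli_mellin s = (\<Sum>n. of_real (bernoulli_quot (Suc n)) * (pochhammer s n * rGamma (s + of_nat (Suc n))))"

text \<open>On the disc of radius 1 around z every large n satisfies |s + n| \<ge> 1, so the terms
  are eventually bounded by \<open>\<bar>bernoulli_quot (Suc n)\<bar>\<close> times the maximum of
  \<open>rGamma\<close>. The finitely many early terms are harmless, being entire.\<close>

lemma holomorphic_bernoulli_mellin: "bernoulli_mellin holomorphic_on UNIV"
proof (rule holomorphic_uniform_sequence)
  fix z :: complex
  have "bounded (rGamma ` cball z 1)"
    by (intro compact_imp_bounded compact_continuous_image holomorphic_on_imp_continuous_on holomorphic_rGamma compact_cball)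
  then obtain C where C: "norm (rGamma s) \<le> C" if "s \<in> cball z 1" for s
    unfolding bounded_iff by blast
  have "uniform_limit (cball z 1) (\<lambda>N s. \<Sum>n<N. of_real (bernoulli_quot (Suc n)) * (pochhammer s n * rGamma (s + of_nat (Suc n))))
          (\<lambda>s. \<Sum>n. of_real (bernoulli_quot (Suc n)) * (pochhammer s n * rGamma (s + of_nat (Suc n)))) sequentially"
  proof (rule Weierstrass_m_test_ev)
    show "summable (\<lambda>n. \<bar>bernoulli_quot (Suc n)\<bar> * C)"
      using summable_abs_bernoulli_quot by (intro summable_mult2) (subst summable_Suc_iff)
    show "\<forall>\<^sub>F n in sequentially. \<forall>s\<in>cball z 1. norm (of_real (bernoulli_quot (Suc n)) *
             (pochhammer s n * rGamma (s + of_nat (Suc n)))) \<le> \<bar>bernoulli_quot (Suc n)\<bar> * C"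
      using eventually_ge_at_top[of "nat \<lceil>norm z + 2\<rceil>"]
    proof (eventually_elim, intro ballI)
      fix n s assume n: "n \<ge> nat \<lceil>norm z + 2\<rceil>" and s: "s \<in> cball z 1"
      have "norm s \<le> norm z + 1"
        using s norm_triangle_ineq2[of s z] by (auto simp: dist_norm norm_minus_commute)
      moreover have "real n \<ge> norm z + 2" using n by linarith
      moreover have "norm (of_nat n :: complex) - norm s \<le> norm (s + of_nat n)"
        using norm_diff_ineq[of "of_nat n" s] by (simp add: add.commute)
      ultimately have ge: "norm (s + of_nat n) \<ge> 1" by simp
      have "norm (pochhammer s n * rGamma (s + of_nat (Suc n))) = norm (rGamma s) / norm (s + of_nat n)"
        using ge by (subst pochhammer_rGamma_quotient) (auto simp: norm_divide)
      also have "\<dots> \<le> norm (rGamma s) / 1" using ge by (intro divide_left_mono) auto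
      also have "\<dots> \<le> C" using C[OF s] by simp
      finally show "norm (of_real (bernoulli_quot (Suc n)) *
             (pochhammer s n * rGamma (s + of_nat (Suc n)))) \<le> \<bar>bernoulli_quot (Suc n)\<bar> * C"
        by (subst norm_mult) (simp add: mult_left_mono)
    qed
  qed
  then show "\<exists>d>0. cball z d \<subseteq> UNIV \<and> uniform_limit (cball z d) (\<lambda>N s. \<Sum>n<N. of_real (bernoulli_quot (Suc n)) * (pochhammer s n * rGamma (s + of_nat (Suc n))))
      bernoulli_mellin sequentially"
    unfolding bernoulli_mellin_def[abs_def] by (intro exI[of _ 1]) auto
qed (auto simp: pochhammer_prod intro!: holomorphic_intros)

lemma bernoulli_mellin_nonpole:
  assumes "\<And>n. s + of_nat n \<noteq> 0"
  shows "bernoulli_mellin s = rGamma s * (\<Sum>n. of_real (bernoulli_quot (Suc n)) / (s + of_nat n))"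
proof -
  have "summable (\<lambda>n. of_real (bernoulli_quot (Suc n)) / (s + of_nat n))"
  proof (rule summable_comparison_test_ev)
    show "summable (\<lambda>n. \<bar>bernoulli_quot (Suc n)\<bar>)"
      using summable_abs_bernoulli_quot by (subst summable_Suc_iff)
    show "\<forall>\<^sub>F n in sequentially. norm (of_real (bernoulli_quot (Suc n)) / (s + of_nat n)) \<le> \<bar>bernoulli_quot (Suc n)\<bar>"
      using eventually_ge_at_top[of "nat \<lceil>norm s + 1\<rceil>"]
    proof eventually_elim
      fix n assume n: "n \<ge> nat \<lceil>norm s + 1\<rceil>"
      then have "real n \<ge> norm s + 1" by linarith
      moreover have "norm (of_nat n :: complex) - norm s \<le> norm (s + of_nat n)"
        using norm_diff_ineq[of "of_nat n" s] by (simp add: add.commute)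
      ultimately have ge: "norm (s + of_nat n) \<ge> 1" by simp
      have "\<bar>bernoulli_quot (Suc n)\<bar> / norm (s + of_nat n) \<le> \<bar>bernoulli_quot (Suc n)\<bar> / 1"
        using ge by (intro divide_left_mono) auto
      then show "norm (of_real (bernoulli_quot (Suc n)) / (s + of_nat n)) \<le> \<bar>bernoulli_quot (Suc n)\<bar>"
        by (simp add: norm_divide)
    qed
  qed
  then show ?thesis
    unfolding bernoulli_mellin_def
    by (subst pochhammer_rGamma_quotient[OF assms]) (simp add: suminf_mult[symmetric] mult_ac)
qed

text \<open>Only the term with index n survives: for j < n the argument of \<open>rGamma\<close> is
  a nonpositive integer, and for j > n the factor 0 occurs in the Pochhammer symbol.\<close>

lemma bernoulli_mellin_nonpos_int:
  "bernoulli_mellin (- of_nat n) = of_real ((- 1) ^ n * bernoulli (Suc n) / (real n + 1))"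
proof -
  have z: "of_real (bernoulli_quot (Suc j)) * (pochhammer (- of_nat n) j * rGamma (- of_nat n + of_nat (Suc j))) = (0 :: complex)"
    if "j \<noteq> n" for j
  proof (cases "j < n")
    case True
    then have "- of_nat n + of_nat (Suc j) = - (of_nat (n - Suc j) :: complex)"
      by (simp add: of_nat_diff)
    then show ?thesis by (simp add: rGamma_eq_zero_iff del: of_nat_Suc)
  next
    case False
    with that have "pochhammer (- of_nat n :: complex) j = 0"
      by (intro pochhammer_of_nat_eq_0_lemma) auto
    then show ?thesis by simp
  qed
  have "bernoulli_mellin (- of_nat n) = of_real (bernoulli_quot (Suc n)) * (pochhammer (- of_nat n) n * rGamma (- of_nat n + of_nat (Suc n)))"
    unfolding bernoulli_mellin_def
    by (subst suminf_finite[of "{n}"]) (use z in auto)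
  also have "pochhammer (- of_nat n :: complex) n = (-1) ^ n * fact n"
    by (simp add: pochhammer_same)
  also have "- of_nat n + of_nat (Suc n) = (1 :: complex)" by simp
  finally show ?thesis by (simp add: bernoulli_quot_def add_ac mult_ac)
qed

section \<open>Analytic continuation of the zeta function\<close>

text \<open>Integrals and series are evaluated at real arguments only, and this transfers the
  results to complex ones. The midpoint of the interval serves as the accumulation point of the
  identity theorem.\<close>

lemma identity_from_real_interval:
  assumes "open S" "connected S" "f holomorphic_on S" "g holomorphic_on S"
    and "a < b" and sub: "of_real ` {a<..<b} \<subseteq> S"
    and eq: "\<And>x. a < x \<Longrightarrow> x < b \<Longrightarrow> f (of_real x) = g (of_real x)" and "z \<in> S"
  shows "f z = (g z :: complex)"
proof -
  define m where "m = (a + b) / 2"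
  have m: "a < m" "m < b" using \<open>a < b\<close> by (auto simp: m_def)
  have lim: "complex_of_real m islimpt of_real ` {a<..<b}"
  proof (rule islimptI)
    fix T assume T: "complex_of_real m \<in> T" "open T"
    then obtain e where e: "e > 0" "ball (complex_of_real m) e \<subseteq> T" by (auto simp: open_contains_ball)
    define y where "y = m + min (e / 2) ((b - m) / 2)"
    have "(b - m) / 2 > 0" "m + (b - m) / 2 < b" using m by (simp_all add: field_simps)
    then have y: "m < y" "y < b" "\<bar>m - y\<bar> < e"
      using e m by (auto simp: y_def min_def)
    then have "dist (complex_of_real m) (of_real y) < e"
      by (simp only: dist_of_real dist_real_def)
    then have "complex_of_real y \<in> T" using e by auto
    then show "\<exists>y\<in>complex_of_real ` {a<..<b}. y \<in> T \<and> y \<noteq> complex_of_real m"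
      using y m by (intro bexI[of _ "of_real y"]) auto
  qed
  have "f z - g z = 0"
  proof (rule analytic_continuation[of "\<lambda>z. f z - g z" S])
    show "(\<lambda>z. f z - g z) holomorphic_on S" by (intro holomorphic_intros assms)
    show "complex_of_real m \<in> S" using m sub by auto
    show "of_real ` {a<..<b} \<subseteq> S" by (rule sub)
    fix w assume "w \<in> complex_of_real ` {a<..<b}"
    then show "f w - g w = 0" using eq by auto
  qed (fact assms lim)+
  then show ?thesis by simp
qed

text \<open>Links the series of unit-interval integrals, for which holomorphy is known, with the
  improper integral. Nonnegativity makes the truncations increase, so monotone convergence
  applies.\<close>

lemma has_integral_atLeast_unit_intervals:
  fixes g :: "real \<Rightarrow> real"
  assumes nonneg: "\<And>t. t \<ge> 1 \<Longrightarrow> g t \<ge> 0"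
    and int: "\<And>n. ((\<lambda>u. g (real (Suc n) + u)) has_integral e n) {0..1}"
    and "e sums L"
  shows "(g has_integral L) {1..}"
proof -
  have step: "(g has_integral e n) {real (Suc n)..real (Suc (Suc n))}" for n
    using int[of n] has_integral_shift_Icc_real[of g "real (Suc n)" "e n" 0 1]
    by (simp add: o_def add_ac)
  have part: "(g has_integral (\<Sum>n<N. e n)) {1..real (Suc N)}" for N
  proof (induction N)
    case 0
    show ?case by (simp add: has_integral_refl)
  next
    case (Suc N)
    have "(g has_integral ((\<Sum>n<N. e n) + e N)) {1..real (Suc (Suc N))}"
      by (rule has_integral_combine[OF _ _ Suc step]) auto
    then show ?case by simp
  qed
  show ?thesis
  proof (rule has_integral_monotone_convergence_increasing)
    show "((\<lambda>t. if t \<in> {1..real (Suc N)} then g t else 0) has_integral (\<Sum>n<N. e n)) {1..}" for N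
      using part[of N] by (subst has_integral_restrict) auto
    show "(if t \<in> {1..real (Suc N)} then g t else 0) \<le> (if t \<in> {1..real (Suc (Suc N))} then g t else 0)"
      if "t \<in> {1..}" for t N
      using that nonneg by auto
    show "(\<lambda>N. if t \<in> {1..real (Suc N)} then g t else 0) \<longlonglongrightarrow> g t" if "t \<in> {1..}" for t
    proof (rule tendsto_eventually)
      show "\<forall>\<^sub>F N in sequentially. (if t \<in> {1..real (Suc N)} then g t else 0) = g t"
        using eventually_ge_at_top[of "nat \<lceil>t\<rceil>"]
      proof eventually_elim
        fix N assume "nat \<lceil>t\<rceil> \<le> N"
        then have "t \<le> real (Suc N)" by linarith
        then show "(if t \<in> {1..real (Suc N)} then g t else 0) = g t" using that by auto
      qed
    qed
    show "(\<lambda>N. \<Sum>n<N. e n) \<longlonglongrightarrow> L" using \<open>e sums L\<close> by (simp add: sums_def)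
  qed
qed

text \<open>Termwise integration with dominating function \<open>t powr (y - 1)\<close> times the
  sum of the \<open>\<bar>c n\<bar>\<close>, integrable at 0 because y > 0.\<close>

lemma has_integral_powr_times_power_series:
  fixes c :: "nat \<Rightarrow> real"
  assumes c: "summable (\<lambda>n. \<bar>c n\<bar>)" and y: "y > 0"
  shows "((\<lambda>t. t powr (y - 1) * (\<Sum>n. c n * t ^ n)) has_integral (\<Sum>n. c n / (y + real n))) {0..1}"
proof (rule has_integral_dominated_convergence)
  have single: "((\<lambda>t. t powr (y - 1) * (c n * t ^ n)) has_integral c n / (y + real n)) {0..1}" for n
  proof -
    have "((\<lambda>t. t powr (y + real n - 1)) has_integral 1 powr (y + real n - 1 + 1) / (y + real n - 1 + 1)) {0..1}"
      using y by (intro has_integral_powr_from_0) auto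
    then have I: "((\<lambda>t. c n * t powr (y + real n - 1)) has_integral c n / (y + real n)) {0..1}"
      by (drule_tac has_integral_mult_right[of _ _ _ "c n"]) simp
    have eq: "t powr (y - 1) * (c n * t ^ n) = c n * t powr (y + real n - 1)" if "t \<in> {0..1} - {0}" for t
    proof -
      have "t powr (y + real n - 1) = t powr (y - 1) * t powr real n"
        by (simp flip: powr_add add: algebra_simps)
      then show ?thesis using that by (simp add: powr_realpow)
    qed
    show ?thesis by (rule has_integral_spike_finite[of "{0}", OF _ eq I]) simp_all
  qed
  show "((\<lambda>t. t powr (y - 1) * (\<Sum>n<N. c n * t ^ n)) has_integral (\<Sum>n<N. c n / (y + real n))) {0..1}" for N
    unfolding sum_distrib_left by (intro has_integral_sum single) auto
  show "(\<lambda>t. t powr (y - 1) * (\<Sum>n. \<bar>c n\<bar>)) integrable_on {0..1}"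
  proof (rule integrable_on_mult_left)
    show "(\<lambda>t. t powr (y - 1)) integrable_on {0..1}"
      by (rule has_integral_integrable[OF has_integral_powr_from_0]) (use y in auto)
  qed
  have le: "\<bar>c n * t ^ n\<bar> \<le> \<bar>c n\<bar>" if "t \<in> {0..1}" for n t
    using that by (auto simp: abs_mult power_abs intro!: mult_left_le power_le_one)
  show "\<forall>t\<in>{0..1}. norm (t powr (y - 1) * (\<Sum>n<N. c n * t ^ n)) \<le> t powr (y - 1) * (\<Sum>n. \<bar>c n\<bar>)" for N
  proof
    fix t :: real assume t: "t \<in> {0..1}"
    have "\<bar>\<Sum>n<N. c n * t ^ n\<bar> \<le> (\<Sum>n<N. \<bar>c n\<bar>)"
      using le[OF t] by (intro order_trans[OF sum_abs] sum_mono)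
    also have "\<dots> \<le> (\<Sum>n. \<bar>c n\<bar>)" using c by (intro sum_le_suminf) auto
    finally show "norm (t powr (y - 1) * (\<Sum>n<N. c n * t ^ n)) \<le> t powr (y - 1) * (\<Sum>n. \<bar>c n\<bar>)"
      by (simp add: abs_mult mult_left_mono)
  qed
  show "\<forall>t\<in>{0..1}. (\<lambda>N. t powr (y - 1) * (\<Sum>n<N. c n * t ^ n)) \<longlonglongrightarrow> t powr (y - 1) * (\<Sum>n. c n * t ^ n)"
  proof
    fix t :: real assume t: "t \<in> {0..1}"
    have "summable (\<lambda>n. c n * t ^ n)"
      by (rule summable_comparison_test[OF _ c]) (use le[OF t] in auto)
    then show "(\<lambda>N. t powr (y - 1) * (\<Sum>n<N. c n * t ^ n)) \<longlonglongrightarrow> t powr (y - 1) * (\<Sum>n. c n * t ^ n)"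
      by (intro tendsto_intros) (simp add: summable_LIMSEQ)
  qed
  have "summable (\<lambda>n. c n / (y + real n))"
  proof (rule summable_comparison_test[OF _ summable_mult2[OF c, of "1 / y"]])
    have "\<bar>c n\<bar> / (y + real n) \<le> \<bar>c n\<bar> / y" for n using y by (intro divide_left_mono) auto
    then show "\<exists>N. \<forall>n\<ge>N. norm (c n / (y + real n)) \<le> \<bar>c n\<bar> * (1 / y)"
      using y by (auto simp: abs_divide)
  qed
  then show "(\<lambda>N. \<Sum>n<N. c n / (y + real n)) \<longlonglongrightarrow> (\<Sum>n. c n / (y + real n))"
    by (rule summable_LIMSEQ)
qed

text \<open>The integral of \<open>t powr (s - 1) / (exp t - 1)\<close> over [1, infinity), cut into
  unit intervals. The exponent is written \<open>- (1 - s)\<close> to match the general lemma on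
  such series, applied at 1 - s.\<close>

definition exp_tail :: "complex \<Rightarrow> complex" where
  "exp_tail s = (\<Sum>n. integral {0..1} (\<lambda>u. of_real (1 / (exp (real (Suc n) + u) - 1)) * of_real (real (Suc n) + u) powr (- (1 - s))))"

lemma summable_exp_powr: "summable (\<lambda>n. 1 / (exp (real (Suc n)) - 1) * real (Suc n) powr (- \<sigma>))"
proof -
  have "summable (\<lambda>n. 1 / (exp (real n) - 1) * real n powr (- \<sigma>))"
  proof (rule summable_comparison_test_bigo)
    have "exp (- real n / 2) = exp (- 1 / 2) ^ n" for n
      by (simp flip: exp_of_nat_mult)
    then show "summable (\<lambda>n. norm (exp (- real n / 2)))"
      by (simp add: summable_geometric_iff)
    show "(\<lambda>n. 1 / (exp (real n) - 1) * real n powr (- \<sigma>)) \<in> O(\<lambda>n. exp (- real n / 2))"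
      by real_asymp
  qed
  then show ?thesis by (subst (asm) summable_Suc_iff[symmetric])
qed

text \<open>The weight decays faster than any power, so the half-plane of convergence can start
  arbitrarily far to the left.\<close>

lemma
  shows holomorphic_exp_tail: "exp_tail holomorphic_on UNIV"
    and summable_exp_tail: "summable (\<lambda>n. integral {0..1} (\<lambda>u. of_real (1 / (exp (real (Suc n) + u) - 1)) * of_real (real (Suc n) + u) powr (- (1 - s)) :: complex))"
proof -
  define h where "h = (\<lambda>n s. integral {0..1} (\<lambda>u. of_real (1 / (exp (real (Suc n) + u) - 1)) * of_real (real (Suc n) + u) powr (- s) :: complex))"
  have cont: "continuous_on {0..1} (\<lambda>u. 1 / (exp (real (Suc n) + u) - 1))" for n
    by (intro continuous_intros) (auto simp: add_eq_0_iff)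
  have bound: "\<bar>1 / (exp (real (Suc n) + u) - 1)\<bar> \<le> 1 / (exp (real (Suc n)) - 1)" if "u \<in> {0..1}" for n u
  proof -
    have "exp (real (Suc n)) > 1" by simp
    moreover have "exp (real (Suc n) + u) \<ge> exp (real (Suc n))" using that by simp
    ultimately show ?thesis by (simp add: frac_le)
  qed
  have lt: "Re w - 1 < Re w" for w :: complex by simp
  note H = holomorphic_dirichlet_integral_series[OF cont bound summable_exp_powr]
  show "summable (\<lambda>n. integral {0..1} (\<lambda>u. of_real (1 / (exp (real (Suc n) + u) - 1)) * of_real (real (Suc n) + u) powr (- (1 - s)) :: complex))"
    by (rule H(2)[OF _ lt])
  have "(\<lambda>s. \<Sum>n. h n s) holomorphic_on UNIV"
    \<comment> \<open>The convergence lemma works with a fixed abscissa, so each point z gets its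
      own half-plane \<open>Re s > Re z - 1\<close>.\<close>
    unfolding holomorphic_on_def
  proof
    fix z :: complex
    have op: "open {s. Re s > Re z - 1}" by (simp add: open_halfspace_Re_gt)
    have hol: "(\<lambda>s. \<Sum>n. h n s) holomorphic_on {s. Re s > Re z - 1}"
      unfolding h_def by (rule H(1))
    show "(\<lambda>s. \<Sum>n. h n s) field_differentiable (at z within UNIV)"
      by (rule holomorphic_on_imp_differentiable_at[OF hol op]) simp
  qed
  then have "((\<lambda>s. \<Sum>n. h n s) \<circ> (\<lambda>s. 1 - s)) holomorphic_on UNIV"
    by (intro holomorphic_on_compose) (auto intro!: holomorphic_intros elim: holomorphic_on_subset)
  then show "exp_tail holomorphic_on UNIV"
    by (simp add: exp_tail_def[abs_def] h_def o_def)
qed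

lemma exp_tail_of_real:
  obtains e where "exp_tail (of_real x) = of_real e"
    "((\<lambda>t. t powr (x - 1) / (exp t - 1)) has_integral e) {1..}"
proof -
  define g where "g = (\<lambda>t::real. t powr (x - 1) / (exp t - 1))"
  define e where "e = (\<lambda>n. integral {0..1} (\<lambda>u. g (real (Suc n) + u)))"
  have int: "((\<lambda>u. g (real (Suc n) + u)) has_integral e n) {0..1}" for n
    unfolding e_def g_def
    by (intro integrable_integral integrable_continuous_real continuous_intros) (auto simp: add_eq_0_iff)
  have eq: "integral {0..1} (\<lambda>u. of_real (1 / (exp (real (Suc n) + u) - 1)) * of_real (real (Suc n) + u) powr (- (1 - of_real x)) :: complex) = of_real (e n)" for n
  proof (rule integral_unique)
    have "((\<lambda>u. complex_of_real (g (real (Suc n) + u))) has_integral of_real (e n)) {0..1}"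
      using has_integral_linear[OF int bounded_linear_of_real] by (simp add: o_def)
    then show "((\<lambda>u. of_real (1 / (exp (real (Suc n) + u) - 1)) * of_real (real (Suc n) + u) powr (- (1 - of_real x)) :: complex) has_integral of_real (e n)) {0..1}"
    proof (rule has_integral_eq[rotated])
      fix u :: real assume "u \<in> {0..1}"
      then have "real (Suc n) + u > 0" by auto
      then show "complex_of_real (g (real (Suc n) + u)) = of_real (1 / (exp (real (Suc n) + u) - 1)) * of_real (real (Suc n) + u) powr (- (1 - of_real x))"
        using powr_of_real[of "real (Suc n) + u" "x - 1"] unfolding g_def
        by (simp del: of_nat_Suc of_real_add)
    qed
  qed
  have "summable (\<lambda>n. complex_of_real (e n))"
    using summable_exp_tail[of "of_real x"] unfolding eq .
  then have "summable e" by (simp add: summable_of_real_iff)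
  show ?thesis
  proof
    show "exp_tail (of_real x) = of_real (suminf e)"
      unfolding exp_tail_def eq using \<open>summable e\<close> by (simp add: suminf_of_real)
    show "((\<lambda>t. t powr (x - 1) / (exp t - 1)) has_integral suminf e) {1..}"
      using has_integral_atLeast_unit_intervals[OF _ int summable_sums[OF \<open>summable e\<close>]]
      by (simp add: g_def)
  qed
qed

text \<open>The change of variables is a statement about absolutely integrable functions;
  nonnegativity supplies this from plain integrability.\<close>

lemma has_integral_scale_nonneg:
  fixes f :: "real \<Rightarrow> real"
  assumes f: "(f has_integral I) {0..}" and nonneg: "\<And>t. t \<ge> 0 \<Longrightarrow> f t \<ge> 0" and c: "c > 0"
  shows "((\<lambda>t. f (c * t)) has_integral (I / c)) {0..}"
proof -
  have img: "(\<lambda>t. c * t) ` {0..} = {0..}"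
  proof
    show "{0..} \<subseteq> (\<lambda>t. c * t) ` {0..}"
    proof
      fix x :: real assume "x \<in> {0..}"
      then show "x \<in> (\<lambda>t. c * t) ` {0..}" using c by (intro image_eqI[of _ _ "x / c"]) auto
    qed
  qed (use c in auto)
  have "f absolutely_integrable_on {0..}"
    using f nonneg by (intro nonnegative_absolutely_integrable_1) auto
  then have "f absolutely_integrable_on (\<lambda>t. c * t) ` {0..} \<and> integral ((\<lambda>t. c * t) ` {0..}) f = I"
    using f by (simp add: img integral_unique)
  also have "?this \<longleftrightarrow> (\<lambda>t. \<bar>c\<bar> * f (c * t)) absolutely_integrable_on {0..} \<and> integral {0..} (\<lambda>t. \<bar>c\<bar> * f (c * t)) = I"
    using c by (intro has_absolute_integral_change_of_variables_1'[symmetric])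
       (auto intro!: derivative_eq_intros inj_onI)
  finally have "((\<lambda>t. c * f (c * t)) has_integral I) {0..}"
    using c by (auto simp: has_integral_iff intro: set_lebesgue_integral_eq_integral(1))
  from has_integral_divide[OF this, of c] show ?thesis using c by simp
qed

text \<open>\<open>1 / (exp t - 1)\<close> is the geometric series of the
  \<open>exp (- real (Suc n) * t)\<close>, and each term is a rescaled Gamma integral. All terms are
  nonnegative, so the sum may be taken by monotone convergence.\<close>

lemma has_integral_powr_over_exp_minus_1:
  fixes x :: real
  assumes x: "x > 1"
  shows "((\<lambda>t. t powr (x - 1) / (exp t - 1)) has_integral Gamma x * (\<Sum>n. real (Suc n) powr (- x))) {0..}"
proof (rule has_integral_monotone_convergence_increasing)
  have single: "((\<lambda>t. t powr (x - 1) * exp (- real (Suc n) * t)) has_integral Gamma x * real (Suc n) powr (- x)) {0..}" for n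
  proof -
    define c where "c = real (Suc n)"
    have c: "c > 0" by (simp add: c_def)
    have "((\<lambda>t. (c * t) powr (x - 1) / exp (c * t)) has_integral Gamma x / c) {0..}"
      using x c by (intro has_integral_scale_nonneg Gamma_integral_real) auto
    then have "((\<lambda>t. c powr (- (x - 1)) * ((c * t) powr (x - 1) / exp (c * t))) has_integral c powr (- (x - 1)) * (Gamma x / c)) {0..}"
      by (rule has_integral_mult_right)
    moreover have "c powr (- (x - 1)) * (Gamma x / c) = Gamma x * c powr (- x)"
      using c by (simp add: powr_minus powr_diff field_simps)
    moreover have "c powr (- (x - 1)) * ((c * t) powr (x - 1) / exp (c * t)) = t powr (x - 1) * exp (- c * t)" if "t \<in> {0..}" for t
    proof -
      have "c powr (- (x - 1)) * c powr (x - 1) = 1" using c by (simp flip: powr_add)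
      then have "c powr (- (x - 1)) * (c powr (x - 1) * t powr (x - 1) / exp (c * t)) = t powr (x - 1) / exp (c * t)"
        by (simp only: mult.assoc[symmetric] times_divide_eq_right)
      then show ?thesis using c that by (simp add: powr_mult exp_minus divide_inverse)
    qed
    ultimately show ?thesis unfolding c_def[symmetric] by (metis (no_types, lifting) has_integral_cong)
  qed
  show "((\<lambda>t. \<Sum>n<N. t powr (x - 1) * exp (- real (Suc n) * t)) has_integral (\<Sum>n<N. Gamma x * real (Suc n) powr (- x))) {0..}" for N
    by (intro has_integral_sum single) auto
  show "(\<Sum>n<N. t powr (x - 1) * exp (- real (Suc n) * t)) \<le> (\<Sum>n<Suc N. t powr (x - 1) * exp (- real (Suc n) * t))" for N and t :: real
    by simp
  show "(\<lambda>N. \<Sum>n<N. t powr (x - 1) * exp (- real (Suc n) * t)) \<longlonglongrightarrow> t powr (x - 1) / (exp t - 1)" if "t \<in> {0..}" for t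
  \<comment> \<open>At t = 0 the partial sums and the limit are all 0, because
    \<open>0 powr a = 0\<close>.\<close>
  proof (cases "t = 0")
    case False
    with that have t: "t > 0" by auto
    have "(\<lambda>n. exp (- t) ^ n) sums (1 / (1 - exp (- t)))"
      using t by (intro geometric_sums) auto
    then have "(\<lambda>n. t powr (x - 1) * exp (- t) * exp (- t) ^ n) sums (t powr (x - 1) * exp (- t) * (1 / (1 - exp (- t))))"
      by (rule sums_mult)
    also have "(\<lambda>n. t powr (x - 1) * exp (- t) * exp (- t) ^ n) = (\<lambda>n. t powr (x - 1) * exp (- real (Suc n) * t))"
      by (simp add: ring_distribs exp_add exp_of_nat_mult[symmetric] exp_diff exp_minus field_simps)
    also have "t powr (x - 1) * exp (- t) * (1 / (1 - exp (- t))) = t powr (x - 1) / (exp t - 1)"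
      using t by (simp add: exp_minus field_simps)
    finally show ?thesis by (simp add: sums_def)
  qed simp
  have "summable (\<lambda>n. real (Suc n) powr (- x))"
    using x summable_real_powr_iff[of "- x"] by (subst summable_Suc_iff) simp
  then show "(\<lambda>N. \<Sum>n<N. Gamma x * real (Suc n) powr (- x)) \<longlonglongrightarrow> Gamma x * (\<Sum>n. real (Suc n) powr (- x))"
    unfolding sum_distrib_left[symmetric] by (intro tendsto_intros summable_LIMSEQ)
qed

text \<open>The fraction \<open>rGamma s / (s - 1)\<close> is the contribution of the zeroth
  Bernoulli number on [0, 1], \<open>bernoulli_mellin\<close> that of the others. The value 0 at 1
  is the normalisation demanded by \<open>riemann_zeta\<close>.\<close>

definition zeta_cont :: "complex \<Rightarrow> complex" where
  "zeta_cont s = (if s = 1 then 0 else rGamma s / (s - 1) + bernoulli_mellin s + rGamma s * exp_tail s)"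

lemma holomorphic_zeta_cont: "zeta_cont holomorphic_on (- {1})"
proof -
  have "(\<lambda>s. rGamma s / (s - 1) + bernoulli_mellin s + rGamma s * exp_tail s) holomorphic_on (- {1})"
    by (intro holomorphic_intros holomorphic_on_subset[OF holomorphic_bernoulli_mellin]
          holomorphic_on_subset[OF holomorphic_exp_tail]) auto
  then show ?thesis
    by (rule holomorphic_transform) (simp add: zeta_cont_def)
qed

text \<open>Away from the nonpositive integers the factor \<open>rGamma y\<close> can be taken out
  of the Bernoulli series. This form is used for y > 1, to recover the Dirichlet series, and for -1
  < y < 0, to derive the functional equation.\<close>

lemma zeta_cont_of_real:
  assumes "y \<noteq> 1" and nz: "\<And>n. y + real n \<noteq> 0" and e: "((\<lambda>t. t powr (y - 1) / (exp t - 1)) has_integral e) {1..}"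
  shows "zeta_cont (of_real y) = of_real (rGamma y * (1 / (y - 1) + (\<Sum>n. bernoulli_quot (Suc n) / (y + real n)) + e))"
proof -
  have nz': "of_real y + of_nat n \<noteq> (0::complex)" for n
    using nz[of n] by (metis of_real_0 of_real_add of_real_eq_iff of_real_of_nat_eq)
  have "exp_tail (of_real y) = of_real e"
    using exp_tail_of_real[of y] has_integral_unique[OF e] by metis
  moreover have "(\<Sum>n. of_real (bernoulli_quot (Suc n)) / (of_real y + of_nat n)) = complex_of_real (\<Sum>n. bernoulli_quot (Suc n) / (y + real n))"
  proof -
    have "summable (\<lambda>n. bernoulli_quot (Suc n) / (y + real n))"
    proof (rule summable_comparison_test_ev)
      show "summable (\<lambda>n. \<bar>bernoulli_quot (Suc n)\<bar>)"
        using summable_abs_bernoulli_quot by (subst summable_Suc_iff)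
      show "\<forall>\<^sub>F n in sequentially. norm (bernoulli_quot (Suc n) / (y + real n)) \<le> \<bar>bernoulli_quot (Suc n)\<bar>"
        using eventually_ge_at_top[of "nat \<lceil>\<bar>y\<bar> + 1\<rceil>"]
      proof eventually_elim
        fix n assume n: "n \<ge> nat \<lceil>\<bar>y\<bar> + 1\<rceil>"
        then have ge: "y + real n \<ge> 1" by linarith
        have "\<bar>bernoulli_quot (Suc n)\<bar> / \<bar>y + real n\<bar> \<le> \<bar>bernoulli_quot (Suc n)\<bar> / 1"
          using ge by (intro divide_left_mono) auto
        then show "norm (bernoulli_quot (Suc n) / (y + real n)) \<le> \<bar>bernoulli_quot (Suc n)\<bar>"
          by (simp add: abs_divide)
      qed
    qed
    then show ?thesis by (simp add: suminf_of_real)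
  qed
  ultimately show ?thesis
    using assms(1) nz' by (simp add: zeta_cont_def bernoulli_mellin_nonpole rGamma_complex_of_real algebra_simps)
qed

lemma zeta_cont_Mellin:
  assumes x: "x > 1"
  shows "zeta_cont (of_real x) = of_real (\<Sum>n. real (Suc n) powr (- x))"
proof -
  obtain e where e: "((\<lambda>t. t powr (x - 1) / (exp t - 1)) has_integral e) {1..}"
    using exp_tail_of_real[of x] by metis
  have s: "summable (\<lambda>n. bernoulli_quot n / (x - 1 + real n))"
  proof (rule summable_comparison_test)
    show "summable (\<lambda>n. \<bar>bernoulli_quot n\<bar> * (1 / (x - 1)))"
      using summable_abs_bernoulli_quot by (rule summable_mult2)
    have "\<bar>bernoulli_quot n\<bar> / (x - 1 + real n) \<le> \<bar>bernoulli_quot n\<bar> / (x - 1)" for n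
      using x by (intro divide_left_mono) auto
    then show "\<exists>N. \<forall>n\<ge>N. norm (bernoulli_quot n / (x - 1 + real n)) \<le> \<bar>bernoulli_quot n\<bar> * (1 / (x - 1))"
      using x by (simp add: abs_divide)
  qed
  \<comment> \<open>The expansion is that of \<open>t / (exp t - 1)\<close>, so one more power of t
    is split off. The condition \<open>y > 0\<close> of the integration lemma, with y = x - 1, is
    exactly \<open>x > 1\<close>.\<close>
  have "((\<lambda>t. t powr (x - 1 - 1) * (\<Sum>n. bernoulli_quot n * t ^ n)) has_integral (\<Sum>n. bernoulli_quot n / (x - 1 + real n))) {0..1}"
    using x by (intro has_integral_powr_times_power_series summable_abs_bernoulli_quot) auto
  moreover have "t powr (x - 1 - 1) * (\<Sum>n. bernoulli_quot n * t ^ n) = t powr (x - 1) / (exp t - 1)" if "t \<in> {0..1}" for t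
  proof (cases "t = 0")
    case False
    with that have t: "t > 0" "t \<le> 1" by auto
    then show ?thesis using bernoulli_quot_sums[OF t] by (simp add: sums_iff powr_diff power2_eq_square)
  qed simp
  ultimately have "((\<lambda>t. t powr (x - 1) / (exp t - 1)) has_integral (\<Sum>n. bernoulli_quot n / (x - 1 + real n))) {0..1}"
    by (rule has_integral_eq[rotated]) 
  from has_integral_Un[OF this e] have "((\<lambda>t. t powr (x - 1) / (exp t - 1)) has_integral (\<Sum>n. bernoulli_quot n / (x - 1 + real n)) + e) ({0..1} \<union> {1..})"
    by simp
  also have "{0..1} \<union> {1..} = {0::real..}" by auto
  finally have "Gamma x * (\<Sum>n. real (Suc n) powr (- x)) = (\<Sum>n. bernoulli_quot n / (x - 1 + real n)) + e"
    using has_integral_powr_over_exp_minus_1[OF x] has_integral_unique by blast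
  also have "(\<Sum>n. bernoulli_quot n / (x - 1 + real n)) = 1 / (x - 1) + (\<Sum>n. bernoulli_quot (Suc n) / (x + real n))"
    using suminf_split_head[OF s] by (simp add: bernoulli_quot_0 algebra_simps)
  finally have "rGamma x * (1 / (x - 1) + (\<Sum>n. bernoulli_quot (Suc n) / (x + real n)) + e) = rGamma x * Gamma x * (\<Sum>n. real (Suc n) powr (- x))"
    by simp
  also have "rGamma x * Gamma x = 1"
  proof -
    have "Gamma x > 0" using x by (intro Gamma_real_pos) simp
    then show ?thesis by (simp add: rGamma_inverse_Gamma)
  qed
  finally show ?thesis using zeta_cont_of_real[OF _ _ e] x
    by (simp add: add_eq_0_iff)
qed

section \<open>The Dirichlet series and uniqueness of the continuation\<close>

lemma
  shows holomorphic_Dirichlet_zeta: "(\<lambda>s. \<Sum>n. 1 / of_nat (Suc n) powr s :: complex) holomorphic_on {s. Re s > 1}"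
    and summable_Dirichlet_zeta: "Re s > 1 \<Longrightarrow> summable (\<lambda>n. 1 / of_nat (Suc n) powr s :: complex)"
proof -
  have bound: "norm (1 / of_nat (Suc n) powr s :: complex) \<le> real (Suc n) powr (- \<sigma>)" if "\<sigma> \<le> Re s" for n s \<sigma>
  proof -
    have "norm (of_nat (Suc n) powr s :: complex) = real (Suc n) powr Re s"
      using norm_powr_real_powr[of "of_nat (Suc n)" s] by simp
    then have "norm (1 / of_nat (Suc n) powr s :: complex) = real (Suc n) powr (- Re s)"
      by (simp add: norm_divide norm_inverse powr_minus divide_inverse del: of_nat_Suc)
    also have "\<dots> \<le> real (Suc n) powr (- \<sigma>)" using that by (intro powr_mono) auto
    finally show ?thesis .
  qed
  have summ: "summable (\<lambda>n. real (Suc n) powr (- \<sigma>))" if "\<sigma> > 1" for \<sigma>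
    using that summable_real_powr_iff[of "- \<sigma>"] by (subst summable_Suc_iff) simp
  show "Re s > 1 \<Longrightarrow> summable (\<lambda>n. 1 / of_nat (Suc n) powr s :: complex)"
    by (rule summable_comparison_test[OF _ summ[of "Re s"]]) (use bound in auto)
  show "(\<lambda>s. \<Sum>n. 1 / of_nat (Suc n) powr s :: complex) holomorphic_on {s. Re s > 1}"
  proof (rule holomorphic_uniform_sequence)
    show "open {s. Re s > 1}" by (simp add: open_halfspace_Re_gt)
    show "(\<lambda>s. \<Sum>n<N. 1 / of_nat (Suc n) powr s :: complex) holomorphic_on {s. Re s > 1}" for N
      by (intro holomorphic_intros) (auto simp del: of_nat_Suc)
    fix z :: complex assume "z \<in> {s. Re s > 1}"
    then have z: "Re z > 1" by simp
    define d where "d = (Re z - 1) / 2"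
    have d: "d > 0" "Re z - d > 1" using z by (auto simp: d_def field_simps)
    have Re: "Re z - d \<le> Re s" if "s \<in> cball z d" for s
      using that abs_Re_le_cmod[of "z - s"] by (simp add: dist_norm)
    have "uniform_limit (cball z d) (\<lambda>N s. \<Sum>n<N. 1 / of_nat (Suc n) powr s :: complex) (\<lambda>s. \<Sum>n. 1 / of_nat (Suc n) powr s) sequentially"
      by (rule Weierstrass_m_test[OF bound[OF Re] summ[OF d(2)]])
    then show "\<exists>d>0. cball z d \<subseteq> {s. Re s > 1} \<and>
       uniform_limit (cball z d) (\<lambda>N s. \<Sum>n<N. 1 / of_nat (Suc n) powr s :: complex) (\<lambda>s. \<Sum>n. 1 / of_nat (Suc n) powr s) sequentially"
      using d Re by (intro exI[of _ d]) fastforce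
  qed
qed

lemma zeta_cont_sums:
  assumes s: "Re s > 1"
  shows "(\<lambda>n. 1 / of_nat (Suc n) powr s) sums zeta_cont s"
proof -
  have "zeta_cont s = (\<Sum>n. 1 / of_nat (Suc n) powr s)"
  proof (rule identity_from_real_interval[of "{s. Re s > 1}" zeta_cont "\<lambda>s. \<Sum>n. 1 / of_nat (Suc n) powr s" 1 2])
    show "connected {s. Re s > 1}" by (intro convex_connected convex_halfspace_Re_gt)
    show "zeta_cont holomorphic_on {s. Re s > 1}"
      by (rule holomorphic_on_subset[OF holomorphic_zeta_cont]) auto
    fix x :: real assume "1 < x" "x < 2"
    have "complex_of_real (real (Suc n) powr (- x)) = 1 / of_nat (Suc n) powr of_real x" for n
      using powr_of_real[of "real (Suc n)" x] by (simp add: powr_minus divide_inverse del: of_nat_Suc)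
    moreover have "summable (\<lambda>n. real (Suc n) powr (- x))"
      using \<open>1 < x\<close> summable_real_powr_iff[of "- x"] by (subst summable_Suc_iff) simp
    ultimately show "zeta_cont (of_real x) = (\<Sum>n. 1 / of_nat (Suc n) powr of_real x)"
      using zeta_cont_Mellin[OF \<open>1 < x\<close>] by (simp add: suminf_of_real del: of_nat_Suc)
  qed (use s holomorphic_Dirichlet_zeta in \<open>auto simp: open_halfspace_Re_gt\<close>)
  then show ?thesis using summable_Dirichlet_zeta[OF s] by (simp add: sums_iff)
qed

text \<open>Existence is \<open>zeta_cont\<close> itself. Uniqueness holds because the punctured
  plane is connected, so agreement on \<open>Re s > 1\<close> spreads to all of it, and the value at
  1 is prescribed.\<close>

theorem riemann_zeta_eq_zeta_cont: "riemann_zeta = zeta_cont"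
  unfolding riemann_zeta_def
proof (rule the_equality)
  show "zeta_cont holomorphic_on (- {1}) \<and>
     (\<forall>s. Re s > 1 \<longrightarrow> (\<lambda>n. 1 / of_nat (Suc n) powr s) sums zeta_cont s) \<and> zeta_cont 1 = 0"
    using holomorphic_zeta_cont zeta_cont_sums by (auto simp: zeta_cont_def)
  fix f assume f: "f holomorphic_on (- {1}) \<and> (\<forall>s. Re s > 1 \<longrightarrow> (\<lambda>n. 1 / of_nat (Suc n) powr s) sums f s) \<and> f 1 = 0"
  show "f = zeta_cont"
  proof
    fix z
    show "f z = zeta_cont z"
    proof (cases "z = 1")
      case False
      show ?thesis
      proof (rule analytic_continuation_open[of "{s. Re s > 1}" "- {1}" f zeta_cont])
        show "connected (- {1 :: complex})" by (rule connected_punctured_universe) simp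
        have "2 \<in> {s. Re s > 1}" by simp
        then show "{s. Re s > 1} \<noteq> {}" by blast
        fix s assume "s \<in> {s. Re s > 1}"
        then show "f s = zeta_cont s" using f zeta_cont_sums[of s] sums_unique2 by blast
      qed (use f holomorphic_zeta_cont False in \<open>auto simp: open_halfspace_Re_gt\<close>)
    qed (use f in \<open>simp add: zeta_cont_def\<close>)
  qed
qed

lemma holomorphic_riemann_zeta: "riemann_zeta holomorphic_on (- {1})"
  by (simp add: riemann_zeta_eq_zeta_cont holomorphic_zeta_cont)

text \<open>\<open>rGamma\<close> vanishes at the nonpositive integers, so only
  \<open>bernoulli_mellin\<close> contributes.\<close>

lemma riemann_zeta_nonpos_int:
  "riemann_zeta (- of_nat n) = of_real ((- 1) ^ n * bernoulli (Suc n) / (real n + 1))"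
proof -
  have "(- of_nat n :: complex) \<noteq> 1"
    by (metis add.commute neg_eq_iff_add_eq_0 of_nat_1 of_nat_add of_nat_eq_0_iff add_is_0 one_neq_zero)
  then show ?thesis
    by (simp add: riemann_zeta_eq_zeta_cont zeta_cont_def bernoulli_mellin_nonpos_int rGamma_eq_zero_iff)
qed

section \<open>The functional equation\<close>

text \<open>This is the partial fraction series of the cotangent on the imaginary axis. It comes
  from differentiating the reflection formula of the Gamma function, which expresses pi * z * cot(pi
  * z) through Digamma(1 - z) - Digamma(1 + z), and from the limit formula for Digamma.\<close>

lemma sums_partial_fractions_exp:
  fixes x :: real
  assumes x: "x > 0"
  shows "(\<lambda>n. 2 * x / (x\<^sup>2 + (2 * pi * real (Suc n))\<^sup>2)) sums (1 / (exp x - 1) - 1 / x + 1 / 2)"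
proof -
  \<comment> \<open>With this z, \<open>pi * z\<close> is \<open>\<i>\<close> times x / 2, so sine
    and cosine turn into real exponentials. A nonzero imaginary part keeps \<open>1 + z\<close> and
    \<open>1 - z\<close> away from the poles of Digamma.\<close>
  define z where "z = \<i> * of_real (x / (2 * pi))"
  have Im: "Im z \<noteq> 0" using x by (simp add: z_def)
  have [simp]: "z \<noteq> 0" using Im by auto
  have nI: "1 + z \<notin> \<int>\<^sub>\<le>\<^sub>0" "1 - z \<notin> \<int>\<^sub>\<le>\<^sub>0"
    using Im by (auto elim!: nonpos_Ints_cases simp: complex_eq_iff)
  have nz: "1 + z + of_nat n \<noteq> 0" "1 - z + of_nat n \<noteq> 0" for n
    using Im by (auto simp: complex_eq_iff)
  define G where "G = rGamma (1 + z) * rGamma (1 - z)"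
  define S C where "S = sin (of_real pi * z)" and "C = cos (of_real pi * z)"
  have refl: "w * (rGamma (1 + w) * rGamma (1 - w)) = sin (of_real pi * w) / of_real pi" for w :: complex
    using rGamma_reflection_complex[of w] rGamma_plus1[of w] by (simp add: add.commute mult.assoc[symmetric])
  have "((\<lambda>w. w * (rGamma (1 + w) * rGamma (1 - w))) has_field_derivative
          (G + z * (- rGamma (1 + z) * Digamma (1 + z) * rGamma (1 - z) + rGamma (1 + z) * (rGamma (1 - z) * Digamma (1 - z))))) (at z)"
    using nI by (auto intro!: derivative_eq_intros simp: G_def algebra_simps)
  moreover have "((\<lambda>w. sin (of_real pi * w) / of_real pi) has_field_derivative C) (at z)"
    by (auto intro!: derivative_eq_intros simp: C_def)
  ultimately have "G + z * (- rGamma (1 + z) * Digamma (1 + z) * rGamma (1 - z) + rGamma (1 + z) * (rGamma (1 - z) * Digamma (1 - z))) = C"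
    unfolding refl by (rule DERIV_unique)
  then have *: "G * (1 + z * (Digamma (1 - z) - Digamma (1 + z))) = C"
    by (simp add: G_def algebra_simps)
  have G: "z * G = S / of_real pi" using refl[of z] by (simp add: G_def S_def)
  have SC: "S * (1 + z * (Digamma (1 - z) - Digamma (1 + z))) = of_real pi * z * C"
  proof -
    have "S = of_real pi * (z * G)" using G by simp
    then show ?thesis by (simp only: mult.assoc *)
  qed
  have piz: "\<i> * (of_real pi * z) = of_real (- x / 2)"
    by (simp add: z_def field_simps)
  have "S = of_real ((exp (- x / 2) - exp (x / 2)) / 2) / \<i>"
    unfolding S_def sin_exp_eq piz by (simp flip: exp_of_real)
  moreover have "w = \<i> * S" if "S = w / \<i>" for w using that by simp
  ultimately have "of_real ((exp (- x / 2) - exp (x / 2)) / 2) = \<i> * S" by blast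
  then have "of_real ((exp (- x / 2) - exp (x / 2)) / 2) * (1 + z * (Digamma (1 - z) - Digamma (1 + z))) = \<i> * (of_real pi * z) * C"
    by (simp only: SC mult.assoc)
  also have "C = of_real ((exp (- x / 2) + exp (x / 2)) / 2)"
    unfolding C_def cos_exp_eq piz by (simp flip: exp_of_real)
  finally have D: "of_real ((exp (- x / 2) - exp (x / 2)) / 2) * (1 + z * (Digamma (1 - z) - Digamma (1 + z)))
       = of_real (- x / 2) * of_real ((exp (- x / 2) + exp (x / 2)) / 2)"
    unfolding piz .
  have z2: "z\<^sup>2 = - of_real ((x / (2 * pi))\<^sup>2)"
    unfolding z_def power_mult_distrib by simp
  \<comment> \<open>The logarithms in the two limit formulas for Digamma cancel, leaving a
    series.\<close>
  have "(\<lambda>m. (of_real (ln (real m)) - (\<Sum>n<m. inverse (1 - z + of_nat n))) - (of_real (ln (real m)) - (\<Sum>n<m. inverse (1 + z + of_nat n)))) \<longlonglongrightarrow> Digamma (1 - z) - Digamma (1 + z)"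
    using nI by (intro tendsto_diff Digamma_LIMSEQ) auto
  also have "(\<lambda>m. (of_real (ln (real m)) - (\<Sum>n<m. inverse (1 - z + of_nat n))) - (of_real (ln (real m)) - (\<Sum>n<m. inverse (1 + z + of_nat n))))
     = (\<lambda>m. \<Sum>n<m. inverse (1 + z + of_nat n) - inverse (1 - z + of_nat n))"
    by (simp add: sum_subtractf)
  finally have "(\<lambda>n. inverse (1 + z + of_nat n) - inverse (1 - z + of_nat n)) sums (Digamma (1 - z) - Digamma (1 + z))"
    by (simp add: sums_def)
  then have "(\<lambda>n. z * (inverse (1 + z + of_nat n) - inverse (1 - z + of_nat n))) sums (z * (Digamma (1 - z) - Digamma (1 + z)))"
    by (rule sums_mult)
  moreover have "z * (inverse (1 + z + of_nat n) - inverse (1 - z + of_nat n)) = of_real (2 * x\<^sup>2 / (x\<^sup>2 + (2 * pi * real (Suc n))\<^sup>2))" for n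
  proof -
    have "z * (inverse (1 + z + of_nat n) - inverse (1 - z + of_nat n)) = - 2 * z\<^sup>2 / ((1 + of_nat n)\<^sup>2 - z\<^sup>2)"
    proof -
      have "inverse u - inverse v = (v - u) / (u * v)" if "u \<noteq> 0" "v \<noteq> 0" for u v :: complex
        using that by (simp add: field_simps)
      moreover have "(1 + z + of_nat n) * (1 - z + of_nat n) = (1 + of_nat n)\<^sup>2 - z\<^sup>2"
        by (simp add: algebra_simps power2_eq_square)
      moreover have "1 - z + of_nat n - (1 + z + of_nat n) = - 2 * z" by simp
      ultimately show ?thesis using nz[of n] by (simp add: power2_eq_square)
    qed
    also have "\<dots> = of_real (2 * (x / (2 * pi))\<^sup>2 / ((1 + real n)\<^sup>2 + (x / (2 * pi))\<^sup>2))"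
      by (simp add: z2)
    also have "2 * (x / (2 * pi))\<^sup>2 / ((1 + real n)\<^sup>2 + (x / (2 * pi))\<^sup>2) = 2 * x\<^sup>2 / (x\<^sup>2 + (2 * pi * real (Suc n))\<^sup>2)"
    proof -
      have "(1 + real n)\<^sup>2 + (x / (2 * pi))\<^sup>2 = (x\<^sup>2 + (2 * pi * real (Suc n))\<^sup>2) / (2 * pi)\<^sup>2"
        by (simp add: field_simps power2_eq_square)
      then show ?thesis by (simp add: power_divide)
    qed
    finally show ?thesis .
  qed
  ultimately have "(\<lambda>n. of_real (2 * x\<^sup>2 / (x\<^sup>2 + (2 * pi * real (Suc n))\<^sup>2))) sums (z * (Digamma (1 - z) - Digamma (1 + z)))"
    by simp
  \<comment> \<open>In terms of \<open>q = exp (x / 2)\<close> the equation \<open>D\<close> is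
    rational and can be solved for the Digamma difference.\<close>
  moreover define q where "q = exp (x / 2)"
  have q: "q > 1" "exp x = q * q" "exp (- x / 2) = 1 / q"
    using x by (simp_all add: q_def exp_minus field_simps flip: exp_add)
  have "z * (Digamma (1 - z) - Digamma (1 + z)) = of_real (x * (1 / (exp x - 1) - 1 / x + 1 / 2))"
  proof -
    define W where "W = z * (Digamma (1 - z) - Digamma (1 + z))"
    define a b where "a = (1 / q - q) / 2" and "b = (1 / q + q) / 2"
    have Q: "q * q > 1" using q by (metis less_1_mult)
    have aq: "a = (1 - q * q) / (2 * q)" and bq: "b = (q * q + 1) / (2 * q)"
      using q by (simp_all add: a_def b_def field_simps)
    have a: "a \<noteq> 0" using q Q unfolding aq by simp
    have "of_real a * (1 + W) = of_real (- x / 2 * b)"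
      using D unfolding W_def[symmetric] q(3) q_def[symmetric] a_def[symmetric] b_def[symmetric] by simp
    then have "1 + W = of_real (- x / 2 * b) / of_real a" using a by (simp add: field_simps)
    then have "W = of_real (- x / 2 * b / a - 1)" by (simp add: algebra_simps eq_diff_eq)
    also have "- x / 2 * b / a - 1 = x * (1 / (exp x - 1) - 1 / x + 1 / 2)"
    proof -
      have "b / a = (q * q + 1) / (1 - q * q)"
        using q Q by (simp add: aq bq)
      then have "- x / 2 * b / a = - x / 2 * ((q * q + 1) / (1 - q * q))"
        by (simp only: times_divide_eq_right[symmetric])
      also have "(q * q + 1) / (1 - q * q) = - (2 / (q * q - 1) + 1)"
        using Q by (simp add: divide_simps) (simp add: algebra_simps)
      also have "- x / 2 * - (2 / (q * q - 1) + 1) - 1 = x * (1 / (q * q - 1) - 1 / x + 1 / 2)"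
        using x by (simp add: ring_distribs)
      finally show ?thesis unfolding q(2) .
    qed
    finally show ?thesis unfolding W_def .
  qed
  ultimately have "(\<lambda>n. 2 * x\<^sup>2 / (x\<^sup>2 + (2 * pi * real (Suc n))\<^sup>2)) sums (x * (1 / (exp x - 1) - 1 / x + 1 / 2))"
    by (simp only: sums_of_real_iff)
  from sums_divide[OF this, of x] show ?thesis
    using x by (simp add: power2_eq_square)
qed

text \<open>The substitution t = y^2 / (1 + y^2) in the Beta integral with parameters (1 + \<sigma>)
  / 2 and (1 - \<sigma>) / 2. These add up to 1, so the Beta value is given by the reflection
  formula.\<close>

lemma has_integral_powr_over_1_plus_square:
  fixes \<sigma> :: real
  assumes \<sigma>: "-1 < \<sigma>" "\<sigma> < 1"
  shows "((\<lambda>y. y powr \<sigma> / (1 + y\<^sup>2)) has_integral pi / (2 * cos (pi * \<sigma> / 2))) {0..}"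
proof -
  define a b where "a = (1 + \<sigma>) / 2" and "b = (1 - \<sigma>) / 2"
  have ab: "a > 0" "b > 0" "b = 1 - a" using \<sigma> by (auto simp: a_def b_def field_simps)
  define f where "f = (\<lambda>t::real. t powr (a - 1) * (1 - t) powr (b - 1))"
  define g where "g = (\<lambda>y::real. y\<^sup>2 / (1 + y\<^sup>2))"
  have pos: "1 + y\<^sup>2 > 0" for y :: real by (simp add: add_pos_nonneg)
  have nz: "1 + y\<^sup>2 \<noteq> 0" for y :: real using pos[of y] by simp
  have B: "Beta a b = pi / cos (pi * \<sigma> / 2)"
  proof -
    have "complex_of_real (Gamma a * Gamma (1 - a)) = Gamma (of_real a) * Gamma (of_real (1 - a))"
      by (simp only: of_real_mult Gamma_complex_of_real)
    also have "of_real (1 - a) = 1 - complex_of_real a" by simp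
    also have "Gamma (of_real a) * Gamma (1 - of_real a) = of_real pi / sin (of_real pi * complex_of_real a)"
      by (rule Gamma_reflection_complex)
    also have "\<dots> = of_real (pi / sin (pi * a))" by (simp flip: sin_of_real)
    finally have "complex_of_real (Gamma a * Gamma (1 - a)) = of_real (pi / sin (pi * a))" .
    then have "Gamma a * Gamma (1 - a) = pi / sin (pi * a)" by (simp only: of_real_eq_iff)
    moreover have "pi * a = pi / 2 + pi * \<sigma> / 2" by (simp add: a_def field_simps)
    then have "sin (pi * a) = cos (pi * \<sigma> / 2)" by (simp add: sin_add)
    ultimately show ?thesis using ab by (simp add: Beta_def)
  qed
  have img: "g ` {0<..} = {0<..<1}"
  proof
    show "g ` {0<..} \<subseteq> {0<..<1}" using pos by (auto simp: g_def field_simps)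
    show "{0<..<1} \<subseteq> g ` {0<..}"
    proof
      fix t :: real assume t: "t \<in> {0<..<1}"
      then have "1 + t / (1 - t) = 1 / (1 - t)" by (simp add: field_simps)
      then have "g (sqrt (t / (1 - t))) = t" using t by (simp add: g_def)
      then show "t \<in> g ` {0<..}" using t by (intro image_eqI[of _ _ "sqrt (t / (1 - t))"]) auto
    qed
  qed
  have inj: "inj_on g {0<..}"
  proof (rule inj_onI)
    fix u v :: real assume uv: "u \<in> {0<..}" "v \<in> {0<..}" "g u = g v"
    have "1 - g w = inverse (1 + w\<^sup>2)" for w
    proof -
      have "1 - g w = (1 + w\<^sup>2) / (1 + w\<^sup>2) - w\<^sup>2 / (1 + w\<^sup>2)" using nz[of w] by (simp add: g_def)
      also have "\<dots> = inverse (1 + w\<^sup>2)" by (simp only: diff_divide_distrib[symmetric] add_diff_cancel_right' inverse_eq_divide)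
      finally show ?thesis .
    qed
    then have "inverse (1 + u\<^sup>2) = inverse (1 + v\<^sup>2)" using uv(3) by metis
    then have "u\<^sup>2 = v\<^sup>2" by (simp only: inverse_eq_iff_eq add_left_cancel)
    then show "u = v" using uv by (simp add: power2_eq_iff)
  qed
  have int: "(f has_integral Beta a b) {0<..<1}"
    using has_integral_Beta_real[of a b] ab unfolding f_def by (simp add: has_integral_Icc_iff_Ioo)
  then have "f absolutely_integrable_on {0<..<1}"
    by (intro nonnegative_absolutely_integrable_1) (auto simp: f_def)
  then have "f absolutely_integrable_on g ` {0<..} \<and> integral (g ` {0<..}) f = Beta a b"
    using int by (simp add: img integral_unique)
  also have "?this \<longleftrightarrow> (\<lambda>y. \<bar>2 * y / (1 + y\<^sup>2)\<^sup>2\<bar> * f (g y)) absolutely_integrable_on {0<..} \<and> integral {0<..} (\<lambda>y. \<bar>2 * y / (1 + y\<^sup>2)\<^sup>2\<bar> * f (g y)) = Beta a b"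
  proof (rule has_absolute_integral_change_of_variables_1'[symmetric])
    fix y :: real
    show "(g has_field_derivative 2 * y / (1 + y\<^sup>2)\<^sup>2) (at y within {0<..})"
      unfolding g_def using nz[of y]
      by (auto intro!: derivative_eq_intros simp: power2_eq_square divide_simps) (simp add: algebra_simps)
  qed (use inj in auto)
  finally have I: "((\<lambda>y. \<bar>2 * y / (1 + y\<^sup>2)\<^sup>2\<bar> * f (g y)) has_integral Beta a b) {0<..}"
    by (auto simp: has_integral_iff intro: set_lebesgue_integral_eq_integral(1))
  have "\<bar>2 * y / (1 + y\<^sup>2)\<^sup>2\<bar> * f (g y) = 2 * (y powr \<sigma> / (1 + y\<^sup>2))" if "y \<in> {0<..}" for y
  proof -
    define w where "w = 1 + y\<^sup>2"
    have w: "w > 0" using pos by (simp add: w_def)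
    have y: "y > 0" using that by simp
    have "1 - g y = 1 / w" using w by (simp add: g_def w_def field_simps)
    then have "f (g y) = (y\<^sup>2 / w) powr (a - 1) * (1 / w) powr (b - 1)" by (simp add: f_def g_def w_def)
    moreover have "(y\<^sup>2 / w) powr (a - 1) = (y\<^sup>2) powr (a - 1) / w powr (a - 1)"
      using w by (simp add: powr_divide)
    moreover have "(y\<^sup>2) powr (a - 1) = y powr (2 * (a - 1))"
      using powr_powr[of y 2 "a - 1"] y by simp
    moreover have "y powr (2 * (a - 1)) / w powr (a - 1) = y powr (2 * (a - 1)) * w powr (- (a - 1))"
      by (simp only: powr_minus divide_inverse)
    moreover have "(1 / w) powr (b - 1) = w powr (- (b - 1))"
      using w by (simp only: powr_minus divide_inverse powr_mult mult_1 inverse_powr)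
    ultimately have "f (g y) = y powr (2 * (a - 1)) * w powr (- (a - 1) + - (b - 1))"
      by (simp only: powr_add mult.assoc)
    \<comment> \<open>Because a + b = 1, exactly one factor \<open>w = 1 + y\<^sup>2\<close>
      remains, and it reduces the square in the derivative of g to a single power.\<close>
    also have "- (a - 1) + - (b - 1) = 1" using ab by simp
    also have "2 * (a - 1) = \<sigma> - 1" by (simp add: a_def)
    also have "y powr (\<sigma> - 1) = y powr \<sigma> / y" using y by (simp add: powr_diff)
    finally have "f (g y) = y powr \<sigma> / y * w" using w by simp
    then show ?thesis unfolding w_def[symmetric] using w y by (simp add: power2_eq_square[of w])
  qed
  from has_integral_eq[OF this I] have "((\<lambda>y. 2 * (y powr \<sigma> / (1 + y\<^sup>2))) has_integral Beta a b) {0<..}" .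
  moreover have "2 * r / 2 = r" for r :: real by simp
  ultimately have "((\<lambda>y. y powr \<sigma> / (1 + y\<^sup>2)) has_integral Beta a b / 2) {0<..}"
    using has_integral_divide[of "\<lambda>y. 2 * (y powr \<sigma> / (1 + y\<^sup>2))" "Beta a b" "{0<..}" 2] by (simp only:)
  then have "((\<lambda>y. if y \<in> {0<..} then y powr \<sigma> / (1 + y\<^sup>2) else 0) has_integral Beta a b / 2) {0..}"
    by (subst has_integral_restrict) auto
  \<comment> \<open>The endpoint 0 may be added even for negative \<sigma>, since
    \<open>0 powr \<sigma> = 0\<close>.\<close>
  then have "((\<lambda>y. y powr \<sigma> / (1 + y\<^sup>2)) has_integral Beta a b / 2) {0..}"
    by (rule has_integral_eq[rotated]) auto
  then show ?thesis by (simp add: B mult.commute)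
qed

lemma has_integral_cong_value:
  assumes "(f has_integral I) S" "I = J" "\<And>x. x \<in> S \<Longrightarrow> f x = g x"
  shows "(g has_integral J) S"
  using has_integral_eq[OF assms(3) assms(1)] assms(2) by simp

text \<open>Subtracting \<open>1 / t - 1 / 2\<close> makes the integrand O(t^\<sigma>) at 0,
  integrable for \<sigma> > -1. On [1, infinity) the subtracted terms are integrable since \<sigma>
  < 0, and their integrals give precisely the terms \<open>1 / (\<sigma> - 1)\<close> and
  \<open>- 1 / (2 * \<sigma>)\<close> of the continuation.\<close>

lemma riemann_zeta_strip:
  fixes \<sigma> :: real
  assumes \<sigma>: "-1 < \<sigma>" "\<sigma> < 0"
    and I: "((\<lambda>t. t powr (\<sigma> - 1) * (1 / (exp t - 1) - 1 / t + 1 / 2)) has_integral I) {0..}"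
  shows "riemann_zeta (of_real \<sigma>) = of_real (rGamma \<sigma> * I)"
proof -
  let ?K = "\<lambda>t. t powr (\<sigma> - 1) * (1 / (exp t - 1) - 1 / t + 1 / 2)"
  obtain e where e: "((\<lambda>t. t powr (\<sigma> - 1) / (exp t - 1)) has_integral e) {1..}"
    using exp_tail_of_real[of \<sigma>] by metis
  define A where "A = (\<Sum>n. bernoulli_quot (Suc (Suc n)) / (\<sigma> + 1 + real n))"
  have sum2: "summable (\<lambda>n. \<bar>bernoulli_quot (Suc (Suc n))\<bar>)"
    using summable_abs_bernoulli_quot by (subst summable_Suc_iff, subst summable_Suc_iff)
  have "((\<lambda>t. t powr (\<sigma> + 1 - 1) * (\<Sum>n. bernoulli_quot (Suc (Suc n)) * t ^ n)) has_integral A) {0..1}"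
    unfolding A_def by (rule has_integral_powr_times_power_series[OF sum2]) (use \<sigma> in simp)
  then have I0: "(?K has_integral A) {0..1}"
  proof (rule has_integral_eq[rotated])
    fix t :: real assume t: "t \<in> {0..1}"
    show "t powr (\<sigma> + 1 - 1) * (\<Sum>n. bernoulli_quot (Suc (Suc n)) * t ^ n) = ?K t"
    proof (cases "t = 0")
      case False
      with t have t: "t > 0" "t \<le> 1" by auto
      have "(\<lambda>n. bernoulli_quot (n + 2) * t ^ (n + 2)) sums (t / (exp t - 1) - (\<Sum>n<2. bernoulli_quot n * t ^ n))"
        using bernoulli_quot_sums[OF t] by (rule sums_split_initial_segment)
      then have "(\<lambda>n. t\<^sup>2 * (bernoulli_quot (Suc (Suc n)) * t ^ n)) sums (t / (exp t - 1) - (1 - t / 2))"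
        by (simp add: numeral_2_eq_2 bernoulli_quot_0 bernoulli_quot_1 mult_ac)
      from sums_divide[OF this, of "t\<^sup>2"]
      have "(\<Sum>n. bernoulli_quot (Suc (Suc n)) * t ^ n) = (t / (exp t - 1) - (1 - t / 2)) / t\<^sup>2"
        using t by (simp add: sums_iff)
      also have "\<dots> = (1 / (exp t - 1) - 1 / t + 1 / 2) / t"
        using t by (simp add: add_divide_distrib diff_divide_distrib power2_eq_square)
      finally show ?thesis using t by (simp add: powr_diff)
    qed simp
  qed
  have I1: "(?K has_integral (e + 1 / (\<sigma> - 1) - 1 / (2 * \<sigma>))) {1..}"
  proof -
    have 1: "((\<lambda>t. t powr (\<sigma> - 2)) has_integral - (1 powr (\<sigma> - 2 + 1)) / (\<sigma> - 2 + 1)) {1..}"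
      using \<sigma> by (intro has_integral_powr_to_inf) auto
    have 2: "((\<lambda>t. t powr (\<sigma> - 1)) has_integral - (1 powr (\<sigma> - 1 + 1)) / (\<sigma> - 1 + 1)) {1..}"
      using \<sigma> by (intro has_integral_powr_to_inf) auto
    show ?thesis
    proof (rule has_integral_cong_value)
      show "((\<lambda>t. t powr (\<sigma> - 1) / (exp t - 1) - t powr (\<sigma> - 2) + t powr (\<sigma> - 1) / 2) has_integral
        (e - (- (1 powr (\<sigma> - 2 + 1)) / (\<sigma> - 2 + 1)) + (- (1 powr (\<sigma> - 1 + 1)) / (\<sigma> - 1 + 1)) / 2)) {1..}"
        by (intro has_integral_add has_integral_diff has_integral_divide e 1 2)
      show "e - (- (1 powr (\<sigma> - 2 + 1)) / (\<sigma> - 2 + 1)) + (- (1 powr (\<sigma> - 1 + 1)) / (\<sigma> - 1 + 1)) / 2 = e + 1 / (\<sigma> - 1) - 1 / (2 * \<sigma>)"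
        by simp
      fix t :: real assume "t \<in> {1..}"
      then have "t powr (\<sigma> - 2) = t powr (\<sigma> - 1) / t" using powr_diff[of t "\<sigma> - 1" 1] by simp
      then show "t powr (\<sigma> - 1) / (exp t - 1) - t powr (\<sigma> - 2) + t powr (\<sigma> - 1) / 2 = ?K t"
        by (simp add: ring_distribs)
    qed
  qed
  have "(?K has_integral (A + (e + 1 / (\<sigma> - 1) - 1 / (2 * \<sigma>)))) ({0..1} \<union> {1..})"
    by (rule has_integral_Un[OF I0 I1]) simp
  also have "{0..1} \<union> {1..} = {0::real..}" by auto
  finally have I_eq: "I = A + (e + 1 / (\<sigma> - 1) - 1 / (2 * \<sigma>))"
    using has_integral_unique[OF I] by simp
  have "summable (\<lambda>n. bernoulli_quot (Suc n) / (\<sigma> + real n))"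
  proof (subst summable_Suc_iff[symmetric], rule summable_comparison_test)
    show "summable (\<lambda>n. \<bar>bernoulli_quot (Suc (Suc n))\<bar> * (1 / (\<sigma> + 1)))"
      using sum2 by (rule summable_mult2)
    have "\<bar>bernoulli_quot (Suc (Suc n))\<bar> / (\<sigma> + real (Suc n)) \<le> \<bar>bernoulli_quot (Suc (Suc n))\<bar> / (\<sigma> + 1)" for n
      using \<sigma> by (intro divide_left_mono) auto
    then show "\<exists>N. \<forall>n\<ge>N. norm (bernoulli_quot (Suc (Suc n)) / (\<sigma> + real (Suc n))) \<le> \<bar>bernoulli_quot (Suc (Suc n))\<bar> * (1 / (\<sigma> + 1))"
      using \<sigma> by (simp add: abs_divide)
  qed
  from suminf_split_head[OF this] have S: "(\<Sum>n. bernoulli_quot (Suc n) / (\<sigma> + real n)) = - 1 / (2 * \<sigma>) + A"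
    by (simp add: A_def bernoulli_quot_1 add_ac)
  have nz: "\<sigma> + real n \<noteq> 0" for n
    using \<sigma> by (cases n) auto
  have "I = 1 / (\<sigma> - 1) + (\<Sum>n. bernoulli_quot (Suc n) / (\<sigma> + real n)) + e"
    unfolding I_eq S by simp
  moreover have "\<sigma> \<noteq> 1" using \<sigma> by simp
  ultimately show ?thesis
    unfolding riemann_zeta_eq_zeta_cont using zeta_cont_of_real[OF _ nz e] by simp
qed

text \<open>The partial fractions are integrated term by term. Scaling by 2 * pi * (n + 1) reduces
  every term to one integral times a power of n + 1, and these powers sum to zeta(s).\<close>

lemma riemann_zeta_reflection_real:
  fixes s :: real
  assumes s: "1 < s" "s < 2"
  shows "riemann_zeta (1 - of_real s) = 2 * of_real (2 * pi) powr (- of_real s) * cos (of_real (pi / 2) * of_real s) * Gamma (of_real s) * riemann_zeta (of_real s)"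
proof -
  define \<sigma> where "\<sigma> = 1 - s"
  have \<sigma>: "-1 < \<sigma>" "\<sigma> < 0" using s by (auto simp: \<sigma>_def)
  define B where "B = pi / (2 * cos (pi * \<sigma> / 2))"
  let ?K = "\<lambda>t. t powr (\<sigma> - 1) * (1 / (exp t - 1) - 1 / t + 1 / 2)"
  define c where "c = (\<lambda>n. 2 * pi * real (Suc n))"
  have c: "c n > 0" for n by (simp add: c_def)
  have single: "((\<lambda>t. t powr (\<sigma> - 1) * (2 * t / (t\<^sup>2 + (c n)\<^sup>2))) has_integral 2 * B * c n powr (- s)) {0..}" for n
  proof -
    have "((\<lambda>t. (1 / c n * t) powr \<sigma> / (1 + (1 / c n * t)\<^sup>2)) has_integral B / (1 / c n)) {0..}"
      unfolding B_def using \<sigma> c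
      by (intro has_integral_scale_nonneg has_integral_powr_over_1_plus_square) auto
    note I = has_integral_mult_right[OF this, of "2 * c n powr (\<sigma> - 2)"]
    show ?thesis
    proof (rule has_integral_cong_value[OF I])
      have "c n powr (\<sigma> - 2) * c n = c n powr (\<sigma> - 2 + 1)" using c[of n] by (subst powr_add) simp
      then show "2 * c n powr (\<sigma> - 2) * (B / (1 / c n)) = 2 * B * c n powr (- s)"
        by (simp add: \<sigma>_def mult_ac)
      fix t :: real assume t: "t \<in> {0..}"
      show "2 * c n powr (\<sigma> - 2) * ((1 / c n * t) powr \<sigma> / (1 + (1 / c n * t)\<^sup>2)) = t powr (\<sigma> - 1) * (2 * t / (t\<^sup>2 + (c n)\<^sup>2))"
      proof (cases "t = 0")
        case False
        with t have t: "t > 0" by auto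
        have 1: "c n powr (\<sigma> - 2) = c n powr \<sigma> / (c n)\<^sup>2" using c[of n] by (simp add: powr_diff)
        have 2: "(1 / c n * t) powr \<sigma> = t powr \<sigma> / c n powr \<sigma>" using c[of n] t by (simp add: powr_divide)
        have 3: "t powr (\<sigma> - 1) = t powr \<sigma> / t" using t by (simp add: powr_diff)
        have 4: "1 + (1 / c n * t)\<^sup>2 = (t\<^sup>2 + (c n)\<^sup>2) / (c n)\<^sup>2"
          using c[of n] by (simp add: power_divide add_divide_distrib)
        have "2 * (P / q) * ((T / P) / (D / q)) = T / t * (2 * t / D)" if "P \<noteq> 0" "q \<noteq> 0" for P q T D :: real
          using that t by simp
        then show ?thesis unfolding 1 2 3 4 using c[of n] by (metis less_irrefl power_eq_0_iff powr_eq_0_iff)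
      qed simp
    qed
  qed
  have sum: "summable (\<lambda>n. real (Suc n) powr (- s))"
    using s summable_real_powr_iff[of "- s"] by (subst summable_Suc_iff) simp
  define Z where "Z = (\<Sum>n. real (Suc n) powr (- s))"
  have "(?K has_integral 2 * B * ((2 * pi) powr (- s) * Z)) {0..}"
  proof (rule has_integral_monotone_convergence_increasing)
    show "((\<lambda>t. \<Sum>n<N. t powr (\<sigma> - 1) * (2 * t / (t\<^sup>2 + (c n)\<^sup>2))) has_integral (\<Sum>n<N. 2 * B * c n powr (- s))) {0..}" for N
      by (intro has_integral_sum single) auto
    show "(\<Sum>n<N. t powr (\<sigma> - 1) * (2 * t / (t\<^sup>2 + (c n)\<^sup>2))) \<le> (\<Sum>n<Suc N. t powr (\<sigma> - 1) * (2 * t / (t\<^sup>2 + (c n)\<^sup>2)))" if "t \<in> {0..}" for N t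
      using that by simp
    show "(\<lambda>N. \<Sum>n<N. t powr (\<sigma> - 1) * (2 * t / (t\<^sup>2 + (c n)\<^sup>2))) \<longlonglongrightarrow> ?K t" if "t \<in> {0..}" for t
    proof (cases "t = 0")
      case False
      with that have "t > 0" by auto
      from sums_mult[OF sums_partial_fractions_exp[OF this], of "t powr (\<sigma> - 1)"]
      show ?thesis unfolding sums_def c_def .
    qed simp
    have "2 * B * c n powr (- s) = 2 * B * ((2 * pi) powr (- s) * real (Suc n) powr (- s))" for n
      unfolding c_def by (simp add: powr_mult del: of_nat_Suc)
    then have "(\<Sum>n<N. 2 * B * c n powr (- s)) = 2 * B * ((2 * pi) powr (- s) * (\<Sum>n<N. real (Suc n) powr (- s)))" for N
      by (simp only: sum_distrib_left)
    moreover have "(\<lambda>N. 2 * B * ((2 * pi) powr (- s) * (\<Sum>n<N. real (Suc n) powr (- s)))) \<longlonglongrightarrow> 2 * B * ((2 * pi) powr (- s) * Z)"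
      unfolding Z_def by (intro tendsto_intros summable_LIMSEQ sum)
    ultimately show "(\<lambda>N. \<Sum>n<N. 2 * B * c n powr (- s)) \<longlonglongrightarrow> 2 * B * ((2 * pi) powr (- s) * Z)" by simp
  qed
  from riemann_zeta_strip[OF \<sigma> this]
  have r1: "riemann_zeta (of_real \<sigma>) = of_real (rGamma \<sigma> * (2 * B) * (2 * pi) powr (- s) * Z)" by (simp only: mult_ac)
  \<comment> \<open>The Gamma reflection formula produces sin(pi * s); by the double angle formula
    its half-angle sine cancels the denominator of B, leaving the cosine.\<close>
  have r2: "rGamma \<sigma> * (2 * B) = 2 * cos (pi / 2 * s) * Gamma s"
  proof -
    have "complex_of_real (rGamma s * rGamma \<sigma>) = of_real (sin (pi * s) / pi)"
      using rGamma_reflection_complex[of "of_real s"]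
      unfolding of_real_mult rGamma_complex_of_real[symmetric] \<sigma>_def by (simp flip: sin_of_real)
    then have 1: "rGamma s * rGamma \<sigma> = sin (pi * s) / pi" by (simp only: of_real_eq_iff)
    have 2: "sin (pi * s) = 2 * sin (pi / 2 * s) * cos (pi / 2 * s)"
      using sin_double[of "pi / 2 * s"] by simp
    have \<sigma>_eq: "pi * \<sigma> / 2 = pi / 2 - pi / 2 * s" by (simp add: \<sigma>_def field_simps)
    have 3: "cos (pi * \<sigma> / 2) = sin (pi / 2 * s)" unfolding \<sigma>_eq cos_diff by simp
    have 4: "sin (pi / 2 * s) > 0" using s by (intro sin_gt_zero) (auto simp: field_simps)
    have "Gamma s > 0" using s by (intro Gamma_real_pos) simp
    then have "rGamma \<sigma> = Gamma s * (rGamma s * rGamma \<sigma>)" by (simp add: rGamma_inverse_Gamma)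
    also have "\<dots> = Gamma s * (2 * sin (pi / 2 * s) * cos (pi / 2 * s) / pi)" unfolding 1 2 ..
    finally have "rGamma \<sigma> * (2 * B) = Gamma s * (2 * sin (pi / 2 * s) * cos (pi / 2 * s) / pi) * (pi / sin (pi / 2 * s))"
      unfolding B_def 3 by simp
    also have "\<dots> = 2 * cos (pi / 2 * s) * Gamma s" using 4 by simp
    finally show ?thesis .
  qed
  have r3: "riemann_zeta (of_real s) = of_real Z"
    using zeta_cont_Mellin[OF s(1)] by (simp add: riemann_zeta_eq_zeta_cont Z_def)
  have r4: "complex_of_real ((2 * pi) powr (- s)) = of_real (2 * pi) powr (- of_real s)"
    using powr_of_real[of "2 * pi" "- s"] by simp
  have r5: "complex_of_real \<sigma> = 1 - of_real s" by (simp add: \<sigma>_def)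
  have r6: "complex_of_real (cos (pi / 2 * s)) = cos (of_real (pi / 2) * of_real s)"
    by (simp flip: cos_of_real)
  show ?thesis
    unfolding r5[symmetric] r1 r2 r3 r4[symmetric] r6[symmetric] Gamma_complex_of_real
    by (simp only: of_real_mult of_real_numeral mult_ac)
qed

theorem riemann_zeta_reflection:
  assumes s: "Re s > 1"
  shows "riemann_zeta (1 - s) = 2 * of_real (2 * pi) powr (- s) * cos (of_real (pi / 2) * s) * Gamma s * riemann_zeta s"
proof (rule identity_from_real_interval[of "{s. Re s > 1}" "\<lambda>s. riemann_zeta (1 - s)"
    "\<lambda>s. 2 * of_real (2 * pi) powr (- s) * cos (of_real (pi / 2) * s) * Gamma s * riemann_zeta s" 1 2])
  show "connected {s. Re s > 1}" by (intro convex_connected convex_halfspace_Re_gt)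
  show "open {s. Re s > 1}" by (simp add: open_halfspace_Re_gt)
  have "(riemann_zeta \<circ> (\<lambda>s. 1 - s)) holomorphic_on {s. Re s > 1}"
    by (intro holomorphic_on_compose holomorphic_on_subset[OF holomorphic_riemann_zeta] holomorphic_intros) auto
  then show "(\<lambda>s. riemann_zeta (1 - s)) holomorphic_on {s. Re s > 1}" by (simp add: o_def)
  show "(\<lambda>s. 2 * of_real (2 * pi) powr (- s) * cos (of_real (pi / 2) * s) * Gamma s * riemann_zeta s) holomorphic_on {s. Re s > 1}"
    by (intro holomorphic_intros holomorphic_on_subset[OF holomorphic_riemann_zeta])
       (auto elim!: nonpos_Ints_cases)
qed (use s riemann_zeta_reflection_real in auto)

section \<open>Zeta on the real line\<close>

definition real_zeta :: "real \<Rightarrow> real" where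
  "real_zeta x = Re (riemann_zeta (of_real x))"

lemma has_field_derivative_riemann_zeta:
  "s \<noteq> 1 \<Longrightarrow> (riemann_zeta has_field_derivative deriv riemann_zeta s) (at s)"
  using holomorphic_derivI[OF holomorphic_riemann_zeta, of s] by auto

lemma has_real_derivative_real_zeta:
  assumes "x \<noteq> 1"
  shows "(real_zeta has_real_derivative Re (deriv riemann_zeta (of_real x))) (at x)"
  unfolding real_zeta_def[abs_def]
  using has_field_derivative_riemann_zeta[of "of_real x"] assms
  by (intro has_field_derivative_Re has_vector_derivative_real_field) auto

lemma has_real_derivative_real_zeta_nonpos_int:
  "(real_zeta has_real_derivative zeta'_int (- int n)) (at (- real n))"
  using has_real_derivative_real_zeta[of "- real n"] by (simp add: zeta'_int_def)

lemma continuous_real_zeta: "x \<noteq> 1 \<Longrightarrow> isCont real_zeta x"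
  by (rule DERIV_isCont[OF has_real_derivative_real_zeta])

lemma riemann_zeta_of_real_gt_1:
  assumes "x > 1" shows "riemann_zeta (of_real x) = of_real (\<Sum>n. real (Suc n) powr (- x))"
  using zeta_cont_Mellin[OF assms] by (simp only: riemann_zeta_eq_zeta_cont)

lemma summable_Suc_powr: "x > 1 \<Longrightarrow> summable (\<lambda>n. real (Suc n) powr (- x))"
  using summable_real_powr_iff[of "- x"] by (subst summable_Suc_iff) simp

lemma real_zeta_sums:
  assumes "x > 1" shows "(\<lambda>n. real (Suc n) powr (- x)) sums real_zeta x"
  unfolding real_zeta_def riemann_zeta_of_real_gt_1[OF assms] Re_complex_of_real
  by (rule summable_sums[OF summable_Suc_powr[OF assms]])

lemma zeta_nat_eq: "zeta_nat n = real_zeta (real n)"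
  by (simp add: zeta_nat_def real_zeta_def)

lemma real_zeta_nonpos_int:
  "real_zeta (- real n) = (- 1) ^ n * bernoulli (Suc n) / (real n + 1)"
  unfolding real_zeta_def using riemann_zeta_nonpos_int[of n] by simp

text \<open>In the functional equation at s = n + 1 the cosine is taken at an odd multiple of pi /
  2. For n = 0 the point s = 1 is the pole and lies outside the domain.\<close>

lemma real_zeta_neg_even:
  assumes "even n" "n \<noteq> 0"
  shows "real_zeta (- real n) = 0"
proof -
  from assms obtain j where j: "n = 2 * j" by (auto elim: evenE)
  have "cos (of_real (pi / 2) * (of_nat n + 1 :: complex)) = of_real (cos (pi / 2 * (real n + 1)))"
    by (simp flip: cos_of_real)
  also have "pi / 2 * (real n + 1) = real j * pi + pi / 2" by (simp add: j field_simps)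
  also have "cos (real j * pi + pi / 2) = 0" by (simp add: cos_add)
  finally have "riemann_zeta (1 - (of_nat n + 1)) = 0"
    using assms by (subst riemann_zeta_reflection) auto
  then show ?thesis by (simp add: real_zeta_def)
qed

text \<open>The harmonic term is 0 here, either because \<open>harm 0 = 0\<close> or by the trivial
  zeros. It is inserted to give the same expression as for odd n.\<close>

lemma a_seq_eq_even:
  assumes "even n"
  shows "a_seq n = - (zeta'_int (- int n) + harm n * real_zeta (- real n))"
  using assms real_zeta_neg_even[of n] by (cases "n = 0") (auto simp: a_seq_def harm_def)

text \<open>The derivative of the functional equation at s = n + 1. Its factor X has logarithmic
  derivative Digamma(n + 1) - ln(2 * pi) there, and Digamma(n + 1) is
  \<open>harm n - euler_mascheroni\<close>.\<close>

lemma a_seq_eq_odd: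
  assumes "odd n"
  shows "a_seq n = zeta'_int (- int n) + harm n * real_zeta (- real n)"
proof -
  define N where "N = complex_of_nat (Suc n)"
  from assms obtain j where j: "n = 2 * j + 1" by (auto elim: oddE)
  have n: "n \<ge> 1" using j by simp
  define r where "r = real_zeta (- real n)"
  define Z where "Z = zeta_nat (Suc n)"
  have "real (Suc n) > 1" using n by simp
  have ZN: "riemann_zeta N = of_real Z"
    using riemann_zeta_of_real_gt_1[OF \<open>real (Suc n) > 1\<close>] by (simp add: Z_def zeta_nat_def N_def)
  have "Z > 0"
  proof -
    have "0 < (\<Sum>i. real (Suc i) powr (- real (Suc n)))"
      by (rule suminf_pos[OF summable_Suc_powr[OF \<open>real (Suc n) > 1\<close>]]) simp
    then show ?thesis
      using real_zeta_sums[OF \<open>real (Suc n) > 1\<close>] by (simp add: Z_def zeta_nat_eq sums_iff)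
  qed
  define X where "X = (\<lambda>s. 2 * of_real (2 * pi) powr (- s) * cos (of_real (pi / 2) * s) * Gamma s :: complex)"
  have reflX: "riemann_zeta (1 - s) = X s * riemann_zeta s" if "Re s > 1" for s
    using riemann_zeta_reflection[OF that] by (simp only: X_def)
  have ReN: "Re N > 1" using n by (simp add: N_def)
  have N1: "1 - N = - of_nat n" by (simp add: N_def)
  have zr: "riemann_zeta (- of_nat n) = of_real r"
    unfolding r_def real_zeta_nonpos_int by (rule riemann_zeta_nonpos_int)
  \<comment> \<open>For odd n the cosine in X is stationary at N, so it contributes nothing to the
    derivative.\<close>
  have sin0: "sin (of_real (pi / 2) * N) = 0"
  proof -
    have "sin (of_real (pi / 2) * N) = of_real (sin (pi / 2 * real (Suc n)))"
      by (simp add: N_def flip: sin_of_real)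
    also have "pi / 2 * real (Suc n) = real (j + 1) * pi" by (simp add: j field_simps)
    also have "sin (real (j + 1) * pi) = 0" by (rule sin_npi)
    finally show ?thesis by simp
  qed
  have NI: "N \<notin> \<int>\<^sub>\<le>\<^sub>0" using ReN by (auto elim!: nonpos_Ints_cases)
  have two_pi: "complex_of_real (2 * pi) \<noteq> 0" by simp
  have X': "(X has_field_derivative X N * (Digamma N - of_real (ln (2 * pi)))) (at N)"
  proof -
    have e: "complex_of_real (2 * pi) powr (- s) = exp (- s * of_real (ln (2 * pi)))" for s
      by (simp add: powr_def Ln_of_real del: of_real_mult)
    show ?thesis
      unfolding X_def e
      by (rule derivative_eq_intros refl NI | simp only: sin0)+ (simp add: algebra_simps sin0)
  qed
  have D1: "((\<lambda>s. X s * riemann_zeta s) has_field_derivative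
      X N * deriv riemann_zeta N + X N * (Digamma N - of_real (ln (2 * pi))) * riemann_zeta N) (at N)"
    using ReN by (intro DERIV_mult' X' has_field_derivative_riemann_zeta) auto
  have D2: "((\<lambda>s. riemann_zeta (1 - s)) has_field_derivative deriv riemann_zeta (1 - N) * (- 1)) (at N)"
  proof (rule DERIV_chain2[of riemann_zeta])
    have "1 - N \<noteq> 1" using ReN by auto
    then show "(riemann_zeta has_field_derivative deriv riemann_zeta (1 - N)) (at (1 - N))"
      by (rule has_field_derivative_riemann_zeta)
    show "((-) 1 has_field_derivative - 1) (at N)" by (auto intro!: derivative_eq_intros)
  qed
  have "\<forall>\<^sub>F s in nhds N. s \<in> {s. Re s > 1}"
    using ReN by (intro eventually_nhds_in_open) (auto simp: open_halfspace_Re_gt)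
  then have ev: "\<forall>\<^sub>F s in nhds N. riemann_zeta (1 - s) = X s * riemann_zeta s"
    by eventually_elim (rule reflX, simp)
  have "((\<lambda>s. X s * riemann_zeta s) has_field_derivative deriv riemann_zeta (1 - N) * (- 1)) (at N)"
    using D2 unfolding DERIV_cong_ev[OF HOL.refl ev HOL.refl] .
  from DERIV_unique[OF this D1]
  have D: "- deriv riemann_zeta (- of_nat n) = X N * deriv riemann_zeta N + (Digamma N - of_real (ln (2 * pi))) * (X N * riemann_zeta N)"
    unfolding N1 by (simp only: mult_ac mult_minus1 mult_minus1_right)
  have XZ: "X N * riemann_zeta N = of_real r"
    using reflX[OF ReN] zr N1 by simp
  \<comment> \<open>The value of X at N is read off from the functional equation itself, as Z > 0,
    instead of from the explicit factors.\<close>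
  then have XN: "X N = of_real (r / Z)"
    using \<open>Z > 0\<close> unfolding ZN by (simp add: field_simps)
  have "Digamma N = of_real (harm n - euler_mascheroni)"
    unfolding N_def Digamma_of_nat by (simp add: of_real_harm)
  then have "- deriv riemann_zeta (- of_nat n) = of_real (r / Z) * deriv riemann_zeta N + of_real ((harm n - euler_mascheroni - ln (2 * pi)) * r)"
    using D[unfolded XZ, unfolded XN] by (simp only: of_real_diff of_real_mult)
  then have "Re (- deriv riemann_zeta (- of_nat n)) = Re (of_real (r / Z) * deriv riemann_zeta N + of_real ((harm n - euler_mascheroni - ln (2 * pi)) * r))"
    by (rule arg_cong)
  then have "- Re (deriv riemann_zeta (- of_nat n)) = r / Z * Re (deriv riemann_zeta N) + (harm n - euler_mascheroni - ln (2 * pi)) * r"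
    by (simp only: uminus_complex.sel plus_complex.sel times_complex.sel Re_complex_of_real Im_complex_of_real mult_zero_left diff_0_right)
  then have "zeta'_int (- int n) + harm n * r = - r * (zeta'_int (int n + 1) / Z - ln (2 * pi) - euler_mascheroni)"
    unfolding zeta'_int_def N_def by (simp add: algebra_simps)
  moreover have "r = - (bernoulli (n + 1) / real (n + 1))"
    unfolding r_def real_zeta_nonpos_int using assms by simp
  ultimately show ?thesis
    using assms by (simp add: a_seq_def r_def[symmetric] Z_def)
qed

text \<open>The subtracted quotient in d is the integral of x^(-1-\<epsilon>) from n + 1 to n + 2;
  these quotients telescope to 1 / \<epsilon>. The differences are bounded by 2 / (n + 1)^2
  uniformly in \<epsilon>, so limit and sum may be interchanged, and the limits of the terms form a
  series for \<open>euler_mascheroni\<close>.\<close>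

lemma real_zeta_near_1:
  "((\<lambda>\<epsilon>. real_zeta (1 + \<epsilon>) - 1 / \<epsilon>) \<longlongrightarrow> euler_mascheroni) (at_right 0)"
proof -
  define d where "d = (\<lambda>n \<epsilon>. real (Suc n) powr (- (1 + \<epsilon>)) - (real (Suc n) powr (- \<epsilon>) - real (Suc (Suc n)) powr (- \<epsilon>)) / \<epsilon>)"
  define d0 where "d0 = (\<lambda>n. inverse (real (n + 1)) + ln (real (n + 1)) - ln (real (n + 2)))"
  have bound: "\<bar>d n \<epsilon>\<bar> \<le> 2 * real (Suc n) powr (- 2)" if \<epsilon>: "\<epsilon> \<in> {0<..<1}" for n \<epsilon>
  proof -
    define a where "a = real (Suc n)"
    have a: "a \<ge> 1" by (simp add: a_def)
    \<comment> \<open>The mean value theorem is applied twice: first to write the quotient as a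
      value of x^(-\<epsilon>-1), then to compare that value with the one at a.\<close>
    have "\<exists>z>a. z < a + 1 \<and> (a + 1) powr (- \<epsilon>) - a powr (- \<epsilon>) = (a + 1 - a) * (- \<epsilon> * z powr (- \<epsilon> - 1))"
      using a by (intro MVT2) (auto intro!: derivative_eq_intros)
    then obtain z where z: "z > a" "z < a + 1" "(a + 1) powr (- \<epsilon>) - a powr (- \<epsilon>) = - \<epsilon> * z powr (- \<epsilon> - 1)"
      by auto
    have "(a powr (- \<epsilon>) - (a + 1) powr (- \<epsilon>)) / \<epsilon> = z powr (- \<epsilon> - 1)" using z(3) \<epsilon> by (simp add: field_simps)
    then have d: "d n \<epsilon> = a powr (- \<epsilon> - 1) - z powr (- \<epsilon> - 1)"
    proof -
      have "real (Suc (Suc n)) = a + 1" "- (1 + \<epsilon>) = - \<epsilon> - 1" by (simp_all add: a_def)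
      then show ?thesis
        using \<open>(a powr (- \<epsilon>) - (a + 1) powr (- \<epsilon>)) / \<epsilon> = z powr (- \<epsilon> - 1)\<close> unfolding d_def a_def[symmetric]
        by (simp only:)
    qed
    have "\<exists>y>a. y < z \<and> z powr (- \<epsilon> - 1) - a powr (- \<epsilon> - 1) = (z - a) * ((- \<epsilon> - 1) * y powr (- \<epsilon> - 1 - 1))"
      using a z by (intro MVT2) (auto intro!: derivative_eq_intros)
    then obtain y where y: "y > a" "y < z" "d n \<epsilon> = (z - a) * ((\<epsilon> + 1) * y powr (- \<epsilon> - 2))"
      unfolding d by (auto simp: algebra_simps)
    have "\<bar>d n \<epsilon>\<bar> = (z - a) * ((\<epsilon> + 1) * y powr (- \<epsilon> - 2))"
      unfolding y(3) using z y \<epsilon> by simp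
    also have "\<dots> \<le> 1 * (2 * a powr (- 2))"
    proof (intro mult_mono)
      have "y powr (- \<epsilon> - 2) \<le> y powr (- 2)" using y a \<epsilon> by (intro powr_mono) auto
      also have "\<dots> \<le> a powr (- 2)" using y a by (intro powr_mono2') auto
      finally show "y powr (- \<epsilon> - 2) \<le> a powr (- 2)" .
    qed (use z \<epsilon> in auto)
    finally show ?thesis by (simp add: a_def)
  qed
  have lim: "(d n \<longlongrightarrow> d0 n) (at_right 0)" for n
  proof -
    define a where "a = real (Suc n)"
    have a: "a > 0" by (simp add: a_def)
    have "((\<lambda>\<epsilon>. a powr (- \<epsilon>) - (a + 1) powr (- \<epsilon>)) has_real_derivative (- ln a + ln (a + 1))) (at 0)"
      using a by (auto intro!: derivative_eq_intros)
    then have "((\<lambda>\<epsilon>. (a powr (- \<epsilon>) - (a + 1) powr (- \<epsilon>)) / \<epsilon>) \<longlongrightarrow> - ln a + ln (a + 1)) (at 0)"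
      using a by (simp add: DERIV_def)
    then have 1: "((\<lambda>\<epsilon>. (a powr (- \<epsilon>) - (a + 1) powr (- \<epsilon>)) / \<epsilon>) \<longlongrightarrow> - ln a + ln (a + 1)) (at_right 0)"
      by (rule filterlim_mono) (auto intro: at_le)
    have "((\<lambda>\<epsilon>. a powr (- (1 + \<epsilon>))) \<longlongrightarrow> a powr (- (1 + 0))) (at_right 0)"
      using a by (intro tendsto_intros) auto
    note 2 = tendsto_diff[OF this 1]
    have a1: "real (Suc (Suc n)) = a + 1" by (simp add: a_def)
    have "d n = (\<lambda>\<epsilon>. a powr (- (1 + \<epsilon>)) - (a powr (- \<epsilon>) - (a + 1) powr (- \<epsilon>)) / \<epsilon>)"
      unfolding d_def a1 a_def ..
    moreover have "d0 n = a powr (- (1 + 0)) - (- ln a + ln (a + 1))"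
      by (simp add: d0_def a_def powr_minus add_ac)
    ultimately show ?thesis using 2 by (simp only:)
  qed
  have sums: "(\<lambda>n. d n \<epsilon>) sums (real_zeta (1 + \<epsilon>) - 1 / \<epsilon>)" if \<epsilon>: "\<epsilon> > 0" for \<epsilon>
  proof -
    have "(\<lambda>n. real (Suc n) powr (- \<epsilon>)) \<longlonglongrightarrow> 0"
      using \<epsilon> by real_asymp
    from telescope_sums'[OF this]
    have "(\<lambda>n. real (Suc n) powr (- \<epsilon>) - real (Suc (Suc n)) powr (- \<epsilon>)) sums 1" by simp
    from sums_diff[OF real_zeta_sums sums_divide[OF this, of \<epsilon>], of "1 + \<epsilon>"] \<epsilon>
    show ?thesis by (simp only: d_def less_add_same_cancel1)
  qed
  have "((\<lambda>\<epsilon>. \<Sum>n. d n \<epsilon>) \<longlongrightarrow> euler_mascheroni) (at_right 0)"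
  proof (rule swap_uniform_limit'[where F = sequentially and S = "{0<..<1}"])
    show "\<forall>\<^sub>F N in sequentially. ((\<lambda>\<epsilon>. \<Sum>n<N. d n \<epsilon>) \<longlongrightarrow> (\<Sum>n<N. d0 n)) (at_right 0)"
      by (intro always_eventually allI tendsto_sum lim)
    show "(\<lambda>N. \<Sum>n<N. d0 n) \<longlonglongrightarrow> euler_mascheroni"
      using euler_mascheroni_sum_real by (simp only: sums_def d0_def)
    show "uniform_limit {0<..<1} (\<lambda>N \<epsilon>. \<Sum>n<N. d n \<epsilon>) (\<lambda>\<epsilon>. \<Sum>n. d n \<epsilon>) sequentially"
    proof (rule Weierstrass_m_test)
      show "summable (\<lambda>n. 2 * real (Suc n) powr (- 2))"
        by (intro summable_mult summable_Suc_powr) simp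
    qed (use bound in auto)
    show "\<forall>\<^sub>F \<epsilon> in at_right 0. \<epsilon> \<in> {0<..<1::real}"
      by (rule eventually_at_right_real) simp
  qed simp
  moreover have "\<forall>\<^sub>F \<epsilon> in at_right 0. (\<Sum>n. d n \<epsilon>) = real_zeta (1 + \<epsilon>) - 1 / \<epsilon>"
    using eventually_at_right_less[of "0::real"] by eventually_elim (use sums in \<open>simp add: sums_iff\<close>)
  ultimately show ?thesis by (rule Lim_transform_eventually)
qed

section \<open>Harmonic numbers, Bernoulli numbers and binomial sums\<close>

text \<open>Pascal's rule and absorption turn the step from n to n + 1 into an alternating binomial
  sum without its first term, which equals 1 and is divided by n + 1.\<close>

lemma alternating_binomial_harm:
  "(\<Sum>l=1..n. (- 1) ^ (l + 1) * real (n choose l) / real l) = harm n"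
proof (induction n)
  case (Suc n)
  have "(\<Sum>l=1..Suc n. (- 1) ^ (l + 1) * real (Suc n choose l) / real l)
      = (\<Sum>l=1..Suc n. (- 1) ^ (l + 1) * real (n choose l) / real l + (- 1) ^ (l + 1) * real (Suc n choose l) / real (Suc n))"
  proof (intro sum.cong refl)
    fix l assume "l \<in> {1..Suc n}"
    then obtain i where l: "l = Suc i" by (cases l) auto
    have "real (Suc i) * real (Suc n choose Suc i) = real (Suc n) * real (n choose i)"
      using Suc_times_binomial[of i n] by (metis of_nat_mult)
    then have "real (n choose i) / real (Suc i) = real (Suc n choose Suc i) / real (Suc n)"
      by (simp add: field_simps del: of_nat_Suc binomial_Suc_Suc)
    then have "real (Suc n choose l) / real l = real (n choose l) / real l + real (Suc n choose l) / real (Suc n)"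
      unfolding l by (simp add: add_divide_distrib del: of_nat_Suc)
    then show "(- 1) ^ (l + 1) * real (Suc n choose l) / real l = (- 1) ^ (l + 1) * real (n choose l) / real l + (- 1) ^ (l + 1) * real (Suc n choose l) / real (Suc n)"
      by (simp only: times_divide_eq_right[symmetric] distrib_left)
  qed
  also have "\<dots> = (\<Sum>l=1..n. (- 1) ^ (l + 1) * real (n choose l) / real l) + (\<Sum>l=1..Suc n. (- 1) ^ (l + 1) * real (Suc n choose l)) / real (Suc n)"
  proof -
    have "(\<Sum>l=1..Suc n. (- 1) ^ (l + 1) * real (n choose l) / real l) = (\<Sum>l=1..n. (- 1) ^ (l + 1) * real (n choose l) / real l)"
      by simp
    then show ?thesis by (simp only: sum.distrib sum_divide_distrib)
  qed
  also have "(\<Sum>l=1..Suc n. (- 1) ^ (l + 1) * real (Suc n choose l)) = 1"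
  proof -
    have "0 = (\<Sum>l\<le>Suc n. (- 1) ^ l * real (Suc n choose l))"
      using choose_alternating_sum[of "Suc n", where ?'a = real] by simp
    also have "\<dots> = 1 + (\<Sum>l=1..Suc n. (- 1) ^ l * real (Suc n choose l))"
      by (simp add: atMost_atLeast0 sum.atLeast_Suc_atMost[of 0] del: sum.cl_ivl_Suc binomial_Suc_Suc)
    finally show ?thesis by (simp add: sum_negf)
  qed
  finally show ?case using Suc.IH by (simp add: harm_Suc inverse_eq_divide)
qed (simp add: harm_def)

text \<open>The value is \<open>\<integral>\<^sub>0\<^sup>1 (B\<^sub>n\<^sub>+\<^sub>1(x) - B\<^sub>n\<^sub>+\<^sub>1) / ((n + 1) x) dx\<close>, and the recurrence below expresses
  that \<open>x\<^sup>n\<close> is the forward difference of \<open>(B\<^sub>n\<^sub>+\<^sub>1(x) - B\<^sub>n\<^sub>+\<^sub>1) / (n + 1)\<close>.\<close>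

definition bernoulli_harm :: "nat \<Rightarrow> real" where
  "bernoulli_harm n = 1 / real (n + 1) * (\<Sum>k=1..n+1. real ((n + 1) choose k) * bernoulli (n + 1 - k) / real k)"

lemma bernoulli_harm_recurrence:
  assumes "j \<ge> 1"
  shows "(\<Sum>n<j. real (j choose n) * bernoulli_harm n) = 1 / real j"
proof -
  define T where "T = (\<lambda>l t. fact j / fact l * (bernoulli t / fact t / fact (Suc (j - l) - t)) / real l)"
  have "(\<Sum>n<j. real (j choose n) * bernoulli_harm n) = (\<Sum>n<j. \<Sum>l=1..n+1. T l (n + 1 - l))"
  proof (intro sum.cong refl)
    fix n assume n: "n \<in> {..<j}"
    have "real (j choose n) * bernoulli_harm n = (\<Sum>l=1..n+1. real (j choose n) * (1 / real (n + 1) * (real ((n + 1) choose l) * bernoulli (n + 1 - l) / real l)))"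
      unfolding bernoulli_harm_def sum_distrib_left ..
    also have "\<dots> = (\<Sum>l=1..n+1. T l (n + 1 - l))"
    proof (intro sum.cong refl)
      fix l assume l: "l \<in> {1..n+1}"
      have e: "Suc (j - l) - (n + 1 - l) = j - n" using l n by auto
      have b1: "real (j choose n) = fact j / (fact n * fact (j - n))" using n by (intro binomial_fact) auto
      have b2: "real ((n + 1) choose l) = real (n + 1) * fact n / (fact l * fact (n + 1 - l))"
        using l binomial_fact[of l "n + 1", where ?'a = real] by simp
      have "F / (f * g) * (1 / N * (N * f / c * B / L)) = F / x * (B / y / g) / L"
        if "f \<noteq> 0" "N \<noteq> 0" "c = x * y" for F f g N c B L x y :: real
        using that by simp
      then show "real (j choose n) * (1 / real (n + 1) * (real ((n + 1) choose l) * bernoulli (n + 1 - l) / real l)) = T l (n + 1 - l)"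
        unfolding T_def e b1 b2 by (metis fact_nonzero of_nat_eq_0_iff add_is_0 one_neq_zero)
    qed
    finally show "real (j choose n) * bernoulli_harm n = (\<Sum>l=1..n+1. T l (n + 1 - l))" .
  qed
  \<comment> \<open>After the exchange, the sum for fixed l is a complete Bernoulli convolution in t
    = n + 1 - l, which vanishes unless l = j.\<close>
  also have "\<dots> = (\<Sum>l=1..j. \<Sum>n\<in>{l-1..<j}. T l (n + 1 - l))"
    unfolding sum.Sigma[OF finite_lessThan ballI[OF finite_atLeastAtMost]] sum.Sigma[OF finite_atLeastAtMost ballI[OF finite_atLeastLessThan]]
    by (rule sum.reindex_bij_witness[of _ "\<lambda>(l, n). (n, l)" "\<lambda>(n, l). (l, n)"]) auto
  also have "\<dots> = (\<Sum>l=1..j. \<Sum>t\<le>j-l. T l t)"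
  proof (rule sum.cong[OF refl])
    fix l assume "l \<in> {1..j}"
    then show "(\<Sum>n\<in>{l-1..<j}. T l (n + 1 - l)) = (\<Sum>t\<le>j-l. T l t)"
      by (intro sum.reindex_bij_witness[of _ "\<lambda>t. t + l - 1" "\<lambda>n. n + 1 - l"]) auto
  qed
  also have "\<dots> = (\<Sum>l=1..j. fact j / fact l / real l * (\<Sum>t\<le>j-l. bernoulli t / fact t / fact (Suc (j - l) - t)))"
    by (simp add: T_def sum_distrib_left mult_ac)
  also have "\<dots> = (\<Sum>l=1..j. if l = j then 1 / real j else 0)"
    unfolding bernoulli_conv by (intro sum.cong) auto
  also have "\<dots> = 1 / real j" using assms by simp
  finally show ?thesis .
qed

text \<open>The hypothesis says that the polynomial \<open>\<Sum>n\<le>N. q n * x ^ n\<close> is \<open>(-1) ^ K\<close>-symmetric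
  under \<open>x \<mapsto> 1 - x\<close>.\<close>

lemma harm_sum_eq_bernoulli_harm_sum:
  fixes q :: "nat \<Rightarrow> real"
  assumes sym: "\<And>l. l \<le> N \<Longrightarrow> (\<Sum>n=l..N. real (n choose l) * q n) = (- 1) ^ (K + l) * q l"
  shows "(- 1) ^ K * (\<Sum>n\<le>N. q n * harm n) = (\<Sum>n\<le>N. (1 - (- 1) ^ (n + K)) * q n * bernoulli_harm n)"
proof -
  \<comment> \<open>Expanding \<open>harm n\<close> into binomial coefficients brings the double sum
    into the form to which the symmetry hypothesis applies.\<close>
  have "(\<Sum>n\<le>N. q n * harm n) = (\<Sum>n\<le>N. \<Sum>l=1..n. q n * ((- 1) ^ (l + 1) * real (n choose l) / real l))"
    by (simp only: alternating_binomial_harm[symmetric] sum_distrib_left)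
  also have "\<dots> = (\<Sum>l=1..N. \<Sum>n=l..N. q n * ((- 1) ^ (l + 1) * real (n choose l) / real l))"
    unfolding sum.Sigma[OF finite_atMost ballI[OF finite_atLeastAtMost]] sum.Sigma[OF finite_atLeastAtMost ballI[OF finite_atLeastAtMost]]
    by (rule sum.reindex_bij_witness[of _ "\<lambda>(l, n). (n, l)" "\<lambda>(n, l). (l, n)"]) auto
  also have "\<dots> = (\<Sum>l=1..N. (- 1) ^ (l + 1) / real l * (\<Sum>n=l..N. real (n choose l) * q n))"
    by (simp add: sum_distrib_left mult_ac)
  also have "\<dots> = (\<Sum>l=1..N. - ((- 1) ^ K) * (q l / real l))"
  proof (intro sum.cong refl)
    fix l assume "l \<in> {1..N}"
    then have "(- 1) ^ (l + 1) / real l * (\<Sum>n=l..N. real (n choose l) * q n) = ((- 1) ^ (l + 1) * (- 1) ^ (K + l)) * (q l / real l)"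
      using sym[of l] by simp
    also have "(- 1) ^ (l + 1) * (- 1) ^ (K + l) = (- 1 :: real) ^ (K + 1 + 2 * l)"
    proof -
      have "(l + 1) + (K + l) = K + 1 + 2 * l" by simp
      then show ?thesis by (simp only: power_add[symmetric])
    qed
    also have "\<dots> = - ((- 1) ^ K)" by (simp add: power_add)
    finally show "(- 1) ^ (l + 1) / real l * (\<Sum>n=l..N. real (n choose l) * q n) = - ((- 1) ^ K) * (q l / real l)" .
  qed
  also have "\<dots> = - ((- 1) ^ K) * (\<Sum>l=1..N. q l / real l)" by (simp only: sum_distrib_left)
  finally have "(- 1) ^ K * (\<Sum>n\<le>N. q n * harm n) = - ((- 1) ^ K * (- 1) ^ K) * (\<Sum>l=1..N. q l / real l)"
    by simp
  also have "(- 1) ^ K * (- 1) ^ K = (1 :: real)" by (simp flip: power_mult_distrib)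
  \<comment> \<open>The symmetry is used a second time: writing 1 / l through the recurrence and
    exchanging sums gives the hypothesis again, now without its diagonal term.\<close>
  also have "(\<Sum>l=1..N. q l / real l) = (\<Sum>l=1..N. \<Sum>n<l. q l * (real (l choose n) * bernoulli_harm n))"
    by (intro sum.cong refl) (simp add: bernoulli_harm_recurrence flip: sum_distrib_left)
  also have "\<dots> = (\<Sum>n\<le>N. \<Sum>l\<in>{n<..N}. q l * (real (l choose n) * bernoulli_harm n))"
    unfolding sum.Sigma[OF finite_atMost ballI[OF finite_greaterThanAtMost]] sum.Sigma[OF finite_atLeastAtMost ballI[OF finite_lessThan]]
    by (rule sum.reindex_bij_witness[of _ "\<lambda>(l, n). (n, l)" "\<lambda>(n, l). (l, n)"]) auto
  also have "\<dots> = (\<Sum>n\<le>N. ((- 1) ^ (n + K) - 1) * q n * bernoulli_harm n)"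
  proof (intro sum.cong refl)
    fix n assume n: "n \<in> {..N}"
    have "(\<Sum>l\<in>{n<..N}. q l * (real (l choose n) * bernoulli_harm n)) = (\<Sum>l\<in>{n<..N}. real (l choose n) * q l) * bernoulli_harm n"
      by (simp add: sum_distrib_left mult_ac)
    also have "(\<Sum>l\<in>{n<..N}. real (l choose n) * q l) = (\<Sum>l=n..N. real (l choose n) * q l) - q n"
      using n by (simp add: sum.head)
    also have "\<dots> = ((- 1) ^ (n + K) - 1) * q n" using sym[of n] n by (simp add: algebra_simps)
    finally show "(\<Sum>l\<in>{n<..N}. q l * (real (l choose n) * bernoulli_harm n)) = ((- 1) ^ (n + K) - 1) * q n * bernoulli_harm n" .
  qed
  finally show ?thesis by (simp add: sum_negf[symmetric] algebra_simps)
qed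

text \<open>Euler's integral \<open>\<integral>\<^sub>0\<^sup>1 x\<^sup>a (1 - x)\<^sup>b dx\<close>.\<close>

definition fact_beta :: "nat \<Rightarrow> nat \<Rightarrow> real" where
  "fact_beta a b = fact a * fact b / fact (a + b + 1)"

text \<open>The identity x + (1 - x) = 1 under the integral.\<close>

lemma fact_beta_Suc: "fact_beta (Suc a) b + fact_beta a (Suc b) = fact_beta a b"
proof -
  have "fact_beta (Suc a) b + fact_beta a (Suc b) = (real (Suc a) + real (Suc b)) * (fact a * fact b) / (real (a + b + 2) * fact (a + b + 1))"
    unfolding fact_beta_def by (simp add: add_divide_distrib[symmetric] algebra_simps)
  also have "real (Suc a) + real (Suc b) = real (a + b + 2)" by simp
  also have "real (a + b + 2) * (fact a * fact b) / (real (a + b + 2) * fact (a + b + 1)) = fact_beta a b"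
    unfolding fact_beta_def by (rule mult_divide_mult_cancel_left) simp
  finally show ?thesis .
qed

lemma sum_binomial_Suc_split:
  fixes f :: "nat \<Rightarrow> real"
  shows "(\<Sum>l\<le>Suc m. real (Suc m choose l) * f l) = (\<Sum>l\<le>m. real (m choose l) * f l) + (\<Sum>l\<le>m. real (m choose l) * f (Suc l))"
proof -
  have "(\<Sum>l\<le>Suc m. real (Suc m choose l) * f l) = f 0 + (\<Sum>l\<le>m. real (Suc m choose Suc l) * f (Suc l))"
    by (simp add: sum.atMost_Suc_shift del: sum.atMost_Suc binomial_Suc_Suc)
  also have "\<dots> = (f 0 + (\<Sum>l\<le>m. real (m choose Suc l) * f (Suc l))) + (\<Sum>l\<le>m. real (m choose l) * f (Suc l))"
    by (simp add: ring_distribs sum.distrib)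
  also have "f 0 + (\<Sum>l\<le>m. real (m choose Suc l) * f (Suc l)) = (\<Sum>l\<le>Suc m. real (m choose l) * f l)"
    by (simp add: sum.atMost_Suc_shift del: sum.atMost_Suc)
  finally show ?thesis by simp
qed

text \<open>The expansion of (x + (1 - x))^m = 1 under the integral.\<close>

lemma sum_binomial_fact_beta:
  "(\<Sum>l\<le>m. real (m choose l) * fact_beta (a + l) (b + m - l)) = fact_beta a b"
proof (induction m arbitrary: a b)
  case (Suc m)
  have "(\<Sum>l\<le>Suc m. real (Suc m choose l) * fact_beta (a + l) (b + Suc m - l))
     = (\<Sum>l\<le>m. real (m choose l) * fact_beta (a + l) (Suc b + m - l)) + (\<Sum>l\<le>m. real (m choose l) * fact_beta (Suc a + l) (b + m - l))"
    by (subst sum_binomial_Suc_split) simp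
  also have "\<dots> = fact_beta a (Suc b) + fact_beta (Suc a) b" by (simp only: Suc.IH)
  finally show ?case using fact_beta_Suc[of a b] by simp
qed simp

text \<open>Under the integral the sum is x^a * (1 - x^m) / (1 - x), a geometric sum of the powers
  x^a, ..., x^(a+m-1).\<close>

lemma sum_binomial_fact_beta_harm:
  "(\<Sum>l<m. real (m choose l) * fact_beta (a + l) (m - 1 - l)) = harm (a + m) - harm a"
proof (induction m arbitrary: a)
  case (Suc m)
  have "(\<Sum>l<Suc m. real (Suc m choose l) * fact_beta (a + l) (Suc m - 1 - l)) = (\<Sum>l\<le>m. real (Suc m choose l) * fact_beta (a + l) (m - l))"
    by (simp add: lessThan_Suc_atMost)
  also have "\<dots> = (\<Sum>l\<le>m. real (m choose l) * fact_beta (a + l) (m - l)) + (\<Sum>l<m. real (m choose l) * fact_beta (a + Suc l) (m - Suc l))"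
  proof -
    let ?f = "\<lambda>l. fact_beta (a + l) (m - l)"
    \<comment> \<open>The term \<open>?f (Suc m)\<close>, where the difference
      \<open>m - Suc m\<close> is truncated, only completes both sides to the shape of the Pascal
      split and cancels again.\<close>
    have "(\<Sum>l\<le>m. real (Suc m choose l) * ?f l) + ?f (Suc m) = (\<Sum>l\<le>Suc m. real (Suc m choose l) * ?f l)" by simp
    also have "\<dots> = (\<Sum>l\<le>m. real (m choose l) * ?f l) + (\<Sum>l\<le>m. real (m choose l) * ?f (Suc l))"
      by (rule sum_binomial_Suc_split)
    also have "(\<Sum>l\<le>m. real (m choose l) * ?f (Suc l)) = (\<Sum>l<m. real (m choose l) * ?f (Suc l)) + ?f (Suc m)"
      by (simp add: lessThan_Suc_atMost[symmetric])
    finally show ?thesis by simp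
  qed
  also have "(\<Sum>l\<le>m. real (m choose l) * fact_beta (a + l) (m - l)) = fact_beta a 0"
    using sum_binomial_fact_beta[of m a 0] by simp
  also have "(\<Sum>l<m. real (m choose l) * fact_beta (a + Suc l) (m - Suc l)) = harm (Suc a + m) - harm (Suc a)"
    unfolding Suc.IH[symmetric] by (intro sum.cong) auto
  also have "fact_beta a 0 = inverse (real (Suc a))"
  proof -
    have "fact (a + 0 + 1) = real (Suc a) * fact a" by simp
    then show ?thesis unfolding fact_beta_def by (simp add: inverse_eq_divide del: of_nat_Suc)
  qed
  finally show ?case by (simp add: harm_Suc)
qed simp

section \<open>The Mellin transform of the fractional part polynomial\<close>

definition frac_poly :: "nat \<Rightarrow> real poly" where
  "frac_poly m = monom 1 m * [:1, -1:] ^ m"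

lemma poly_frac_poly: "poly (frac_poly m) u = u ^ m * (1 - u) ^ m"
  by (simp add: frac_poly_def poly_monom)

lemma coeff_frac_poly:
  "coeff (frac_poly m) i = (if i < m then 0 else (- 1) ^ (i - m) * real (m choose (i - m)))"
proof (cases "i \<le> 2 * m")
  case True
  then show ?thesis
    by (simp add: frac_poly_def coeff_monom_mult coeff_linear_poly_power)
next
  case False
  have "degree ([:1, -1:] ^ m :: real poly) \<le> 1 * m"
    by (rule order_trans[OF degree_power_le]) simp
  then have "coeff ([:1, -1:] ^ m :: real poly) (i - m) = 0"
    using False by (intro coeff_eq_0) auto
  then show ?thesis using False by (simp add: frac_poly_def coeff_monom_mult)
qed

lemma higher_pderiv_frac_poly_eq_0: "n > 2 * m \<Longrightarrow> (pderiv ^^ n) (frac_poly m) = 0"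
proof (rule poly_eqI)
  fix i assume "n > 2 * m"
  then have "m choose (i + n - m) = 0" by (intro binomial_eq_0) linarith
  then show "coeff ((pderiv ^^ n) (frac_poly m)) i = coeff 0 i"
    by (simp add: coeff_higher_pderiv coeff_frac_poly)
qed

lemma poly_higher_pderiv_frac_poly_0: "poly ((pderiv ^^ i) (frac_poly m)) 0 = fact i * coeff (frac_poly m) i"
  by (simp add: poly_0_coeff_0 coeff_higher_pderiv pochhammer_fact)

text \<open>The polynomial is symmetric under u \<mapsto> 1 - u, and each differentiation brings out
  a factor -1. This relates the boundary terms at 1 to those at 0.\<close>

lemma pcompose_higher_pderiv_frac_poly:
  "pcompose ((pderiv ^^ i) (frac_poly m)) [:1, -1:] = smult ((- 1) ^ i) ((pderiv ^^ i) (frac_poly m))"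
proof (induction i)
  case 0
  have "poly (pcompose (frac_poly m) [:1, -1:]) = poly (frac_poly m)"
    by (rule ext) (simp add: poly_pcompose poly_frac_poly mult.commute)
  then show ?case by (simp add: poly_eq_poly_eq_iff)
next
  case (Suc i)
  have "pderiv (pcompose ((pderiv ^^ i) (frac_poly m)) [:1, -1:]) = - pcompose ((pderiv ^^ Suc i) (frac_poly m)) [:1, -1:]"
    by (simp add: pderiv_pcompose pderiv_pCons)
  then show ?case by (simp add: Suc.IH pderiv_smult minus_equation_iff[of _ "pcompose _ _"])
qed

lemma poly_higher_pderiv_frac_poly_1:
  "poly ((pderiv ^^ i) (frac_poly m)) 1 = (- 1) ^ i * (fact i * coeff (frac_poly m) i)"
  using arg_cong[OF pcompose_higher_pderiv_frac_poly[of i m], of "\<lambda>p. poly p 0"]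
  by (simp add: poly_pcompose poly_higher_pderiv_frac_poly_0)

text \<open>Repeated integration by parts in closed form. The antiderivative T is a sum whose
  derivatives telescope from the integrand to a term with the derivative of order 2m + 1 of the
  polynomial, which is 0. The excluded values of s are the zeros of the denominators.\<close>

lemma has_integral_frac_poly_powr:
  fixes a s :: real
  assumes a: "a > 0" and s: "\<And>l. l \<in> {1..2 * m + 1} \<Longrightarrow> s \<noteq> real l"
  shows "((\<lambda>u. u ^ m * (1 - u) ^ m * (a + u) powr (- s)) has_integral
     (\<Sum>i\<le>2*m. fact i * coeff (frac_poly m) i * (a powr (real i + 1 - s) - (- 1) ^ i * (a + 1) powr (real i + 1 - s)) / (\<Prod>l=1..i+1. s - real l))) {0..1}"
proof -
  define P where "P = (\<lambda>i. (pderiv ^^ i) (frac_poly m))"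
  define w where "w = (\<lambda>i. \<Prod>l=1..i. s - real l)"
  have wnz: "w i \<noteq> 0" if "i \<le> 2 * m + 1" for i
    unfolding w_def using s that by (auto simp: prod_zero_iff)
  have wSuc: "w (Suc i) = w i * (s - real (Suc i))" for i by (simp add: w_def del: of_nat_Suc)
  define T where "T = (\<lambda>u. - (\<Sum>i\<le>2*m. poly (P i) u * (a + u) powr (real i + 1 - s) / w (Suc i)))"
  have deriv: "(T has_real_derivative u ^ m * (1 - u) ^ m * (a + u) powr (- s)) (at u within {0..1})" if u: "u \<in> {0..1}" for u
  proof -
    define g where "g = (\<lambda>i. poly (P i) u * (a + u) powr (real i - s) / w i)"
    have au: "a + u > 0" using a u by auto
    have "((\<lambda>u. poly (P i) u * (a + u) powr (real i + 1 - s) / w (Suc i)) has_real_derivative g (Suc i) - g i) (at u within {0..1})"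
      if i: "i \<le> 2 * m" for i
    proof -
      have "((\<lambda>u. (a + u) powr (real i + 1 - s)) has_real_derivative (real i + 1 - s) * (a + u) powr (real i - s)) (at u within {0..1})"
        using au by (auto intro!: derivative_eq_intros)
      moreover have "(poly (P i) has_real_derivative poly (P (Suc i)) u) (at u within {0..1})"
        unfolding P_def by (auto intro: poly_DERIV has_field_derivative_at_within)
      ultimately have "((\<lambda>u. poly (P i) u * (a + u) powr (real i + 1 - s) / w (Suc i)) has_real_derivative
        (poly (P (Suc i)) u * (a + u) powr (real i + 1 - s) + (real i + 1 - s) * (a + u) powr (real i - s) * poly (P i) u) / w (Suc i)) (at u within {0..1})"
        by (intro DERIV_cdivide DERIV_mult)
      moreover have "(poly (P (Suc i)) u * (a + u) powr (real i + 1 - s) + (real i + 1 - s) * (a + u) powr (real i - s) * poly (P i) u) / w (Suc i) = g (Suc i) - g i"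
      proof -
        have e1: "(real i + 1 - s) * (a + u) powr (real i - s) * poly (P i) u / w (Suc i) = - g i"
          using wnz[of i] wnz[of "Suc i"] i unfolding wSuc g_def by (simp add: divide_simps) (simp add: algebra_simps)
        have e2: "real i + 1 - s = real (Suc i) - s" by simp
        show ?thesis unfolding add_divide_distrib e1 unfolding e2 by (simp add: g_def del: of_nat_Suc)
      qed
      ultimately show ?thesis by (simp only:)
    qed
    then have "(T has_real_derivative - (\<Sum>i\<le>2*m. g (Suc i) - g i)) (at u within {0..1})"
      unfolding T_def by (intro DERIV_minus DERIV_sum) auto
    moreover have "(\<Sum>i\<le>2*m. g (Suc i) - g i) = g (Suc (2 * m)) - g 0"
    proof -
      have "(\<Sum>i\<le>N. g (Suc i) - g i) = g (Suc N) - g 0" for N by (induction N) auto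
      then show ?thesis .
    qed
    moreover have "P (Suc (2 * m)) = 0" unfolding P_def by (rule higher_pderiv_frac_poly_eq_0) simp
    ultimately show ?thesis by (simp add: g_def P_def poly_frac_poly w_def)
  qed
  have "((\<lambda>u. u ^ m * (1 - u) ^ m * (a + u) powr (- s)) has_integral (T 1 - T 0)) {0..1}"
    using deriv by (intro fundamental_theorem_of_calculus) (auto simp: has_real_derivative_iff_has_vector_derivative)
  also have "T 1 - T 0 = (\<Sum>i\<le>2*m. fact i * coeff (frac_poly m) i * (a powr (real i + 1 - s) - (- 1) ^ i * (a + 1) powr (real i + 1 - s)) / w (i + 1))"
    unfolding T_def P_def poly_higher_pderiv_frac_poly_0 poly_higher_pderiv_frac_poly_1
    by (simp add: sum_subtractf[symmetric] diff_divide_distrib algebra_simps)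
  finally show ?thesis unfolding w_def .
qed

section \<open>The transform as a holomorphic function and its closed form\<close>

definition frac_mellin :: "nat \<Rightarrow> complex \<Rightarrow> complex" where
  "frac_mellin m s = (\<Sum>n. integral {0..1} (\<lambda>u. of_real (u ^ m * (1 - u) ^ m) * of_real (real (Suc n) + u) powr (- s)))"

lemma
  shows holomorphic_frac_mellin: "frac_mellin m holomorphic_on {s. Re s > 1}"
    and summable_frac_mellin: "Re s > 1 \<Longrightarrow> summable (\<lambda>n. integral {0..1} (\<lambda>u. of_real (u ^ m * (1 - u) ^ m) * of_real (real (Suc n) + u) powr (- s) :: complex))"
proof -
  have cont: "continuous_on {0..1} (\<lambda>u::real. u ^ m * (1 - u) ^ m)" by (intro continuous_intros)
  have bound: "\<bar>u ^ m * (1 - u) ^ m\<bar> \<le> 1" if "u \<in> {0..1}" for u :: real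
    using that by (auto simp: abs_mult power_abs intro!: mult_le_one power_le_one)
  have summ: "summable (\<lambda>n. 1 * real (Suc n) powr (- \<sigma>))" if "\<sigma> > 1" for \<sigma>
    unfolding mult_1 by (rule summable_Suc_powr[OF that])
  note H = holomorphic_dirichlet_integral_series[of "\<lambda>_ u. u ^ m * (1 - u) ^ m" "\<lambda>_. 1" 1, OF cont bound summ]
  show "frac_mellin m holomorphic_on {s. Re s > 1}"
    unfolding frac_mellin_def[abs_def] by (rule H(1))
  show "Re s > 1 \<Longrightarrow> summable (\<lambda>n. integral {0..1} (\<lambda>u. of_real (u ^ m * (1 - u) ^ m) * of_real (real (Suc n) + u) powr (- s) :: complex))"
    by (rule H(2))
qed

lemma integral_of_real_powr:
  fixes \<phi> :: "real \<Rightarrow> real"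
  assumes cont: "continuous_on {0..1} \<phi>" and "a > 0"
  shows "integral {0..1} (\<lambda>u. of_real (\<phi> u) * of_real (a + u) powr (- of_real x) :: complex)
    = of_real (integral {0..1} (\<lambda>u. \<phi> u * (a + u) powr (- x)))"
proof (rule integral_unique)
  have "(\<lambda>u. \<phi> u * (a + u) powr (- x)) integrable_on {0..1}"
    using \<open>a > 0\<close> by (intro integrable_continuous_real continuous_intros cont) auto
  from has_integral_of_real[OF integrable_integral[OF this]]
  show "((\<lambda>u. of_real (\<phi> u) * of_real (a + u) powr (- of_real x) :: complex) has_integral of_real (integral {0..1} (\<lambda>u. \<phi> u * (a + u) powr (- x)))) {0..1}"
  proof (rule has_integral_eq[rotated])
    fix u :: real assume "u \<in> {0..1}"
    then have "a + u \<ge> 0" using \<open>a > 0\<close> by auto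
    then show "complex_of_real (\<phi> u * (a + u) powr (- x)) = of_real (\<phi> u) * of_real (a + u) powr (- of_real x)"
      using powr_of_real[of "a + u" "- x"] by (simp only: of_real_mult of_real_minus)
  qed
qed

lemma frac_mellin_of_real:
  assumes "x > 1"
  shows "(\<lambda>n. integral {0..1} (\<lambda>u. u ^ m * (1 - u) ^ m * (real (Suc n) + u) powr (- x))) sums Re (frac_mellin m (of_real x))"
    and "frac_mellin m (of_real x) = of_real (Re (frac_mellin m (of_real x)))"
proof -
  define e where "e = (\<lambda>n. integral {0..1} (\<lambda>u. u ^ m * (1 - u) ^ m * (real (Suc n) + u) powr (- x)))"
  have eq: "integral {0..1} (\<lambda>u. of_real (u ^ m * (1 - u) ^ m) * of_real (real (Suc n) + u) powr (- of_real x) :: complex) = of_real (e n)" for n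
    unfolding e_def by (intro integral_of_real_powr continuous_intros) auto
  have "summable (\<lambda>n. complex_of_real (e n))"
    using summable_frac_mellin[of "of_real x" m] assms unfolding eq by simp
  then have "summable e" by (simp only: summable_of_real_iff)
  then have *: "frac_mellin m (of_real x) = of_real (suminf e)"
    unfolding frac_mellin_def eq by (simp only: suminf_of_real)
  then show "frac_mellin m (of_real x) = of_real (Re (frac_mellin m (of_real x)))" by simp
  show "(\<lambda>n. integral {0..1} (\<lambda>u. u ^ m * (1 - u) ^ m * (real (Suc n) + u) powr (- x))) sums Re (frac_mellin m (of_real x))"
    unfolding * Re_complex_of_real e_def[symmetric] using \<open>summable e\<close> by (rule summable_sums)
qed

text \<open>The bound on x makes every argument x - i - 1 exceed 1. Left boundary terms sum to zeta;
  right boundary terms start one step later and sum to zeta - 1. For even i the two zeta values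
  cancel, which is why only odd i appear in the final formulas.\<close>

lemma frac_mellin_large:
  assumes x: "x > 2 * real m + 2"
  shows "Re (frac_mellin m (of_real x)) = (\<Sum>i\<le>2*m. fact i * coeff (frac_poly m) i * ((- 1) ^ i + (1 - (- 1) ^ i) * real_zeta (x - (real i + 1))) / (\<Prod>l=1..i+1. x - real l))"
proof -
  have "(\<lambda>n. \<Sum>i\<le>2*m. fact i * coeff (frac_poly m) i * (real (Suc n) powr (real i + 1 - x) - (- 1) ^ i * (real (Suc n) + 1) powr (real i + 1 - x)) / (\<Prod>l=1..i+1. x - real l)) sums
    (\<Sum>i\<le>2*m. fact i * coeff (frac_poly m) i * (real_zeta (x - (real i + 1)) - (- 1) ^ i * (real_zeta (x - (real i + 1)) - 1)) / (\<Prod>l=1..i+1. x - real l))"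
  proof (intro sums_sum sums_divide sums_mult sums_diff)
    fix i assume i: "i \<in> {..2*m}"
    then have "x - (real i + 1) > 1" using x by auto
    from real_zeta_sums[OF this] show 1: "(\<lambda>n. real (Suc n) powr (real i + 1 - x)) sums real_zeta (x - (real i + 1))"
      by (simp only: minus_diff_eq)
    have "(\<lambda>n. real (Suc (n + 1)) powr (real i + 1 - x)) sums (real_zeta (x - (real i + 1)) - (\<Sum>n<1. real (Suc n) powr (real i + 1 - x)))"
      by (rule sums_split_initial_segment[OF 1])
    then show "(\<lambda>n. (real (Suc n) + 1) powr (real i + 1 - x)) sums (real_zeta (x - (real i + 1)) - 1)"
      by (simp add: add_ac)
  qed
  moreover have "integral {0..1} (\<lambda>u. u ^ m * (1 - u) ^ m * (real (Suc n) + u) powr (- x))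
      = (\<Sum>i\<le>2*m. fact i * coeff (frac_poly m) i * (real (Suc n) powr (real i + 1 - x) - (- 1) ^ i * (real (Suc n) + 1) powr (real i + 1 - x)) / (\<Prod>l=1..i+1. x - real l))" for n
    using x by (intro integral_unique has_integral_frac_poly_powr) auto
  ultimately have "Re (frac_mellin m (of_real x)) = (\<Sum>i\<le>2*m. fact i * coeff (frac_poly m) i * (real_zeta (x - (real i + 1)) - (- 1) ^ i * (real_zeta (x - (real i + 1)) - 1)) / (\<Prod>l=1..i+1. x - real l))"
    using frac_mellin_of_real(1)[of x m] x sums_unique2 by simp
  also have "\<dots> = (\<Sum>i\<le>2*m. fact i * coeff (frac_poly m) i * ((- 1) ^ i + (1 - (- 1) ^ i) * real_zeta (x - (real i + 1))) / (\<Prod>l=1..i+1. x - real l))"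
    by (intro sum.cong refl arg_cong2[where f = "(/)"] arg_cong2[where f = "(*)"]) (simp add: algebra_simps)
  finally show ?thesis .
qed

lemma riemann_zeta_real: "x > 1 \<Longrightarrow> riemann_zeta (of_real x) = of_real (real_zeta x)"
  by (simp add: real_zeta_def riemann_zeta_of_real_gt_1)

lemma Re_frac_mellin:
  assumes x: "x > 1" and nI: "\<And>l. l \<in> {1..2 * m + 2} \<Longrightarrow> x \<noteq> real l"
  shows "Re (frac_mellin m (of_real x)) = (\<Sum>i\<le>2*m. fact i * coeff (frac_poly m) i * ((- 1) ^ i + (1 - (- 1) ^ i) * real_zeta (x - (real i + 1))) / (\<Prod>l=1..i+1. x - real l))"
proof -
  \<comment> \<open>The denominators vanish at 1, ..., 2m + 1 and the zeta factors have poles at i +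
    2 for i \<le> 2m. Removing finitely many points leaves the half-plane connected.\<close>
  define S where "S = {s. Re s > 1} - complex_of_nat ` {1..2*m+2}"
  define T where "T = (\<lambda>s. \<Sum>i\<le>2*m. of_real (fact i * coeff (frac_poly m) i) * ((- 1) ^ i + (1 - (- 1) ^ i) * riemann_zeta (s - (of_nat i + 1))) / (\<Prod>l=1..i+1. s - of_nat l))"
  have "frac_mellin m (of_real x) = T (of_real x)"
  proof (rule identity_from_real_interval[of S "frac_mellin m" T "2 * real m + 2" "2 * real m + 3"])
    show "open S" unfolding S_def
      by (intro open_Diff open_halfspace_Re_gt finite_imp_closed finite_imageI finite_atLeastAtMost)
    show "connected S" unfolding S_def
      by (intro connected_open_delete_finite open_halfspace_Re_gt convex_connected convex_halfspace_Re_gt) auto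
    show "frac_mellin m holomorphic_on S"
      by (rule holomorphic_on_subset[OF holomorphic_frac_mellin]) (auto simp: S_def)
    show "T holomorphic_on S"
    proof -
      have "(\<lambda>s. riemann_zeta (s - (of_nat i + 1))) holomorphic_on S" if "i \<le> 2 * m" for i
      proof -
        have "(\<lambda>s. s - (of_nat i + 1)) ` S \<subseteq> - {1}"
        proof
          fix z assume "z \<in> (\<lambda>s. s - (of_nat i + 1)) ` S"
          then obtain s where s: "s \<in> S" "z = s - (of_nat i + 1)" by auto
          have "z \<noteq> 1"
          proof
            assume "z = 1"
            then have "s = of_nat (i + 2)" using s by (simp add: algebra_simps)
            moreover have "i + 2 \<in> {1..2*m+2}" using that by simp
            ultimately show False using s(1) unfolding S_def by blast
          qed
          then show "z \<in> - {1}" by simp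
        qed
        then have "(riemann_zeta \<circ> (\<lambda>s. s - (of_nat i + 1))) holomorphic_on S"
          by (intro holomorphic_on_compose_gen[OF _ holomorphic_riemann_zeta] holomorphic_intros)
        then show ?thesis by (simp only: o_def)
      qed
      moreover have "(\<Prod>l=1..i+1. s - of_nat l) \<noteq> 0" if "i \<le> 2 * m" "s \<in> S" for i s
      proof
        assume "(\<Prod>l=1..i+1. s - of_nat l) = 0"
        then obtain l where l: "l \<in> {1..i+1}" "s - of_nat l = 0"
          by (subst (asm) prod_zero_iff) auto
        then have "s = of_nat l" "l \<in> {1..2*m+2}" using that(1) by auto
        then show False using that(2) unfolding S_def by blast
      qed
      ultimately show ?thesis
        unfolding T_def by (intro holomorphic_intros) auto
    qed
    show "of_real ` {2 * real m + 2<..<2 * real m + 3} \<subseteq> S"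
    proof
      fix s assume "s \<in> complex_of_real ` {2 * real m + 2<..<2 * real m + 3}"
      then obtain y where y: "s = of_real y" "y > 2 * real m + 2" by auto
      have "s \<noteq> of_nat l" if "l \<in> {1..2*m+2}" for l
      proof
        assume "s = of_nat l"
        then have "complex_of_real y = of_real (real l)" using y by simp
        then have "y = real l" by (simp only: of_real_eq_iff)
        then show False using y that by auto
      qed
      moreover have "Re s > 1" using y by simp
      ultimately show "s \<in> S" unfolding S_def by blast
    qed
    show "of_real x \<in> S"
    proof -
      have "complex_of_real x \<noteq> of_nat l" if "l \<in> {1..2*m+2}" for l
        using nI[OF that] by (metis of_real_eq_iff of_real_of_nat_eq)
      moreover have "Re (complex_of_real x) > 1" using x by simp
      ultimately show ?thesis unfolding S_def by blast
    qed
    fix y :: real assume y: "2 * real m + 2 < y"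
    have "frac_mellin m (of_real y) = of_real (Re (frac_mellin m (of_real y)))"
      using y by (intro frac_mellin_of_real(2)) simp
    also have "\<dots> = T (of_real y)"
    proof -
      have "riemann_zeta (of_real y - (of_nat i + 1)) = of_real (real_zeta (y - (real i + 1)))" if "i \<in> {..2*m}" for i
      proof -
        have "of_real y - (of_nat i + 1) = complex_of_real (y - (real i + 1))" by simp
        moreover have "y - (real i + 1) > 1" using y that by auto
        ultimately show ?thesis using riemann_zeta_real by metis
      qed
      then show ?thesis
        unfolding frac_mellin_large[OF y] T_def of_real_sum
        by (intro sum.cong refl) (simp add: of_real_prod)
    qed
    finally show "frac_mellin m (of_real y) = T (of_real y)" .
  qed simp
  also have "Re (T (of_real x)) = (\<Sum>i\<le>2*m. fact i * coeff (frac_poly m) i * ((- 1) ^ i + (1 - (- 1) ^ i) * real_zeta (x - (real i + 1))) / (\<Prod>l=1..i+1. x - real l))"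
  proof -
    have "Re (of_real (fact i * coeff (frac_poly m) i) * ((- 1) ^ i + (1 - (- 1) ^ i) * riemann_zeta (of_real x - (of_nat i + 1))) / (\<Prod>l=1..i+1. of_real x - of_nat l))
       = fact i * coeff (frac_poly m) i * ((- 1) ^ i + (1 - (- 1) ^ i) * real_zeta (x - (real i + 1))) / (\<Prod>l=1..i+1. x - real l)" for i
    proof -
      have 1: "(\<Prod>l=1..i+1. of_real x - of_nat l) = complex_of_real (\<Prod>l=1..i+1. x - real l)"
        by (simp add: of_real_prod)
      have 2: "of_real x - (of_nat i + 1) = complex_of_real (x - (real i + 1))" by simp
      have 3: "(- 1) ^ i + (1 - (- 1) ^ i) * z = of_real ((- 1) ^ i) + of_real (1 - (- 1) ^ i) * z" for z :: complex
        by simp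
      have R: "Re (of_real c * w / of_real d) = c * Re w / d" for c d w
        by (simp add: Re_divide_of_real)
      show ?thesis unfolding 1 2 3 R real_zeta_def by simp
    qed
    then show ?thesis unfolding T_def Re_sum by (simp only:)
  qed
  finally show ?thesis .
qed

lemma frac_integral_eq_frac_mellin:
  "frac_integral m k = Re (frac_mellin m (of_real (real k + 2)))"
proof -
  define L where "L = Re (frac_mellin m (of_real (real k + 2)))"
  define g where "g = (\<lambda>t::real. t powr (- (real k + 2)) * (frac t ^ m * (1 - frac t) ^ m))"
  define f where "f = (\<lambda>x::real. x ^ k * frac (1 / x) ^ m * (1 - frac (1 / x)) ^ m)"
  define e where "e = (\<lambda>n. integral {0..1} (\<lambda>u. u ^ m * (1 - u) ^ m * (real (Suc n) + u) powr (- (real k + 2))))"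
  have frac: "0 \<le> frac t" "0 \<le> 1 - frac t" for t :: real
    using frac_lt_1[of t] by simp_all
  have int: "((\<lambda>u. g (real (Suc n) + u)) has_integral e n) {0..1}" for n
  proof -
    have "(\<lambda>u. u ^ m * (1 - u) ^ m * (real (Suc n) + u) powr (- (real k + 2))) integrable_on {0..1}"
      by (intro integrable_continuous_real continuous_intros) auto
    then have I: "((\<lambda>u. u ^ m * (1 - u) ^ m * (real (Suc n) + u) powr (- (real k + 2))) has_integral e n) {0..1}"
      unfolding e_def by (rule integrable_integral)
    show ?thesis
    \<comment> \<open>At u = 1 the fractional part jumps back to 0, so that point is left
      out.\<close>
    proof (rule has_integral_spike_finite[of "{1}", OF _ _ I])
      fix u :: real assume u: "u \<in> {0..1} - {1}"
      have "frac (real (Suc n) + u) = u"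
        using u by (subst frac_unique_iff) auto
      then show "g (real (Suc n) + u) = u ^ m * (1 - u) ^ m * (real (Suc n) + u) powr (- (real k + 2))"
        unfolding g_def by (simp only: mult_ac)
    qed simp
  qed
  have "real k + 2 > 1" by simp
  then have "e sums L" unfolding e_def L_def by (rule frac_mellin_of_real(1))
  then have G: "(g has_integral L) {1..}"
    by (intro has_integral_atLeast_unit_intervals[OF _ int]) (use frac in \<open>simp_all add: g_def\<close>)
  have img: "(\<lambda>t::real. 1 / t) ` {1..} = {0<..1::real}"
  proof
    show "{0<..1} \<subseteq> (\<lambda>t::real. 1 / t) ` {1..}"
    proof
      fix x :: real assume "x \<in> {0<..1}"
      then show "x \<in> (\<lambda>t::real. 1 / t) ` {1..}" by (intro image_eqI[of _ _ "1 / x"]) auto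
    qed
  qed auto
  have "f absolutely_integrable_on ((\<lambda>t::real. 1 / t) ` {1..}) \<and> integral ((\<lambda>t::real. 1 / t) ` {1..}) f = L \<longleftrightarrow>
     (\<lambda>t. \<bar>- 1 / t\<^sup>2\<bar> * f (1 / t)) absolutely_integrable_on {1..} \<and> integral {1..} (\<lambda>t. \<bar>- 1 / t\<^sup>2\<bar> * f (1 / t)) = L"
  proof (rule has_absolute_integral_change_of_variables_1'[symmetric])
    fix t :: real assume "t \<in> {1..}"
    then show "((\<lambda>t. 1 / t) has_field_derivative - 1 / t\<^sup>2) (at t within {1..})"
      by (auto intro!: derivative_eq_intros simp: power2_eq_square)
  qed (auto intro: inj_onI)
  moreover have "((\<lambda>t. \<bar>- 1 / t\<^sup>2\<bar> * f (1 / t)) has_integral L) {1..}"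
  proof (rule has_integral_eq[OF _ G])
    fix t :: real assume "t \<in> {1..}"
    then have t: "t > 0" by auto
    have "t powr (- (real k + 2)) = inverse (t ^ (k + 2))"
    proof -
      have "real k + 2 = real (k + 2)" by simp
      then show ?thesis using powr_realpow[OF t, of "k + 2"] by (simp only: powr_minus)
    qed
    then show "g t = \<bar>- 1 / t\<^sup>2\<bar> * f (1 / t)"
      using t unfolding g_def f_def by (simp add: power_add power_divide power2_eq_square inverse_eq_divide)
  qed
  moreover from this have "(\<lambda>t. \<bar>- 1 / t\<^sup>2\<bar> * f (1 / t)) absolutely_integrable_on {1..}"
  proof (intro nonnegative_absolutely_integrable_1 has_integral_integrable)
    fix t :: real assume "t \<in> {1..}"
    then have "0 \<le> 1 / t" by simp
    then have "0 \<le> f (1 / t)"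
      unfolding f_def by (intro mult_nonneg_nonneg zero_le_power frac)
    then show "0 \<le> \<bar>- 1 / t\<^sup>2\<bar> * f (1 / t)" by (intro mult_nonneg_nonneg abs_ge_zero)
  qed
  ultimately have "f absolutely_integrable_on {0<..1} \<and> integral {0<..1} f = L"
    unfolding img by (simp add: integral_unique)
  then have "(f has_integral L) {0<..1}"
    by (auto simp: has_integral_iff intro: set_lebesgue_integral_eq_integral(1))
  moreover have "(f has_integral L) {0<..1} \<longleftrightarrow> (f has_integral L) {0..1}"
  proof (rule has_integral_spike_set_eq)
    have "{x \<in> {0..1} - {0<..1}. f x \<noteq> 0} \<subseteq> {0}" by auto
    then show "negligible {x \<in> {0..1} - {0<..1}. f x \<noteq> 0}" by (rule negligible_subset[rotated]) simp
    have "{x \<in> {0<..1} - {0..1}. f x \<noteq> 0} = {}" by auto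
    then show "negligible {x \<in> {0<..1} - {0..1}. f x \<noteq> 0}" by (simp only: negligible_empty)
  qed
  ultimately show ?thesis unfolding frac_integral_def f_def L_def[symmetric] by (simp add: integral_unique)
qed

section \<open>Passage to the limit\<close>

text \<open>With S the weighted sum of the residues, both the full sum and the full sum minus S /
  \<epsilon> have finite limits. Multiplying their difference by \<epsilon> gives S = 0, so the
  cancellation never has to be checked on the individual residues.\<close>

lemma poles_cancel:
  fixes p A L :: "nat \<Rightarrow> real" and R :: "nat \<Rightarrow> real \<Rightarrow> real"
  assumes R: "\<And>i. i \<in> I \<Longrightarrow> ((\<lambda>\<epsilon>. R i \<epsilon> - A i / \<epsilon>) \<longlongrightarrow> L i) (at_right 0)"
    and X: "((\<lambda>\<epsilon>. \<Sum>i\<in>I. p i * R i \<epsilon>) \<longlongrightarrow> X) (at_right 0)"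
  shows "X = (\<Sum>i\<in>I. p i * L i)"
proof -
  define S where "S = (\<Sum>i\<in>I. p i * A i)"
  have "((\<lambda>\<epsilon>. \<Sum>i\<in>I. p i * (R i \<epsilon> - A i / \<epsilon>)) \<longlongrightarrow> (\<Sum>i\<in>I. p i * L i)) (at_right 0)"
    by (intro tendsto_sum tendsto_mult tendsto_const R)
  moreover have "(\<Sum>i\<in>I. p i * (R i \<epsilon> - A i / \<epsilon>)) = (\<Sum>i\<in>I. p i * R i \<epsilon>) - S / \<epsilon>" for \<epsilon>
    by (simp add: S_def right_diff_distrib sum_subtractf sum_divide_distrib)
  ultimately have 1: "((\<lambda>\<epsilon>. (\<Sum>i\<in>I. p i * R i \<epsilon>) - S / \<epsilon>) \<longlongrightarrow> (\<Sum>i\<in>I. p i * L i)) (at_right 0)"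
    by simp
  have id0: "((\<lambda>\<epsilon>. \<epsilon>) \<longlongrightarrow> 0) (at_right (0::real))" by (rule tendsto_ident_at)
  have "((\<lambda>\<epsilon>. \<epsilon> * (\<Sum>i\<in>I. p i * R i \<epsilon>) - \<epsilon> * ((\<Sum>i\<in>I. p i * R i \<epsilon>) - S / \<epsilon>)) \<longlongrightarrow> 0 * X - 0 * (\<Sum>i\<in>I. p i * L i)) (at_right 0)"
    by (intro tendsto_diff tendsto_mult id0 X 1)
  moreover have "\<forall>\<^sub>F \<epsilon> in at_right 0. \<epsilon> * (\<Sum>i\<in>I. p i * R i \<epsilon>) - \<epsilon> * ((\<Sum>i\<in>I. p i * R i \<epsilon>) - S / \<epsilon>) = S"
    using eventually_at_right_less[of "0::real"]
  proof eventually_elim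
    fix \<epsilon> :: real assume "\<epsilon> > 0"
    then have "\<epsilon> * r - \<epsilon> * (r - S / \<epsilon>) = S" for r by (simp add: right_diff_distrib)
    then show "\<epsilon> * (\<Sum>i\<in>I. p i * R i \<epsilon>) - \<epsilon> * ((\<Sum>i\<in>I. p i * R i \<epsilon>) - S / \<epsilon>) = S" .
  qed
  ultimately have "((\<lambda>_. S) \<longlongrightarrow> 0 * X - 0 * (\<Sum>i\<in>I. p i * L i)) (at_right (0::real))"
    by (rule Lim_transform_eventually)
  then have "S = 0" by (simp add: tendsto_const_iff)
  with 1 X show ?thesis using tendsto_unique[of "at_right (0::real)"] by simp
qed

text \<open>What remains of the factors s - l with k + 2 \<le> l \<le> n + k + 2 at s = k + 2 +
  \<epsilon> when the vanishing factor \<epsilon> is taken out.\<close>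

definition falling :: "nat \<Rightarrow> real \<Rightarrow> real" where
  "falling n \<epsilon> = (\<Prod>r=1..n. \<epsilon> - real r)"

lemma falling_0: "falling n 0 = (- 1) ^ n * fact n"
proof (induction n)
  case (Suc n)
  have "falling (Suc n) 0 = falling n 0 * (0 - real (Suc n))" by (simp add: falling_def del: of_nat_Suc)
  then show ?case by (simp add: Suc.IH algebra_simps)
qed (simp add: falling_def)

text \<open>The logarithmic derivative at 0 is minus the sum of 1 / r, the source of the harmonic
  numbers in the limit.\<close>

lemma has_real_derivative_falling: "(falling n has_real_derivative - falling n 0 * harm n) (at 0)"
proof (induction n)
  case 0
  show ?case by (simp add: falling_def[abs_def] harm_def)
next
  case (Suc n)
  have e: "falling (Suc n) = (\<lambda>\<epsilon>. falling n \<epsilon> * (\<epsilon> - real (Suc n)))"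
    by (simp add: falling_def[abs_def] del: of_nat_Suc)
  have "((\<lambda>\<epsilon>. falling n \<epsilon> * (\<epsilon> - real (Suc n))) has_real_derivative
      - falling n 0 * harm n * (0 - real (Suc n)) + 1 * falling n 0) (at 0)"
    by (intro DERIV_mult Suc.IH) (auto intro!: derivative_eq_intros)
  moreover have "- falling n 0 * harm n * (0 - real (Suc n)) + 1 * falling n 0 = - falling (Suc n) 0 * harm (Suc n)"
  proof -
    have "real (Suc n) * harm (Suc n) = real (Suc n) * harm n + 1"
      unfolding harm_Suc by (simp add: distrib_left del: of_nat_Suc)
    then have "falling n 0 * (real (Suc n) * harm (Suc n)) = falling n 0 * (real (Suc n) * harm n + 1)"
      by (simp only:)
    then show ?thesis unfolding e by (simp add: distrib_left mult_ac del: of_nat_Suc)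
  qed
  ultimately show ?case unfolding e by simp
qed

text \<open>The numerator, which tends to \<open>(k + 1)!\<close>, cancels the factors common to all terms with
  \<open>i > k\<close>, so that their residues no longer involve \<open>H\<^sub>k\<^sub>+\<^sub>1\<close>.\<close>

definition mellin_term :: "nat \<Rightarrow> nat \<Rightarrow> real \<Rightarrow> real" where
  "mellin_term k i \<epsilon> = (\<Prod>l=1..k+1. real k + 2 + \<epsilon> - real l) / (\<Prod>l=1..i+1. real k + 2 + \<epsilon> - real l)
     * ((- 1) ^ i + (1 - (- 1) ^ i) * real_zeta (real k + 2 + \<epsilon> - (real i + 1)))"

text \<open>These terms have no pole: the denominator cancels completely, and the zeta argument
  tends to an integer that is at least 2.\<close>

lemma mellin_term_less:
  assumes i: "i < k"
  shows "(mellin_term k i \<longlongrightarrow> fact (k - i) * ((- 1) ^ i + (1 - (- 1) ^ i) * zeta_nat (k + 1 - i))) (at_right 0)"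
proof -
  have e: "mellin_term k i \<epsilon> = (\<Prod>l=i+2..k+1. real k + 2 + \<epsilon> - real l)
     * ((- 1) ^ i + (1 - (- 1) ^ i) * real_zeta (real (k + 1 - i) + \<epsilon>))" if "\<epsilon> > 0" for \<epsilon>
  proof -
    have P: "(\<Prod>l=1..k+1. real k + 2 + \<epsilon> - real l) = (\<Prod>l=1..i+1. real k + 2 + \<epsilon> - real l) * (\<Prod>l=i+2..k+1. real k + 2 + \<epsilon> - real l)"
      using i prod.ub_add_nat[of 1 "i+1" "\<lambda>l. real k + 2 + \<epsilon> - real l" "k - i"]
      by (simp del: prod.cl_ivl_Suc)
    have pos: "(\<Prod>l=1..i+1. real k + 2 + \<epsilon> - real l) > 0"
      using i that by (intro prod_pos) auto
    have eq: "real k + 2 + \<epsilon> - (real i + 1) = real (k + 1 - i) + \<epsilon>" using i by (simp add: of_nat_diff)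
    have gen: "a * b / a * c = b * c" if "a > 0" for a b c :: real using that by simp
    show ?thesis unfolding mellin_term_def P eq by (rule gen[OF pos])
  qed
  have "((\<lambda>\<epsilon>. real_zeta (real (k + 1 - i) + \<epsilon>)) \<longlongrightarrow> real_zeta (real (k + 1 - i) + 0)) (at_right 0)"
  proof (rule isCont_tendsto_compose[where g = real_zeta])
    show "isCont real_zeta (real (k + 1 - i) + 0)" using i by (intro continuous_real_zeta) auto
    show "((\<lambda>\<epsilon>. real (k + 1 - i) + \<epsilon>) \<longlongrightarrow> real (k + 1 - i) + 0) (at_right 0)"
      by (intro tendsto_intros)
  qed
  then have "((\<lambda>\<epsilon>. (\<Prod>l=i+2..k+1. real k + 2 + \<epsilon> - real l) * ((- 1) ^ i + (1 - (- 1) ^ i) * real_zeta (real (k + 1 - i) + \<epsilon>))) \<longlongrightarrow>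
     (\<Prod>l=i+2..k+1. real k + 2 + 0 - real l) * ((- 1) ^ i + (1 - (- 1) ^ i) * real_zeta (real (k + 1 - i) + 0))) (at_right 0)"
    by (intro tendsto_intros)
  moreover have "(\<Prod>l=i+2..k+1. real k + 2 + 0 - real l) = fact (k - i)"
  proof -
    have "(\<Prod>l=i+2..k+1. real k + 2 + 0 - real l) = (\<Prod>r=1..k-i. real r)"
      using i by (intro prod.reindex_bij_witness[of _ "\<lambda>r. k + 2 - r" "\<lambda>l. k + 2 - l"]) (auto simp: of_nat_diff)
    then show ?thesis by (simp add: fact_prod)
  qed
  moreover have "\<forall>\<^sub>F \<epsilon> in at_right 0. (\<Prod>l=i+2..k+1. real k + 2 + \<epsilon> - real l) * ((- 1) ^ i + (1 - (- 1) ^ i) * real_zeta (real (k + 1 - i) + \<epsilon>)) = mellin_term k i \<epsilon>"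
    using eventually_at_right_less[of "0::real"] by eventually_elim (rule e[symmetric])
  ultimately show ?thesis
    unfolding zeta_nat_eq by (simp add: Lim_transform_eventually)
qed

text \<open>All products cancel, so the only singularity is the pole of zeta at 1. It is present for
  odd k only, and its constant term is \<open>euler_mascheroni\<close>.\<close>

lemma mellin_term_eq:
  "((\<lambda>\<epsilon>. mellin_term k k \<epsilon> - (1 - (- 1) ^ k) / \<epsilon>) \<longlongrightarrow> (- 1) ^ k + (1 - (- 1) ^ k) * euler_mascheroni) (at_right 0)"
proof -
  have "((\<lambda>\<epsilon>. (- 1) ^ k + (1 - (- 1) ^ k) * (real_zeta (1 + \<epsilon>) - 1 / \<epsilon>)) \<longlongrightarrow> (- 1) ^ k + (1 - (- 1) ^ k) * euler_mascheroni) (at_right 0)"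
    by (intro tendsto_intros real_zeta_near_1)
  moreover have "\<forall>\<^sub>F \<epsilon> in at_right 0. (- 1) ^ k + (1 - (- 1) ^ k) * (real_zeta (1 + \<epsilon>) - 1 / \<epsilon>) = mellin_term k k \<epsilon> - (1 - (- 1) ^ k) / \<epsilon>"
    using eventually_at_right_less[of "0::real"]
  proof eventually_elim
    fix \<epsilon> :: real assume "\<epsilon> > 0"
    then have pos: "(\<Prod>l=1..k+1. real k + 2 + \<epsilon> - real l) > 0" by (intro prod_pos) auto
    have "real k + 2 + \<epsilon> - (real k + 1) = 1 + \<epsilon>" by simp
    moreover have gen: "a / a * c = c" if "a > 0" for a c :: real using that by simp
    ultimately have "mellin_term k k \<epsilon> = (- 1) ^ k + (1 - (- 1) ^ k) * real_zeta (1 + \<epsilon>)"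
      unfolding mellin_term_def by (simp only: gen[OF pos])
    then show "(- 1) ^ k + (1 - (- 1) ^ k) * (real_zeta (1 + \<epsilon>) - 1 / \<epsilon>) = mellin_term k k \<epsilon> - (1 - (- 1) ^ k) / \<epsilon>"
      by (simp add: right_diff_distrib)
  qed
  ultimately show ?thesis by (rule Lim_transform_eventually)
qed

text \<open>The term is \<open>g \<epsilon> / \<epsilon>\<close> with g differentiable at 0, so the
  residue is \<open>g 0\<close> and the constant term is the derivative of g, found by the quotient
  rule.\<close>

lemma mellin_term_greater:
  fixes n k :: nat
  defines "i \<equiv> n + k + 1"
  defines "z \<equiv> (- 1) ^ i + (1 - (- 1) ^ i) * real_zeta (- real n)"
  shows "((\<lambda>\<epsilon>. mellin_term k i \<epsilon> - (z / falling n 0) / \<epsilon>) \<longlongrightarrow>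
    (- 1) ^ n / fact n * (harm n * z + (1 - (- 1) ^ i) * zeta'_int (- int n))) (at_right 0)"
proof -
  define g where "g = (\<lambda>\<epsilon>. ((- 1) ^ i + (1 - (- 1) ^ i) * real_zeta (\<epsilon> - real n)) / falling n \<epsilon>)"
  have w: "falling n 0 \<noteq> 0" by (simp add: falling_0)
  have e: "mellin_term k i \<epsilon> = g \<epsilon> / \<epsilon>" if "\<epsilon> > 0" for \<epsilon>
  proof -
    have "(\<Prod>l=1..i+1. real k + 2 + \<epsilon> - real l) = (\<Prod>l=1..k+1. real k + 2 + \<epsilon> - real l) * (\<Prod>l=k+1+1..i+1. real k + 2 + \<epsilon> - real l)"
      using prod.ub_add_nat[of 1 "k+1" "\<lambda>l. real k + 2 + \<epsilon> - real l" "n+1"] by (simp add: i_def add_ac)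
    also have "(\<Prod>l=k+1+1..i+1. real k + 2 + \<epsilon> - real l) = (\<Prod>r=0..n. \<epsilon> - real r)"
      by (intro prod.reindex_bij_witness[of _ "\<lambda>r. r + k + 2" "\<lambda>l. l - k - 2"]) (auto simp: i_def of_nat_diff)
    also have "\<dots> = \<epsilon> * falling n \<epsilon>"
      by (simp add: prod.atLeast_Suc_atMost falling_def)
    finally have P: "(\<Prod>l=1..i+1. real k + 2 + \<epsilon> - real l) = (\<Prod>l=1..k+1. real k + 2 + \<epsilon> - real l) * (\<epsilon> * falling n \<epsilon>)" .
    have pos: "(\<Prod>l=1..k+1. real k + 2 + \<epsilon> - real l) > 0" using that by (intro prod_pos) auto
    have eq: "real k + 2 + \<epsilon> - (real i + 1) = \<epsilon> - real n" by (simp add: i_def)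
    have gen: "a / (a * (b * c)) * d = d / c / b" if "a > 0" for a b c d :: real using that by simp
    show ?thesis unfolding mellin_term_def g_def P eq by (rule gen[OF pos])
  qed
  have z: "((\<lambda>\<epsilon>. real_zeta (\<epsilon> - real n)) has_real_derivative zeta'_int (- int n)) (at 0)"
    using DERIV_shift[of real_zeta "zeta'_int (- int n)" 0 "- real n"] has_real_derivative_real_zeta_nonpos_int[of n] by simp
  have "((\<lambda>\<epsilon>. (- 1) ^ i + (1 - (- 1) ^ i) * real_zeta (\<epsilon> - real n)) has_real_derivative (1 - (- 1) ^ i) * zeta'_int (- int n)) (at 0)"
    using DERIV_add[OF DERIV_const DERIV_cmult[OF z]] by simp
  from DERIV_divide[OF this has_real_derivative_falling w]
  have "(g has_real_derivative ((1 - (- 1) ^ i) * zeta'_int (- int n) * falling n 0 - z * (- falling n 0 * harm n)) / (falling n 0 * falling n 0)) (at 0)"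
    unfolding g_def z_def by simp
  also have "((1 - (- 1) ^ i) * zeta'_int (- int n) * falling n 0 - z * (- falling n 0 * harm n)) / (falling n 0 * falling n 0)
     = (harm n * z + (1 - (- 1) ^ i) * zeta'_int (- int n)) / falling n 0"
    using w by (simp add: field_simps)
  also have "\<dots> = (- 1) ^ n / fact n * (harm n * z + (1 - (- 1) ^ i) * zeta'_int (- int n))"
    unfolding falling_0 by (simp add: divide_simps)
  finally have "(g has_real_derivative (- 1) ^ n / fact n * (harm n * z + (1 - (- 1) ^ i) * zeta'_int (- int n))) (at 0)" .
  then have "((\<lambda>\<epsilon>. (g \<epsilon> - g 0) / \<epsilon>) \<longlongrightarrow> (- 1) ^ n / fact n * (harm n * z + (1 - (- 1) ^ i) * zeta'_int (- int n))) (at 0)"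
    unfolding DERIV_def by (simp only: add_0)
  then have lim: "((\<lambda>\<epsilon>. (g \<epsilon> - g 0) / \<epsilon>) \<longlongrightarrow> (- 1) ^ n / fact n * (harm n * z + (1 - (- 1) ^ i) * zeta'_int (- int n))) (at_right 0)"
    by (rule filterlim_mono[OF _ order_refl at_le]) simp
  have g0: "g 0 = z / falling n 0" by (simp add: g_def z_def)
  have "\<forall>\<^sub>F \<epsilon> in at_right 0. (g \<epsilon> - g 0) / \<epsilon> = mellin_term k i \<epsilon> - z / falling n 0 / \<epsilon>"
    using eventually_at_right_less[of "0::real"] by eventually_elim (simp add: e g0 diff_divide_distrib)
  with lim show ?thesis by (rule Lim_transform_eventually)
qed

lemma frac_integral_expansion:
  "fact (k + 1) * frac_integral m k = (\<Sum>i\<le>2*m. fact i * coeff (frac_poly m) i *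
     (if i < k then fact (k - i) * ((- 1) ^ i + (1 - (- 1) ^ i) * zeta_nat (k + 1 - i))
      else if i = k then (- 1) ^ k + (1 - (- 1) ^ k) * euler_mascheroni
      else (- 1) ^ (i - k - 1) / fact (i - k - 1) *
        (harm (i - k - 1) * ((- 1) ^ i + (1 - (- 1) ^ i) * real_zeta (- real (i - k - 1)))
          + (1 - (- 1) ^ i) * zeta'_int (- int (i - k - 1)))))"
proof (rule poles_cancel)
  fix i
  define n where "n = i - k - 1"
  show "((\<lambda>\<epsilon>. mellin_term k i \<epsilon> - (if i < k then 0 else if i = k then 1 - (- 1) ^ k else
         ((- 1) ^ i + (1 - (- 1) ^ i) * real_zeta (- real (i - k - 1))) / falling (i - k - 1) 0) / \<epsilon>) \<longlongrightarrow>
      (if i < k then fact (k - i) * ((- 1) ^ i + (1 - (- 1) ^ i) * zeta_nat (k + 1 - i))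
      else if i = k then (- 1) ^ k + (1 - (- 1) ^ k) * euler_mascheroni
      else (- 1) ^ (i - k - 1) / fact (i - k - 1) *
        (harm (i - k - 1) * ((- 1) ^ i + (1 - (- 1) ^ i) * real_zeta (- real (i - k - 1)))
          + (1 - (- 1) ^ i) * zeta'_int (- int (i - k - 1))))) (at_right 0)"
  proof (cases i k rule: linorder_cases)
    case less
    then show ?thesis using mellin_term_less[OF less] by simp
  next
    case equal
    then show ?thesis using mellin_term_eq[of k] by simp
  next
    case greater
    then have i: "i = n + k + 1" and "\<not> i < k" "i \<noteq> k" by (simp_all add: n_def)
    then show ?thesis using mellin_term_greater[of k n] unfolding n_def[symmetric] i[symmetric] by simp
  qed
next
  have ev: "\<forall>\<^sub>F \<epsilon> in at_right 0. (\<Prod>l=1..k+1. real k + 2 + \<epsilon> - real l) * Re (frac_mellin m (of_real (real k + 2 + \<epsilon>)))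
      = (\<Sum>i\<le>2*m. fact i * coeff (frac_poly m) i * mellin_term k i \<epsilon>)"
    using eventually_at_right_real[of 0 "1::real"]
  proof (rule eventually_mono)
    fix \<epsilon> :: real assume \<epsilon>: "\<epsilon> \<in> {0<..<1}"
    \<comment> \<open>For \<epsilon> strictly between 0 and 1 the argument is not an integer, so it
      avoids every excluded point of the closed form.\<close>
    have nI: "real k + 2 + \<epsilon> \<noteq> real l" for l
    proof
      assume "real k + 2 + \<epsilon> = real l"
      then have "\<epsilon> = real_of_int (int l - int k - 2)" by simp
      then have "0 < int l - int k - 2" "int l - int k - 2 < 1"
        using \<epsilon> by (simp_all only: greaterThanLessThan_iff of_int_0_less_iff of_int_less_1_iff)
      then show False by linarith
    qed
    have "Re (frac_mellin m (of_real (real k + 2 + \<epsilon>))) = (\<Sum>i\<le>2*m. fact i * coeff (frac_poly m) i * ((- 1) ^ i + (1 - (- 1) ^ i) * real_zeta (real k + 2 + \<epsilon> - (real i + 1))) / (\<Prod>l=1..i+1. real k + 2 + \<epsilon> - real l))"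
      using \<epsilon> nI by (intro Re_frac_mellin) auto
    then show "(\<Prod>l=1..k+1. real k + 2 + \<epsilon> - real l) * Re (frac_mellin m (of_real (real k + 2 + \<epsilon>))) = (\<Sum>i\<le>2*m. fact i * coeff (frac_poly m) i * mellin_term k i \<epsilon>)"
      unfolding mellin_term_def by (simp only: sum_distrib_left times_divide_eq_right times_divide_eq_left mult_ac)
  qed simp
  have "isCont (frac_mellin m) (of_real (real k + 2))"
  proof -
    have "open {s. Re s > 1}" by (simp add: open_halfspace_Re_gt)
    then show ?thesis
      by (intro continuous_on_interior[OF holomorphic_on_imp_continuous_on[OF holomorphic_frac_mellin]])
         (simp add: interior_open)
  qed
  then have "((\<lambda>\<epsilon>. frac_mellin m (of_real (real k + 2 + \<epsilon>))) \<longlongrightarrow> frac_mellin m (of_real (real k + 2))) (at_right 0)"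
  proof (rule isCont_tendsto_compose)
    have "((\<lambda>\<epsilon>. complex_of_real (real k + 2 + \<epsilon>)) \<longlongrightarrow> of_real (real k + 2 + 0)) (at_right 0)"
      by (intro tendsto_intros)
    then show "((\<lambda>\<epsilon>. complex_of_real (real k + 2 + \<epsilon>)) \<longlongrightarrow> of_real (real k + 2)) (at_right 0)" by simp
  qed
  then have "((\<lambda>\<epsilon>. (\<Prod>l=1..k+1. real k + 2 + \<epsilon> - real l) * Re (frac_mellin m (of_real (real k + 2 + \<epsilon>)))) \<longlongrightarrow>
    (\<Prod>l=1..k+1. real k + 2 + 0 - real l) * Re (frac_mellin m (of_real (real k + 2)))) (at_right 0)"
    by (intro tendsto_intros)
  also have "(\<Prod>l=1..k+1. real k + 2 + 0 - real l) = fact (k + 1)"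
  proof -
    have "(\<Prod>l=1..k+1. real k + 2 + 0 - real l) = (\<Prod>r=1..k+1. real r)"
      by (intro prod.reindex_bij_witness[of _ "\<lambda>r. k + 2 - r" "\<lambda>l. k + 2 - l"]) (auto simp: of_nat_diff)
    then show ?thesis by (simp only: fact_prod of_nat_prod)
  qed
  finally show "((\<lambda>\<epsilon>. \<Sum>i\<le>2*m. fact i * coeff (frac_poly m) i * mellin_term k i \<epsilon>) \<longlongrightarrow> fact (k + 1) * frac_integral m k) (at_right 0)"
    unfolding frac_integral_eq_frac_mellin using ev by (rule Lim_transform_eventually)
qed

section \<open>Evaluation of the integrals\<close>

text \<open>The absolute value of the i-th derivative of the polynomial at 0, with the sign split
  off so that it can be absorbed by \<open>parity_sign\<close>.\<close>

definition frac_coeff :: "nat \<Rightarrow> nat \<Rightarrow> real" where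
  "frac_coeff m i = (if i < m then 0 else fact i * real (m choose (i - m)))"

lemma fact_coeff_frac_poly: "fact i * coeff (frac_poly m) i = (- 1) ^ m * (- 1) ^ i * frac_coeff m i"
proof (cases "i < m")
  case False
  then have "(- 1 :: real) ^ (i - m) = (- 1) ^ m * (- 1) ^ i"
  proof -
    have "(- 1 :: real) ^ m * (- 1) ^ i = (- 1) ^ m * ((- 1) ^ m * (- 1) ^ (i - m))"
      using False by (simp flip: power_add)
    also have "\<dots> = (- 1) ^ (i - m)" by (simp flip: power_mult_distrib mult.assoc)
    finally show ?thesis by simp
  qed
  then show ?thesis using False by (simp add: coeff_frac_poly frac_coeff_def)
qed (simp add: coeff_frac_poly frac_coeff_def)

lemma parity_sign:
  "(- 1) ^ i * ((- 1) ^ i + (1 - (- 1) ^ i) * z) = 1 - (1 - (- 1) ^ i) * (z :: real)"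
  by (cases "even i") simp_all

lemma sum_odd_terms:
  fixes f :: "nat \<Rightarrow> real"
  shows "(\<Sum>i\<le>2*m. (1 - (- 1) ^ i) * f i) = 2 * (\<Sum>j<m. f (2 * j + 1))"
  by (induction m) (simp_all add: algebra_simps)

text \<open>Both sides times \<open>fact l\<close> are the derivative of order K + l of the
  polynomial at 1, computed from the coefficients and from the symmetry. This is the hypothesis of
  \<open>harm_sum_eq_bernoulli_harm_sum\<close> for the K-th derivative.\<close>

lemma sum_binomial_coeff_higher_pderiv:
  fixes m K :: nat
  assumes K: "K \<le> 2 * m"
  defines "q \<equiv> \<lambda>n. coeff ((pderiv ^^ K) (frac_poly m)) n"
  assumes l: "l \<le> 2 * m - K"
  shows "(\<Sum>n=l..2*m-K. real (n choose l) * q n) = (- 1) ^ (K + l) * q l"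
proof -
  define p where "p = (pderiv ^^ (K + l)) (frac_poly m)"
  have p: "p = (pderiv ^^ l) ((pderiv ^^ K) (frac_poly m))" unfolding p_def add.commute[of K l] funpow_add by simp
  have binom: "pochhammer (real (Suc n)) l = fact l * real ((n + l) choose l)" for n
  proof -
    have "fact (n + l) = fact n * pochhammer (real (Suc n)) l"
      using pochhammer_product'[of "1 :: real" n l] by (simp add: pochhammer_fact add.commute)
    moreover have "real ((n + l) choose l) = fact (n + l) / (fact l * fact n)"
      using binomial_fact[of l "n + l", where ?'a = real] by simp
    ultimately show ?thesis by simp
  qed
  have cp: "coeff p n = fact l * (real ((n + l) choose l) * q (n + l))" for n
    unfolding p coeff_higher_pderiv binom q_def by simp
  have "degree p \<le> 2 * m - K - l"
  proof (rule degree_le, intro allI impI)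
    fix n assume n: "n > 2 * m - K - l"
    then have "m choose (n + (K + l) - m) = 0" using K l by (intro binomial_eq_0) linarith
    then show "coeff p n = 0" by (simp add: p_def coeff_higher_pderiv coeff_frac_poly)
  qed
  then have "(\<Sum>n\<le>degree p. coeff p n) = (\<Sum>n\<le>2*m-K-l. coeff p n)"
    by (intro sum.mono_neutral_left) (auto simp: coeff_eq_0)
  then have "poly p 1 = (\<Sum>n\<le>2*m-K-l. coeff p n)" by (simp add: poly_altdef)
  also have "\<dots> = fact l * (\<Sum>n\<le>2*m-K-l. real ((n + l) choose l) * q (n + l))"
    by (simp only: cp sum_distrib_left)
  also have "(\<Sum>n\<le>2*m-K-l. real ((n + l) choose l) * q (n + l)) = (\<Sum>n=l..2*m-K. real (n choose l) * q n)"
    using l by (intro sum.reindex_bij_witness[of _ "\<lambda>n. n - l" "\<lambda>n. n + l"]) auto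
  finally have "poly p 1 = fact l * (\<Sum>n=l..2*m-K. real (n choose l) * q n)" .
  moreover have "poly p 1 = (- 1) ^ (K + l) * poly p 0"
    unfolding p_def poly_higher_pderiv_frac_poly_0 poly_higher_pderiv_frac_poly_1 ..
  moreover have "poly p 0 = fact l * q l"
    using cp[of 0] by (simp add: poly_0_coeff_0)
  ultimately show ?thesis by simp
qed

lemma a_seq_term:
  "(- 1) ^ n * (harm n * (1 - (1 - (- 1) ^ i) * real_zeta (- real n)) - (1 - (- 1) ^ i) * zeta'_int (- int n))
    = (- 1) ^ n * harm n + (1 - (- 1) ^ i) * a_seq n"
  by (cases "even n") (simp_all add: a_seq_eq_even a_seq_eq_odd algebra_simps)

lemma b_seq_eq: "b_seq n = a_seq n - bernoulli_harm n"
  by (simp add: b_seq_def bernoulli_harm_def)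

lemma frac_integral_expansion':
  "fact (k + 1) * frac_integral m k = (- 1) ^ m * (\<Sum>i\<le>2*m. frac_coeff m i *
     (if i < k then fact (k - i) * (1 - (1 - (- 1) ^ i) * zeta_nat (k + 1 - i))
      else if i = k then 1 - (1 - (- 1) ^ k) * euler_mascheroni
      else ((- 1) ^ (i - k - 1) * harm (i - k - 1) + (1 - (- 1) ^ i) * a_seq (i - k - 1)) / fact (i - k - 1)))"
proof -
  have "fact i * coeff (frac_poly m) i *
     (if i < k then fact (k - i) * ((- 1) ^ i + (1 - (- 1) ^ i) * zeta_nat (k + 1 - i))
      else if i = k then (- 1) ^ k + (1 - (- 1) ^ k) * euler_mascheroni
      else (- 1) ^ (i - k - 1) / fact (i - k - 1) *
        (harm (i - k - 1) * ((- 1) ^ i + (1 - (- 1) ^ i) * real_zeta (- real (i - k - 1)))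
          + (1 - (- 1) ^ i) * zeta'_int (- int (i - k - 1))))
    = (- 1) ^ m * (frac_coeff m i *
     (if i < k then fact (k - i) * (1 - (1 - (- 1) ^ i) * zeta_nat (k + 1 - i))
      else if i = k then 1 - (1 - (- 1) ^ k) * euler_mascheroni
      else ((- 1) ^ (i - k - 1) * harm (i - k - 1) + (1 - (- 1) ^ i) * a_seq (i - k - 1)) / fact (i - k - 1)))"
    (is "_ * ?L = _ * (_ * ?M)") for i
  proof -
    have "(- 1) ^ i * ?L = ?M"
    proof (cases i k rule: linorder_cases)
      case less
      have "(- 1) ^ i * (F * X) = F * ((- 1) ^ i * X)" for F X :: real by simp
      then show ?thesis using less by (simp only: parity_sign if_True)
    next
      case equal
      then show ?thesis using parity_sign[of k euler_mascheroni] by simp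
    next
      case greater
      define n where "n = i - k - 1"
      have s: "(- 1) ^ i * (1 - (- 1) ^ i) = - (1 - (- 1 :: real) ^ i)" by (cases "even i") simp_all
      have "(- 1) ^ i * ((- 1) ^ n / F * (H * (x + y * z) + y * w)) = (- 1) ^ n * (H * ((- 1) ^ i * (x + y * z)) + ((- 1) ^ i * y) * w) / F"
        for F H x y z w :: real by (simp add: algebra_simps add_divide_distrib)
      then have "(- 1) ^ i * ((- 1) ^ n / fact n * (harm n * ((- 1) ^ i + (1 - (- 1) ^ i) * real_zeta (- real n)) + (1 - (- 1) ^ i) * zeta'_int (- int n)))
        = (- 1) ^ n * (harm n * (1 - (1 - (- 1) ^ i) * real_zeta (- real n)) + - (1 - (- 1) ^ i) * zeta'_int (- int n)) / fact n"
        by (simp only: parity_sign s)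
      also have "\<dots> = ((- 1) ^ n * harm n + (1 - (- 1) ^ i) * a_seq n) / fact n"
        using a_seq_term[of n i] by (simp only: diff_conv_add_uminus mult_minus_left)
      finally show ?thesis using greater unfolding n_def by simp
    qed
    moreover have "s * t * c * L = s * (c * M)" if "t * L = M" for s t c L M :: real
      using that by (auto simp: mult_ac)
    ultimately show ?thesis unfolding fact_coeff_frac_poly by blast
  qed
  then show ?thesis
    unfolding frac_integral_expansion sum_distrib_left by (intro sum.cong refl)
qed

text \<open>Up to sign the weights of the harmonic numbers are the coefficients of the derivative of
  order k + 1 of the polynomial. Its symmetry replaces them by \<open>bernoulli_harm\<close> with
  weights supported on odd i, where it combines with \<open>a_seq\<close> to
  \<open>b_seq\<close>.\<close>

lemma sum_harm_a_seq_eq_sum_b_seq: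
  assumes k: "k < 2 * m"
  shows "(\<Sum>i=k+1..2*m. frac_coeff m i * (((- 1) ^ (i - k - 1) * harm (i - k - 1) + (1 - (- 1) ^ i) * a_seq (i - k - 1)) / fact (i - k - 1)))
    = (\<Sum>i=k+1..2*m. (1 - (- 1) ^ i) * (frac_coeff m i * b_seq (i - k - 1) / fact (i - k - 1)))"
proof -
  define K N where "K = k + 1" and "N = 2 * m - K"
  define q where "q = (\<lambda>n. coeff ((pderiv ^^ K) (frac_poly m)) n)"
  have c: "frac_coeff m (n + K) / fact n = (- 1) ^ m * (- 1) ^ (n + K) * q n" for n
  proof -
    have "fact (n + K) = fact n * pochhammer (real (Suc n)) K"
      using pochhammer_product'[of "1 :: real" n K] by (simp add: pochhammer_fact add.commute)
    then have "q n = fact (n + K) * coeff (frac_poly m) (n + K) / fact n"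
      unfolding q_def coeff_higher_pderiv by simp
    also have "\<dots> = (- 1) ^ m * (- 1) ^ (n + K) * frac_coeff m (n + K) / fact n"
      unfolding fact_coeff_frac_poly ..
    finally have "(- 1) ^ m * (- 1) ^ (n + K) * q n = ((- 1) ^ m * (- 1) ^ m) * ((- 1) ^ (n + K) * (- 1) ^ (n + K)) * frac_coeff m (n + K) / fact n"
      by (simp only: mult_ac times_divide_eq_right times_divide_eq_left)
    also have "(- 1) ^ a * (- 1) ^ a = (1 :: real)" for a by (simp flip: power_mult_distrib)
    finally show ?thesis by simp
  qed
  have reidx: "(\<Sum>i=k+1..2*m. f i) = (\<Sum>n\<le>N. f (n + K))" for f :: "nat \<Rightarrow> real"
    using k by (intro sum.reindex_bij_witness[of _ "\<lambda>n. n + K" "\<lambda>i. i - K"]) (auto simp: K_def N_def)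
  have sub: "n + K - k - 1 = n" for n by (simp add: K_def)
  have sq: "(- 1) ^ e * (1 - (- 1) ^ e) = - (1 - (- 1 :: real) ^ e)" for e by (cases "even e") simp_all
  have "(\<Sum>n\<le>N. frac_coeff m (n + K) * (((- 1) ^ n * harm n + (1 - (- 1) ^ (n + K)) * a_seq n) / fact n))
     = (\<Sum>n\<le>N. (- 1) ^ m * ((- 1) ^ K * (q n * harm n)) - (- 1) ^ m * ((1 - (- 1) ^ (n + K)) * q n * a_seq n))"
  proof (intro sum.cong refl)
    fix n
    have "frac_coeff m (n + K) * (((- 1) ^ n * harm n + (1 - (- 1) ^ (n + K)) * a_seq n) / fact n)
       = frac_coeff m (n + K) / fact n * ((- 1) ^ n * harm n + (1 - (- 1) ^ (n + K)) * a_seq n)" by simp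
    also have "\<dots> = (- 1) ^ m * (((- 1) ^ (n + K) * (- 1) ^ n) * q n * harm n) + (- 1) ^ m * (((- 1) ^ (n + K) * (1 - (- 1) ^ (n + K))) * q n * a_seq n)"
      unfolding c by (simp add: algebra_simps)
    also have "(- 1) ^ (n + K) * (- 1) ^ n = (- 1 :: real) ^ K"
      by (cases "even n") (simp_all add: power_add)
    finally show "frac_coeff m (n + K) * (((- 1) ^ n * harm n + (1 - (- 1) ^ (n + K)) * a_seq n) / fact n)
       = (- 1) ^ m * ((- 1) ^ K * (q n * harm n)) - (- 1) ^ m * ((1 - (- 1) ^ (n + K)) * q n * a_seq n)"
      unfolding sq by (simp only: mult.assoc mult_minus_left mult_minus_right diff_conv_add_uminus)
  qed
  also have "\<dots> = (- 1) ^ m * ((- 1) ^ K * (\<Sum>n\<le>N. q n * harm n)) - (- 1) ^ m * (\<Sum>n\<le>N. (1 - (- 1) ^ (n + K)) * q n * a_seq n)"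
    by (simp only: sum_subtractf sum_distrib_left)
  also have "(- 1) ^ K * (\<Sum>n\<le>N. q n * harm n) = (\<Sum>n\<le>N. (1 - (- 1) ^ (n + K)) * q n * bernoulli_harm n)"
    unfolding q_def N_def using k
    by (intro harm_sum_eq_bernoulli_harm_sum sum_binomial_coeff_higher_pderiv) (auto simp: K_def)
  also have "(- 1) ^ m * (\<Sum>n\<le>N. (1 - (- 1) ^ (n + K)) * q n * bernoulli_harm n) - (- 1) ^ m * (\<Sum>n\<le>N. (1 - (- 1) ^ (n + K)) * q n * a_seq n)
     = (\<Sum>n\<le>N. (- 1) ^ m * (- (1 - (- 1) ^ (n + K))) * (q n * b_seq n))"
    unfolding b_seq_eq by (simp add: sum_distrib_left sum_subtractf[symmetric] algebra_simps)
  also have "\<dots> = (\<Sum>n\<le>N. (1 - (- 1) ^ (n + K)) * (frac_coeff m (n + K) * b_seq n / fact n))"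
  proof (intro sum.cong refl)
    fix n
    have "(1 - (- 1) ^ (n + K)) * (frac_coeff m (n + K) * b_seq n / fact n) = (1 - (- 1) ^ (n + K)) * (frac_coeff m (n + K) / fact n) * b_seq n" by simp
    also have "\<dots> = (- 1) ^ m * ((- 1) ^ (n + K) * (1 - (- 1) ^ (n + K))) * (q n * b_seq n)"
      unfolding c by (simp only: mult_ac)
    finally show "(- 1) ^ m * (- (1 - (- 1) ^ (n + K))) * (q n * b_seq n) = (1 - (- 1) ^ (n + K)) * (frac_coeff m (n + K) * b_seq n / fact n)"
      unfolding sq ..
  qed
  finally show ?thesis unfolding reidx sub .
qed

section \<open>From factorials to reciprocal binomial coefficients\<close>

lemma frac_coeff_fact:
  assumes "m \<le> i" "i \<le> k"
  shows "frac_coeff m i * fact (k - i) / fact (k + 1) = real (m choose (i - m)) / ((real k + 1) * real (k choose i))"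
proof -
  have "real (k choose i) = fact k / (fact i * fact (k - i))" using assms by (intro binomial_fact)
  moreover have "fact (k + 1) = (real k + 1) * fact k" by simp
  ultimately show ?thesis using assms by (simp add: frac_coeff_def add.commute mult_ac)
qed

lemma sum_frac_coeff_zeta:
  assumes "a \<le> m" "2 * a \<le> k + 1"
  shows "(\<Sum>j<a. frac_coeff m (2*j+1) * (fact (k - (2*j+1)) * zeta_nat (k - 2*j))) / fact (k + 1)
    = 1 / (real k + 1) * (\<Sum>j\<in>{m div 2..<a}. real (m choose (2 * j + 1 - m)) / real (k choose (2 * j + 1)) * zeta_nat (k - 2 * j))"
proof -
  have "(\<Sum>j<a. frac_coeff m (2*j+1) * (fact (k - (2*j+1)) * zeta_nat (k - 2*j))) / fact (k + 1)
    = (\<Sum>j<a. frac_coeff m (2*j+1) * fact (k - (2*j+1)) / fact (k + 1) * zeta_nat (k - 2*j))"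
    by (simp only: sum_divide_distrib mult.assoc times_divide_eq_left)
  also have "\<dots> = (\<Sum>j\<in>{m div 2..<a}. frac_coeff m (2*j+1) * fact (k - (2*j+1)) / fact (k + 1) * zeta_nat (k - 2*j))"
  proof (rule sum.mono_neutral_right)
    show "\<forall>j\<in>{..<a} - {m div 2..<a}. frac_coeff m (2*j+1) * fact (k - (2*j+1)) / fact (k + 1) * zeta_nat (k - 2*j) = 0"
    proof
      fix j assume "j \<in> {..<a} - {m div 2..<a}"
      \<comment> \<open>The polynomial has no coefficient below m, which is where the lower limit
        \<open>m div 2\<close> comes from.\<close>
      then have "2 * j + 1 < m" by auto
      then show "frac_coeff m (2*j+1) * fact (k - (2*j+1)) / fact (k + 1) * zeta_nat (k - 2*j) = 0"
        by (simp add: frac_coeff_def)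
    qed
  qed auto
  also have "\<dots> = (\<Sum>j\<in>{m div 2..<a}. 1 / (real k + 1) * (real (m choose (2 * j + 1 - m)) / real (k choose (2 * j + 1)) * zeta_nat (k - 2 * j)))"
  proof (intro sum.cong refl)
    fix j assume "j \<in> {m div 2..<a}"
    then have "m \<le> 2 * j + 1" "2 * j + 1 \<le> k" using assms by auto
    from frac_coeff_fact[OF this]
    show "frac_coeff m (2*j+1) * fact (k - (2*j+1)) / fact (k + 1) * zeta_nat (k - 2*j) = 1 / (real k + 1) * (real (m choose (2 * j + 1 - m)) / real (k choose (2 * j + 1)) * zeta_nat (k - 2 * j))"
      by simp
  qed
  also have "\<dots> = 1 / (real k + 1) * (\<Sum>j\<in>{m div 2..<a}. real (m choose (2 * j + 1 - m)) / real (k choose (2 * j + 1)) * zeta_nat (k - 2 * j))"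
    by (simp only: sum_distrib_left)
  finally show ?thesis .
qed

lemma sum_frac_coeff_b_seq:
  assumes k: "k < 2 * m"
  shows "(\<Sum>i=k+1..2*m. (1 - (- 1) ^ i) * (frac_coeff m i * b_seq (i - k - 1) / fact (i - k - 1))) / fact (k + 1)
    = (real k + 2) * b_sum m k"
proof -
  \<comment> \<open>Cutting off at k allows the sum to start at 0, so that
    \<open>sum_odd_terms\<close> can extract the odd indices.\<close>
  define h where "h = (\<lambda>i. if i \<le> k then 0 else frac_coeff m i * b_seq (i - k - 1) / fact (i - k - 1))"
  have "(\<Sum>i=k+1..2*m. (1 - (- 1) ^ i) * (frac_coeff m i * b_seq (i - k - 1) / fact (i - k - 1))) = (\<Sum>i=k+1..2*m. (1 - (- 1) ^ i) * h i)"
    by (intro sum.cong) (auto simp: h_def)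
  also have "\<dots> = (\<Sum>i\<le>2*m. (1 - (- 1) ^ i) * h i)"
    by (rule sum.mono_neutral_left) (auto simp: h_def)
  also have "\<dots> = 2 * (\<Sum>j<m. h (2 * j + 1))" by (rule sum_odd_terms)
  also have "(\<Sum>j<m. h (2 * j + 1)) = (\<Sum>j\<in>{m div 2..<m}. h (2 * j + 1))"
  proof (rule sum.mono_neutral_right)
    show "\<forall>j\<in>{..<m} - {m div 2..<m}. h (2 * j + 1) = 0"
    proof
      fix j assume "j \<in> {..<m} - {m div 2..<m}"
      then have "2 * j + 1 < m" by auto
      then show "h (2 * j + 1) = 0" by (simp add: frac_coeff_def h_def)
    qed
  qed auto
  also have "\<dots> = (\<Sum>j=m div 2 + 1..m. h (2 * j - 1))"
    by (intro sum.reindex_bij_witness[of _ "\<lambda>j. j - 1" "\<lambda>j. j + 1"]) auto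
  finally have "(\<Sum>i=k+1..2*m. (1 - (- 1) ^ i) * (frac_coeff m i * b_seq (i - k - 1) / fact (i - k - 1))) / fact (k + 1)
    = (\<Sum>j=m div 2 + 1..m. 2 * h (2 * j - 1) / fact (k + 1))"
    by (simp only: sum_distrib_left sum_divide_distrib)
  also have "\<dots> = (\<Sum>j=m div 2 + 1..m. (real k + 2) * (real (m choose (2 * j - m - 1)) * real ((2 * j) choose (k + 2)) * (b_seq (2 * j - k - 2) / real j)))"
  proof (intro sum.cong refl)
    fix j assume j: "j \<in> {m div 2 + 1..m}"
    then have mj: "m \<le> 2 * j - 1" and j1: "j \<ge> 1" by auto
    show "2 * h (2 * j - 1) / fact (k + 1) = (real k + 2) * (real (m choose (2 * j - m - 1)) * real ((2 * j) choose (k + 2)) * (b_seq (2 * j - k - 2) / real j))"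
    \<comment> \<open>This case is the convention that a summand with vanishing binomial coefficient
      is 0; there \<open>2 * j - k - 2\<close> is a truncated difference.\<close>
    proof (cases "2 * j < k + 2")
      case True
      then show ?thesis by (simp add: h_def binomial_eq_0)
    next
      case False
      have e: "2 * j - 1 - k - 1 = 2 * j - k - 2" "2 * j - 1 - m = 2 * j - m - 1" by simp_all
      have h: "h (2 * j - 1) = fact (2 * j - 1) * real (m choose (2 * j - m - 1)) * b_seq (2 * j - k - 2) / fact (2 * j - k - 2)"
        using False mj unfolding h_def frac_coeff_def e by auto
      have b: "real ((2 * j) choose (k + 2)) = fact (2 * j) / (fact (k + 2) * fact (2 * j - k - 2))"
        using False binomial_fact[of "k + 2" "2 * j", where ?'a = real] by simp
      have f1: "fact (2 * j) = 2 * real j * fact (2 * j - 1)"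
        using j1 fact_reduce[of "2 * j", where ?'a = real] by simp
      have f2: "fact (k + 2) = (real k + 2) * fact (k + 1)" by (simp add: numeral_2_eq_2)
      have gen: "2 * (F * C * B / G) / H = r * (C * (2 * x * F / (r * H * G)) * (B / x))"
        if "r > 0" "x > 0" for F C B G H r x :: real using that by (simp add: mult_ac)
      show ?thesis unfolding h b f1 f2 using j1 by (intro gen) auto
    qed
  qed
  also have "\<dots> = (real k + 2) * b_sum m k" unfolding b_sum_def by (simp only: sum_distrib_left)
  finally show ?thesis .
qed

lemma frac_integral_large:
  assumes k: "k \<ge> 2 * m"
  shows "frac_integral m k = (-1) ^ m *
         (1 / ((real k + 1 - real m) * real ((k - m) choose m))
          - 2 / (real k + 1) *
            (\<Sum>j\<in>{m div 2..<m}. real (m choose (2 * j + 1 - m)) / real (k choose (2 * j + 1))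
                * zeta_nat (k - 2 * j)))"
proof -
  have "fact (k + 1) * frac_integral m k = (- 1) ^ m * (\<Sum>i\<le>2*m. frac_coeff m i * (fact (k - i) * (1 - (1 - (- 1) ^ i) * zeta_nat (k + 1 - i))))"
  proof -
    have "(if i < k then fact (k - i) * (1 - (1 - (- 1) ^ i) * zeta_nat (k + 1 - i))
      else if i = k then 1 - (1 - (- 1) ^ k) * euler_mascheroni
      else ((- 1) ^ (i - k - 1) * harm (i - k - 1) + (1 - (- 1) ^ i) * a_seq (i - k - 1)) / fact (i - k - 1))
       = fact (k - i) * (1 - (1 - (- 1) ^ i) * zeta_nat (k + 1 - i))" if "i \<in> {..2*m}" for i
    proof (cases "i < k")
      case False
      \<comment> \<open>At this boundary k is even, so the coefficient of
        \<open>euler_mascheroni\<close> vanishes and the term agrees with the regular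
        pattern.\<close>
      then have "i = k" "k = 2 * m" using that k by auto
      then show ?thesis by simp
    qed simp
    then show ?thesis
      unfolding frac_integral_expansion' by (intro arg_cong2[where f = "(*)"] sum.cong refl)
  qed
  also have "(\<Sum>i\<le>2*m. frac_coeff m i * (fact (k - i) * (1 - (1 - (- 1) ^ i) * zeta_nat (k + 1 - i))))
     = (\<Sum>i\<le>2*m. frac_coeff m i * fact (k - i)) - (\<Sum>i\<le>2*m. (1 - (- 1) ^ i) * (frac_coeff m i * (fact (k - i) * zeta_nat (k + 1 - i))))"
    by (simp add: sum_subtractf[symmetric] algebra_simps)
  also have "(\<Sum>i\<le>2*m. (1 - (- 1) ^ i) * (frac_coeff m i * (fact (k - i) * zeta_nat (k + 1 - i)))) = 2 * (\<Sum>j<m. frac_coeff m (2*j+1) * (fact (k - (2*j+1)) * zeta_nat (k - 2*j)))"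
    unfolding sum_odd_terms by simp
  also have "(\<Sum>i\<le>2*m. frac_coeff m i * fact (k - i)) = fact (k + 1) * (1 / ((real k + 1 - real m) * real ((k - m) choose m)))"
  proof -
    have "(\<Sum>i\<le>2*m. frac_coeff m i * fact (k - i)) = (\<Sum>i=m..2*m. frac_coeff m i * fact (k - i))"
      by (rule sum.mono_neutral_right) (auto simp: frac_coeff_def)
    also have "\<dots> = (\<Sum>l\<le>m. frac_coeff m (m + l) * fact (k - (m + l)))"
      by (rule sum.reindex_bij_witness[of _ "\<lambda>l. m + l" "\<lambda>i. i - m"]) auto
    also have "\<dots> = (\<Sum>l\<le>m. fact (k + 1) * (real (m choose l) * fact_beta (m + l) (k - 2 * m + m - l)))"
    proof (intro sum.cong refl)
      fix l assume "l \<in> {..m}"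
      then have "k - 2 * m + m - l = k - (m + l)" "m + l + (k - (m + l)) = k" using k by auto
      then show "frac_coeff m (m + l) * fact (k - (m + l)) = fact (k + 1) * (real (m choose l) * fact_beta (m + l) (k - 2 * m + m - l))"
        by (simp add: frac_coeff_def fact_beta_def del: fact_Suc)
    qed
    also have "\<dots> = fact (k + 1) * fact_beta m (k - 2 * m)"
      by (simp only: sum_distrib_left[symmetric] sum_binomial_fact_beta)
    also have "fact_beta m (k - 2 * m) = 1 / ((real k + 1 - real m) * real ((k - m) choose m))"
    proof -
      have e: "m + (k - 2 * m) + 1 = Suc (k - m)" "k - m - m = k - 2 * m" using k by auto
      have "real ((k - m) choose m) = fact (k - m) / (fact m * fact (k - 2 * m))"
        using k binomial_fact[of m "k - m", where ?'a = real] unfolding e by simp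
      moreover have "fact (Suc (k - m)) = (real k + 1 - real m) * fact (k - m)"
        using k by (simp add: of_nat_diff algebra_simps)
      ultimately show ?thesis unfolding fact_beta_def e by simp
    qed
    finally show ?thesis .
  qed
  finally have "frac_integral m k = (- 1) ^ m * (fact (k + 1) * (1 / ((real k + 1 - real m) * real ((k - m) choose m))) -
      2 * (\<Sum>j<m. frac_coeff m (2*j+1) * (fact (k - (2*j+1)) * zeta_nat (k - 2*j)))) / fact (k + 1)"
    by (simp add: eq_divide_eq mult.commute del: fact_Suc)
  also have "\<dots> = (- 1) ^ m * (1 / ((real k + 1 - real m) * real ((k - m) choose m)) -
      2 * ((\<Sum>j<m. frac_coeff m (2*j+1) * (fact (k - (2*j+1)) * zeta_nat (k - 2*j))) / fact (k + 1)))"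
  proof -
    have gen: "s * (F * x - 2 * y) / F = s * (x - 2 * (y / F))" if "F > 0" for s F x y :: real
      using that by (simp add: diff_divide_distrib right_diff_distrib)
    show ?thesis by (rule gen) simp
  qed
  also have "(\<Sum>j<m. frac_coeff m (2*j+1) * (fact (k - (2*j+1)) * zeta_nat (k - 2*j))) / fact (k + 1)
    = 1 / (real k + 1) * (\<Sum>j\<in>{m div 2..<m}. real (m choose (2 * j + 1 - m)) / real (k choose (2 * j + 1)) * zeta_nat (k - 2 * j))"
    using k by (intro sum_frac_coeff_zeta) auto
  finally show ?thesis by simp
qed

text \<open>The common form of the three cases below 2m, which differ only in how the first sum is
  evaluated and in which parts vanish.\<close>

lemma frac_integral_small:
  assumes k: "k < 2 * m"
  shows "frac_integral m k = (- 1) ^ m * ((\<Sum>i\<le>k. frac_coeff m i * fact (k - i)) / fact (k + 1)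
     - 2 / (real k + 1) * (\<Sum>j\<in>{m div 2..<k div 2}. real (m choose (2 * j + 1 - m)) / real (k choose (2 * j + 1)) * zeta_nat (k - 2 * j))
     - (1 - (- 1) ^ k) * euler_mascheroni * (frac_coeff m k / fact (k + 1))
     + (real k + 2) * b_sum m k)"
proof -
  define M where "M = (\<lambda>i. if i < k then fact (k - i) * (1 - (1 - (- 1) ^ i) * zeta_nat (k + 1 - i))
      else if i = k then 1 - (1 - (- 1) ^ k) * euler_mascheroni
      else ((- 1) ^ (i - k - 1) * harm (i - k - 1) + (1 - (- 1) ^ i) * a_seq (i - k - 1)) / fact (i - k - 1))"
  have "{..2*m} = {..k} \<union> {k+1..2*m}" using k by auto
  then have "(\<Sum>i\<le>2*m. frac_coeff m i * M i) = (\<Sum>i\<le>k. frac_coeff m i * M i) + (\<Sum>i=k+1..2*m. frac_coeff m i * M i)"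
    by (simp add: sum.union_disjoint)
  also have "(\<Sum>i=k+1..2*m. frac_coeff m i * M i) = fact (k + 1) * ((real k + 2) * b_sum m k)"
  proof -
    have "(\<Sum>i=k+1..2*m. frac_coeff m i * M i) = (\<Sum>i=k+1..2*m. frac_coeff m i * (((- 1) ^ (i - k - 1) * harm (i - k - 1) + (1 - (- 1) ^ i) * a_seq (i - k - 1)) / fact (i - k - 1)))"
      by (intro sum.cong refl) (auto simp: M_def)
    also have "\<dots> = (\<Sum>i=k+1..2*m. (1 - (- 1) ^ i) * (frac_coeff m i * b_seq (i - k - 1) / fact (i - k - 1)))"
      by (rule sum_harm_a_seq_eq_sum_b_seq[OF k])
    finally show ?thesis using sum_frac_coeff_b_seq[OF k] by (simp add: divide_eq_eq mult.commute del: fact_Suc)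
  qed
  also have "(\<Sum>i\<le>k. frac_coeff m i * M i) = (\<Sum>i<k. frac_coeff m i * M i) + frac_coeff m k * (1 - (1 - (- 1) ^ k) * euler_mascheroni)"
    by (simp add: M_def lessThan_Suc_atMost[symmetric])
  also have "(\<Sum>i<k. frac_coeff m i * M i) = (\<Sum>i<k. frac_coeff m i * fact (k - i)) - (\<Sum>i<k. (1 - (- 1) ^ i) * (frac_coeff m i * (fact (k - i) * zeta_nat (k + 1 - i))))"
    by (simp add: M_def sum_subtractf[symmetric] algebra_simps)
  also have "(\<Sum>i<k. (1 - (- 1) ^ i) * (frac_coeff m i * (fact (k - i) * zeta_nat (k + 1 - i)))) = 2 * (\<Sum>j<k div 2. frac_coeff m (2*j+1) * (fact (k - (2*j+1)) * zeta_nat (k - 2*j)))"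
  proof -
    define f where "f = (\<lambda>i. frac_coeff m i * (fact (k - i) * zeta_nat (k + 1 - i)))"
    \<comment> \<open>For even k the added index k has weight 0; for odd k the bound
      \<open>2 * (k div 2)\<close> equals k - 1. Hence zeta is only taken at arguments that are at
      least 2.\<close>
    have "(\<Sum>i<k. (1 - (- 1) ^ i) * f i) = (\<Sum>i\<le>2*(k div 2). (1 - (- 1) ^ i) * f i)"
    proof (cases "even k")
      case True
      then have "2 * (k div 2) = k" by simp
      then show ?thesis using True by (simp add: lessThan_Suc_atMost[symmetric])
    next
      case False
      then have "{..<k} = {..2*(k div 2)}" by (auto elim!: oddE)
      then show ?thesis by simp
    qed
    then show ?thesis unfolding sum_odd_terms f_def by simp
  qed
  finally have S: "(\<Sum>i\<le>2*m. frac_coeff m i * M i) = (\<Sum>i<k. frac_coeff m i * fact (k - i))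
     - 2 * (\<Sum>j<k div 2. frac_coeff m (2*j+1) * (fact (k - (2*j+1)) * zeta_nat (k - 2*j)))
     + frac_coeff m k * (1 - (1 - (- 1) ^ k) * euler_mascheroni) + fact (k + 1) * ((real k + 2) * b_sum m k)" .
  have T: "(\<Sum>i<k. frac_coeff m i * fact (k - i)) = (\<Sum>i\<le>k. frac_coeff m i * fact (k - i)) - frac_coeff m k"
    by (simp add: lessThan_Suc_atMost[symmetric])
  have "fact (k + 1) * frac_integral m k = (- 1) ^ m * (\<Sum>i\<le>2*m. frac_coeff m i * M i)"
    unfolding M_def by (rule frac_integral_expansion')
  then have "frac_integral m k = (- 1) ^ m * ((\<Sum>i\<le>2*m. frac_coeff m i * M i) / fact (k + 1))"
    by (simp add: eq_divide_eq mult.commute del: fact_Suc)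
  also have "(\<Sum>i\<le>2*m. frac_coeff m i * M i) / fact (k + 1) = (\<Sum>i\<le>k. frac_coeff m i * fact (k - i)) / fact (k + 1)
     - 2 * ((\<Sum>j<k div 2. frac_coeff m (2*j+1) * (fact (k - (2*j+1)) * zeta_nat (k - 2*j))) / fact (k + 1))
     - (1 - (- 1) ^ k) * euler_mascheroni * (frac_coeff m k / fact (k + 1))
     + (real k + 2) * b_sum m k"
    unfolding S T by (simp add: diff_divide_distrib add_divide_distrib right_diff_distrib mult_ac del: fact_Suc)
  also have "(\<Sum>j<k div 2. frac_coeff m (2*j+1) * (fact (k - (2*j+1)) * zeta_nat (k - 2*j))) / fact (k + 1)
    = 1 / (real k + 1) * (\<Sum>j\<in>{m div 2..<k div 2}. real (m choose (2 * j + 1 - m)) / real (k choose (2 * j + 1)) * zeta_nat (k - 2 * j))"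
    using k by (intro sum_frac_coeff_zeta) auto
  finally show ?thesis by simp
qed

lemma sum_frac_coeff_p_sum: "(\<Sum>i\<le>k. frac_coeff m i * fact (k - i)) / fact (k + 1) = p_sum m k / (real k + 1)"
proof -
  have "(\<Sum>i\<le>k. frac_coeff m i * fact (k - i)) / fact (k + 1) = (\<Sum>i\<le>k. frac_coeff m i * fact (k - i) / fact (k + 1))"
    by (rule sum_divide_distrib)
  also have "\<dots> = (\<Sum>i=m..k. frac_coeff m i * fact (k - i) / fact (k + 1))"
    by (rule sum.mono_neutral_right) (auto simp: frac_coeff_def)
  also have "\<dots> = (\<Sum>i=m..k. real (m choose (i - m)) / real (k choose i) / (real k + 1))"
  proof (intro sum.cong refl)
    fix i assume "i \<in> {m..k}"
    then show "frac_coeff m i * fact (k - i) / fact (k + 1) = real (m choose (i - m)) / real (k choose i) / (real k + 1)"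
      using frac_coeff_fact[of m i k] by (simp add: mult.commute del: fact_Suc)
  qed
  also have "\<dots> = p_sum m k / (real k + 1)"
    unfolding p_sum_def by (simp only: sum_divide_distrib)
  finally show ?thesis .
qed

text \<open>For k = 2m - 1 the summand l = m of the full binomial expansion is missing, so the sum
  is a difference of harmonic numbers and not a single reciprocal binomial coefficient.\<close>

lemma sum_frac_coeff_harm:
  assumes "m \<ge> 1"
  shows "(\<Sum>i\<le>2*m-1. frac_coeff m i * fact (2*m-1 - i)) / fact (2*m) = harm (2 * m) - harm m"
proof -
  have "(\<Sum>i\<le>2*m-1. frac_coeff m i * fact (2*m-1 - i)) / fact (2*m) = (\<Sum>i\<le>2*m-1. frac_coeff m i * fact (2*m-1 - i) / fact (2*m))"
    by (rule sum_divide_distrib)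
  also have "\<dots> = (\<Sum>i=m..2*m-1. frac_coeff m i * fact (2*m-1 - i) / fact (2*m))"
    by (rule sum.mono_neutral_right) (auto simp: frac_coeff_def)
  also have "\<dots> = (\<Sum>l<m. frac_coeff m (m + l) * fact (2*m-1 - (m + l)) / fact (2*m))"
    using assms by (intro sum.reindex_bij_witness[of _ "\<lambda>l. m + l" "\<lambda>i. i - m"]) auto
  also have "\<dots> = (\<Sum>l<m. real (m choose l) * fact_beta (m + l) (m - 1 - l))"
  proof (intro sum.cong refl)
    fix l assume "l \<in> {..<m}"
    then have e: "2 * m - 1 - (m + l) = m - 1 - l" "m + l + (m - 1 - l) + 1 = 2 * m" by auto
    show "frac_coeff m (m + l) * fact (2*m-1 - (m + l)) / fact (2*m) = real (m choose l) * fact_beta (m + l) (m - 1 - l)"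
      unfolding fact_beta_def e frac_coeff_def by simp
  qed
  also have "\<dots> = harm (m + m) - harm m" by (rule sum_binomial_fact_beta_harm)
  finally show ?thesis by (simp add: mult_2)
qed

theorem theorem4:
  fixes m k :: nat
  assumes "m \<ge> 1"
  shows
    "(k \<ge> 2 * m \<longrightarrow>
       frac_integral m k = (-1) ^ m *
         (1 / ((real k + 1 - real m) * real ((k - m) choose m))
          - 2 / (real k + 1) *
            (\<Sum>j\<in>{m div 2..<m}. real (m choose (2 * j + 1 - m)) / real (k choose (2 * j + 1))
                * zeta_nat (k - 2 * j)))) \<and>
     (k = 2 * m - 1 \<longrightarrow>
       frac_integral m k = (-1) ^ m *
         (harm (2 * m) - harm m - euler_mascheroni
          - 1 / real m *
            (\<Sum>j\<in>{m div 2..<m - 1}. real (m choose (2 * j + 1 - m))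
                / real ((2 * m - 1) choose (2 * j + 1)) * zeta_nat (2 * m - 1 - 2 * j)))) \<and>
     (m \<le> k \<and> k \<le> 2 * m - 2 \<longrightarrow>
       frac_integral m k = (-1) ^ m / (real k + 1) *
         (p_sum m k
          - 2 * (\<Sum>j\<in>{m div 2..<k div 2}. real (m choose (2 * j + 1 - m))
                / real (k choose (2 * j + 1)) * zeta_nat (k - 2 * j))
          - 2 * euler_mascheroni * real (m choose (2 * m - k))
            * delta ((real k + 1) / 2) (of_int \<lfloor>(real k + 1) / 2\<rfloor>))
         + (-1) ^ m * (real k + 2) * b_sum m k) \<and>
     (k \<le> m - 1 \<longrightarrow>
       frac_integral m k = (-1) ^ m * (real k + 2) * b_sum m k)"
proof (intro conjI impI)
  assume "k \<ge> 2 * m"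
  then show "frac_integral m k = (-1) ^ m *
         (1 / ((real k + 1 - real m) * real ((k - m) choose m))
          - 2 / (real k + 1) *
            (\<Sum>j\<in>{m div 2..<m}. real (m choose (2 * j + 1 - m)) / real (k choose (2 * j + 1))
                * zeta_nat (k - 2 * j)))"
    by (rule frac_integral_large)
next
  assume k: "k = 2 * m - 1"
  then have k': "k < 2 * m" "k + 1 = 2 * m" "odd k" "k div 2 = m - 1" using assms by auto
  have rk: "real k + 1 = 2 * real m"
    using arg_cong[OF k'(2), of real] by simp
  have bs: "b_sum m k = 0"
    unfolding b_sum_def
  proof (rule sum.neutral, rule ballI)
    fix j assume "j \<in> {m div 2 + 1..m}"
    \<comment> \<open>Here k + 2 = 2m + 1 exceeds every index 2j, so the whole b-sum
      vanishes.\<close>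
    then have "2 * j < k + 2" using k' by auto
    then show "real (m choose (2 * j - m - 1)) * real ((2 * j) choose (k + 2)) * (b_seq (2 * j - k - 2) / real j) = 0"
      by (simp add: binomial_eq_0)
  qed
  have fc: "(1 - (- 1) ^ k) * euler_mascheroni * (frac_coeff m k / fact (k + 1)) = euler_mascheroni"
  proof -
    have "frac_coeff m k = fact k * real m"
      using k assms binomial_symmetric[of "m - 1" m] by (simp add: frac_coeff_def)
    moreover have "fact (k + 1) = (2 * real m) * fact k" using rk by (simp add: add.commute)
    ultimately show ?thesis using k'(3) assms by simp
  qed
  have "(\<Sum>i\<le>k. frac_coeff m i * fact (k - i)) / fact (k + 1) = harm (2 * m) - harm m"
    using sum_frac_coeff_harm[OF assms] unfolding k'(2) by (simp only: k)
  then have "frac_integral m k = (- 1) ^ m * (harm (2 * m) - harm m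
     - 2 / (2 * real m) * (\<Sum>j\<in>{m div 2..<m - 1}. real (m choose (2 * j + 1 - m)) / real (k choose (2 * j + 1)) * zeta_nat (k - 2 * j))
     - euler_mascheroni)"
    unfolding frac_integral_small[OF k'(1)] fc bs k'(4) rk by simp
  then show "frac_integral m k = (-1) ^ m *
         (harm (2 * m) - harm m - euler_mascheroni
          - 1 / real m *
            (\<Sum>j\<in>{m div 2..<m - 1}. real (m choose (2 * j + 1 - m))
                / real ((2 * m - 1) choose (2 * j + 1)) * zeta_nat (2 * m - 1 - 2 * j)))"
    unfolding k by simp
next
  assume mk: "m \<le> k \<and> k \<le> 2 * m - 2"
  then have k: "k < 2 * m" using assms by auto
  have c: "(1 - (- 1) ^ k) * euler_mascheroni * (frac_coeff m k / fact (k + 1))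
     = 2 * euler_mascheroni * real (m choose (2 * m - k)) * delta ((real k + 1) / 2) (of_int \<lfloor>(real k + 1) / 2\<rfloor>) / (real k + 1)"
  proof -
    have "frac_coeff m k / fact (k + 1) = real (m choose (k - m)) / (real k + 1)"
      using frac_coeff_fact[of m k k] mk by simp
    also have "m choose (k - m) = m choose (2 * m - k)"
    proof -
      have "k - m \<le> m" "m - (k - m) = 2 * m - k" using mk by auto
      then show ?thesis using binomial_symmetric[of "k - m" m] by simp
    qed
    finally have 1: "frac_coeff m k / fact (k + 1) = real (m choose (2 * m - k)) / (real k + 1)" .
    \<comment> \<open>The \<open>delta\<close> factor tests whether (k + 1) / 2 is an integer, that
      is, whether k is odd.\<close>
    have 2: "1 - (- 1) ^ k = 2 * delta ((real k + 1) / 2) (of_int \<lfloor>(real k + 1) / 2\<rfloor>)"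
    proof (cases "even k")
      case True
      then obtain j where "k = 2 * j" by (auto elim: evenE)
      then have half: "(real k + 1) / 2 = real j + 1 / 2" by simp
      have floor: "\<lfloor>real j + 1 / 2\<rfloor> = int j" by linarith
      show ?thesis unfolding half floor using True by (simp add: delta_def)
    next
      case False
      then obtain j where "k = 2 * j + 1" by (auto elim: oddE)
      then have "(real k + 1) / 2 = of_int (int j + 1)" by simp
      then show ?thesis using False by (simp only: delta_def floor_of_int) simp
    qed
    show ?thesis unfolding 1 2 by simp
  qed
  show "frac_integral m k = (-1) ^ m / (real k + 1) *
         (p_sum m k
          - 2 * (\<Sum>j\<in>{m div 2..<k div 2}. real (m choose (2 * j + 1 - m))
                / real (k choose (2 * j + 1)) * zeta_nat (k - 2 * j))
          - 2 * euler_mascheroni * real (m choose (2 * m - k))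
            * delta ((real k + 1) / 2) (of_int \<lfloor>(real k + 1) / 2\<rfloor>))
         + (-1) ^ m * (real k + 2) * b_sum m k"
    unfolding frac_integral_small[OF k] c sum_frac_coeff_p_sum
    by (simp add: diff_divide_distrib right_diff_distrib distrib_left mult_ac)
next
  assume k: "k \<le> m - 1"
  then have "k < m" using assms by linarith
  \<comment> \<open>The second inequality empties the zeta sum. As all indices up to k lie below m,
    the rational part and the \<open>euler_mascheroni\<close> term vanish as well.\<close>
  then have "k < 2 * m" "k div 2 \<le> m div 2" by auto
  moreover have "(\<Sum>i\<le>k. frac_coeff m i * fact (k - i)) = 0" "frac_coeff m k = 0"
    using \<open>k < m\<close> by (auto simp: frac_coeff_def intro!: sum.neutral)
  ultimately show "frac_integral m k = (-1) ^ m * (real k + 2) * b_sum m k"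
    by (simp add: frac_integral_small)
qed

end
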